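(* Let $L>0$, let $\beta:[0,L]\to\mathbb{R}$ be Lebesgue measurable, let $(x_0,y_0)\in\mathbb{R}^2$, and let $\gamma:[0,L]\to\mathbb{R}^2$ be the path $$\gamma_t=\Big(x_0+\int_0^t\cos\beta_s\,ds,\; y_0+\int_0^t\sin\beta_s\,ds\Big).$$ Suppose that $\gamma$ is strongly tree-reduced. Then $$\mathrm{Length}(\gamma)=\lim_{n\to\infty}\Big\| n!\int_{0<t_1<\cdots<t_n<L}d\gamma_{t_1}\otimes\cdots\otimes d\gamma_{t_n}\Big\|^{1/n}.$$
   Context: $\mathbb{R}^2$ carries the Euclidean norm $|\cdot|$ and, for $n\ge 1$, $\|\cdot\|$ on $(\mathbb{R}^2)^{\otimes n}$ is the projective tensor norm $\|\xi\|=\inf\{\sum_i|v_1^i|\cdots|v_n^i| : \xi=\sum_i v_1^i\otimes\cdots\otimes v_n^i\}$ (infimum over finite representations). The path $\gamma$ is parametrised at unit speed, so $\mathrm{Length}(\gamma)=L$. $\mu$ denotes Lebesgue measure. Regular cusp: for a closed interval $[u,v]\subseteq[0,L]$ with $u<v$, the restriction $\gamma|_{[u,v]}$ is a regular cusp if (i) there is $a\in\mathbb{R}$ such that $\beta_t\in[a,a+\pi]$ for a.a. $t\in[u,v]$; and (ii) for every $\delta>0$ there are a closed subset $F\subseteq[u,v]$ which is a finite disjoint union of closed intervals, and real numbers $a_\delta>a$, $b_\delta<a+\pi$, such that $\mu([u,v]\setminus F)<\delta$ and $\beta_t\in[a_\delta,b_\delta]$ for a.a. $t\in F$ (with the same $a$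 as in (i)). Strongly tree-reduced: $\gamma$ is strongly tree-reduced if for every $t\in(0,L)$ there is a neighbourhood $(u_t,v_t)$ of $t$ such that $\gamma|_{[u_t,v_t]\cap[0,L]}$ is a regular cusp. *)

theory Defs
  imports "HOL-Analysis.Analysis"
begin

text \<open>The supremum is taken in the reals, so this is the length only for rectifiable paths.\<close>
definition path_length :: "(real \<Rightarrow> 'a::real_normed_vector) \<Rightarrow> real \<Rightarrow> real \<Rightarrow> real" where
  "path_length g a b =
     Sup {(\<Sum>k\<in>d. norm (g (Sup k) - g (Inf k))) | d. d division_of {a..b}}"

text \<open>
  The Stieltjes integral of f against dg over an interval, as the limit of the sums of
  f (tag) times the increment of g, along the filter that defines the Henstock-Kurzweil
  integral.  For continuous f and g of bounded variation this is the Riemann-Stieltjes integral.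
\<close>
definition stieltjes_integral :: "real \<Rightarrow> real \<Rightarrow> (real \<Rightarrow> real) \<Rightarrow> (real \<Rightarrow> real) \<Rightarrow> real" where
  "stieltjes_integral a b f g =
     Lim (division_filter {a..b}) (\<lambda>p. \<Sum>(x, k)\<in>p. f x * (g (Sup k) - g (Inf k)))"

text \<open>
  A tensor of order n over the space of dimension CARD('d) is given by its coordinates in the
  standard basis, indexed by the multi-indices in \<open>{..<n} \<rightarrow>\<^sub>E UNIV\<close>; the values at other
  arguments are irrelevant.  The k-th factor of the tensor product is the one with index k,
  counting from 0.
\<close>
type_synonym 'd tensor = "(nat \<Rightarrow> 'd) \<Rightarrow> real"

definition elementary_tensor :: "nat \<Rightarrow> (nat \<Rightarrow> real ^ 'd) \<Rightarrow> 'd::finite tensor" where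
  "elementary_tensor n v = (\<lambda>I. \<Prod>k<n. v k $ I k)"

definition projective_norm :: "nat \<Rightarrow> 'd::finite tensor \<Rightarrow> real" where
  "projective_norm n \<xi> =
     Inf {(\<Sum>i<m. \<Prod>k<n. norm (v i k)) | (m::nat) (v :: nat \<Rightarrow> nat \<Rightarrow> real ^ 'd).
            \<forall>I\<in>{..<n} \<rightarrow>\<^sub>E UNIV. \<xi> I = (\<Sum>i<m. elementary_tensor n (v i) I)}"

text \<open>
  The integral of \<open>d\<gamma> \<otimes> \<dots> \<otimes> d\<gamma>\<close> (n factors) over the simplex \<open>0 < t\<^sub>1 < \<dots> < t\<^sub>n < t\<close>,
  as an iterated integral with the last time variable outermost.
\<close>
primrec iterated_integral :: "(real \<Rightarrow> real ^ 'd) \<Rightarrow> nat \<Rightarrow> real \<Rightarrow> 'd::finite tensor" where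
  "iterated_integral \<gamma> 0 t = (\<lambda>I. 1)"
| "iterated_integral \<gamma> (Suc n) t =
     (\<lambda>I. stieltjes_integral 0 t (\<lambda>s. iterated_integral \<gamma> n s I) (\<lambda>s. \<gamma> s $ I n))"

text \<open>
  The notions below are properties of the unit speed path with angle function \<open>\<beta>\<close>, that is, with
  derivative \<open>(cos \<beta>\<^sub>t, sin \<beta>\<^sub>t)\<close> at almost all t; angles are real numbers, not taken
  modulo \<open>2\<pi>\<close>.
\<close>
definition regular_cusp :: "(real \<Rightarrow> real) \<Rightarrow> real \<Rightarrow> real \<Rightarrow> bool" where
  "regular_cusp \<beta> u v \<longleftrightarrow> u < v \<and>
     (\<exists>a::real.
        (AE t in lebesgue_on {u..v}. \<beta> t \<in> {a..a + pi}) \<and>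
        (\<forall>\<delta>>0. \<exists>F a\<^sub>\<delta> b\<^sub>\<delta>.
           closed F \<and> F \<subseteq> {u..v} \<and>
           (\<exists>\<J>. finite \<J> \<and> disjoint \<J> \<and> (\<forall>J\<in>\<J>. \<exists>c d. c \<le> d \<and> J = {c..d}) \<and> F = \<Union>\<J>) \<and>
           a\<^sub>\<delta> > a \<and> b\<^sub>\<delta> < a + pi \<and>
           measure lebesgue ({u..v} - F) < \<delta> \<and>
           (AE t in lebesgue_on F. \<beta> t \<in> {a\<^sub>\<delta>..b\<^sub>\<delta>})))"

text \<open>\<open>{max u 0..min v L}\<close> is \<open>{u..v} \<inter> {0..L}\<close>.\<close>
definition strongly_tree_reduced :: "(real \<Rightarrow> real) \<Rightarrow> real \<Rightarrow> bool" where
  "strongly_tree_reduced \<beta> L \<longleftrightarrow>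
     (\<forall>t\<in>{0<..<L}. \<exists>u v. t \<in> {u<..<v} \<and> regular_cusp \<beta> (max u 0) (min v L))"

end

theory Submission
  imports Defs
begin

text \<open>
  Write \<open>w t = cis (\<beta> t)\<close> for the velocity of the path, identified with a complex number.  The \<open>n\<close>-th
  root in question is at most \<open>L\<close>, which is also the length of the path
  (\<open>projective_norm_le_power\<close>, \<open>path_length_eq\<close>); the point is the lower bound for the inferior limit.

  Functionals of norm one on tensors are obtained from words \<open>c\<close> in the two letters \<open>w\<close> and \<open>cnj w\<close>: the iterated
  integral of the letters of \<open>c\<close> is the value of such a functional on the tensor of iterated integrals.  Let \<open>max_word n\<close>
  be \<open>n!\<close> times the largest modulus of the iterated integrals of words of length \<open>n\<close>; it is at most the
  projective norm of \<open>n!\<close> times the tensor of iterated integrals.  By the shuffle product formula it is supermultiplicative, so Fekete's argument applies as soon as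
  two facts are known: some \<open>max_word n\<close> with \<open>n > 0\<close> exceeds \<open>r ^ n\<close>, for each \<open>r < L\<close>, and \<open>max_word n\<close> is
  positive for all large \<open>n\<close>.

  Both facts come from the growth of a linear equation, the development of the path in \<open>SU(1,1)\<close>, which is isomorphic to \<open>SL(2,\<real>)\<close>:
  for real \<open>l\<close> consider \<open>z' = l w cnj z\<close>.  Its solutions are \<open>P z\<^sub>0 + cnj (Q z\<^sub>0)\<close>, where \<open>P\<close> and \<open>Q\<close> are
  the power series in \<open>l\<close> whose coefficients are the integrals of the alternating words of even and of odd length.
  The square of a solution satisfies \<open>(z\<^sup>2)' = 2 l \<bar>z\<bar>\<^sup>2 w\<close>, so that its direction \<open>u\<close> is driven towards \<open>w\<close>, and
  \<open>\<bar>z\<bar>\<close> grows by the factor \<open>exp (l * \<integral> Re (w cnj u))\<close>.  For any measurable \<open>\<beta>\<close> the integral of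
  \<open>1 - (Re (w cnj u))\<^sup>2\<close> tends to 0 as \<open>l\<close> grows (\<open>alignment_square_small\<close>), so \<open>u\<close> is close to \<open>w\<close> or to \<open>- w\<close>.
  The second alternative is excluded by the cusp condition: while the angle is in \<open>[a, a + pi]\<close>, \<open>u\<close> cannot leave the
  half-plane of the arguments in \<open>[a, a + pi]\<close> (\<open>half_plane_invariant\<close>), and there it can be near \<open>- w\<close> only when \<open>w\<close> is near
  the boundary of the half-plane, which is rare by the second part of the condition.  Overlapping cusps are chained
  (\<open>defect_small_interior\<close>): in the overlap \<open>u\<close> comes close to some \<open>w\<close> in the interior of the next half-plane.  Hence
  \<open>\<bar>P\<bar> + \<bar>Q\<bar> \<ge> exp (l * (L - e))\<close> for large \<open>l\<close> (\<open>development_growth\<close>), which gives the first fact.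

  For the second fact it suffices that the \<open>n\<close> with \<open>max_word n > 0\<close> have no common divisor \<open>d \<ge> 2\<close>, since they
  form a semigroup.  If \<open>d\<close> were one, \<open>P\<close> and \<open>Q\<close> would be invariant under multiplication of the parameter by a
  primitive \<open>d\<close>-th root of unity.  For \<open>d \<ge> 3\<close> this contradicts the growth, because for a complex parameter \<open>\<mu>\<close> the
  development is bounded by \<open>exp (\<bar>Re \<mu>\<bar> * L)\<close>; for \<open>d = 2\<close> it gives \<open>Q = 0\<close>, hence \<open>\<bar>P\<bar> = 1\<close> by the identity
  \<open>\<bar>P\<bar>\<^sup>2 - \<bar>Q\<bar>\<^sup>2 = 1\<close>, again a contradiction (\<open>exists_nonzero_not_dvd\<close>).
\<close>

section \<open>Indefinite integrals of bounded measurable functions\<close>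

text \<open>
  On \<open>[0, L]\<close> the function \<open>X\<close> is an indefinite integral of the bounded measurable function \<open>x\<close>.  The calculus rules
  below hold for this relation without reference to derivatives almost everywhere.
\<close>
definition primitive :: "real \<Rightarrow> (real \<Rightarrow> 'a::euclidean_space) \<Rightarrow> (real \<Rightarrow> 'a) \<Rightarrow> bool" where
  "primitive L X x \<longleftrightarrow>
     x \<in> borel_measurable (lebesgue_on {0..L}) \<and> bounded (x ` {0..L}) \<and>
     (\<forall>s t. 0 \<le> s \<longrightarrow> s \<le> t \<longrightarrow> t \<le> L \<longrightarrow> (x has_integral (X t - X s)) {s..t})"

lemma bounded_measurable_absolutely_integrable:
  fixes x :: "real \<Rightarrow> 'a::euclidean_space"
  assumes x: "x \<in> borel_measurable (lebesgue_on {0..L})" "bounded (x ` {0..L})"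
    and "0 \<le> s" "t \<le> L"
  shows "x absolutely_integrable_on {s..t}"
proof -
  obtain K where K: "\<And>r. r \<in> {0..L} \<Longrightarrow> norm (x r) \<le> K"
    using x(2) unfolding bounded_iff by blast
  have "x absolutely_integrable_on {0..L}"
    by (rule measurable_bounded_by_integrable_imp_absolutely_integrable[where g="\<lambda>_. K"])
      (use x K in auto)
  then show ?thesis
    by (rule set_integrable_subset) (use assms in auto)
qed

lemma bounded_measurable_norm_le:
  fixes x :: "real \<Rightarrow> 'a::euclidean_space"
  assumes x: "x \<in> borel_measurable (lebesgue_on {0..L})" and K: "\<And>r. r \<in> {0..L} \<Longrightarrow> norm (x r) \<le> K"
    and st: "0 \<le> s" "s \<le> t" "t \<le> L"
  shows "norm (integral {s..t} x) \<le> K * (t - s)"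
proof -
  have b: "bounded (x ` {0..L})" using K unfolding bounded_iff by blast
  have i: "x integrable_on {s..t}"
    using bounded_measurable_absolutely_integrable[OF x b] st
      set_lebesgue_integral_eq_integral(1) by blast
  have "norm (integral (cbox s t) x) \<le> K * measure lborel (cbox s t)"
  proof (rule integrable_bound)
    show "0 \<le> K" using order_trans[OF norm_ge_zero K[of s]] st by simp
    show "x integrable_on cbox s t" using i by simp
  qed (use K st in auto)
  then show ?thesis using st by simp
qed

lemma primitiveD:
  assumes "primitive L X x"
  shows "x \<in> borel_measurable (lebesgue_on {0..L})" "bounded (x ` {0..L})"
    "\<And>s t. 0 \<le> s \<Longrightarrow> s \<le> t \<Longrightarrow> t \<le> L \<Longrightarrow> (x has_integral (X t - X s)) {s..t}"
    "\<And>s t. 0 \<le> s \<Longrightarrow> s \<le> t \<Longrightarrow> t \<le> L \<Longrightarrow> integral {s..t} x = X t - X s"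
    "\<And>s t. 0 \<le> s \<Longrightarrow> s \<le> t \<Longrightarrow> t \<le> L \<Longrightarrow> x integrable_on {s..t}"
  using assms unfolding primitive_def by (auto intro: integral_unique)

lemma primitive_lipschitz:
  assumes "primitive L X x"
  obtains K where "K > 0" "\<And>r. r \<in> {0..L} \<Longrightarrow> norm (x r) \<le> K"
    "\<And>s t. 0 \<le> s \<Longrightarrow> s \<le> t \<Longrightarrow> t \<le> L \<Longrightarrow> norm (X t - X s) \<le> K * (t - s)"
proof -
  obtain K where K: "K > 0" "\<And>r. r \<in> {0..L} \<Longrightarrow> norm (x r) \<le> K"
    using primitiveD(2)[OF assms] unfolding bounded_pos by auto
  show ?thesis
  proof (rule that[OF K])
    fix s t assume st: "0 \<le> s" "s \<le> t" "t \<le> L"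
    show "norm (X t - X s) \<le> K * (t - s)"
      using bounded_measurable_norm_le[OF primitiveD(1)[OF assms] K(2) st]
        primitiveD(4)[OF assms st] by simp
  qed
qed

lemma primitive_continuous:
  assumes "primitive L X x"
  shows "continuous_on {0..L} X"
proof -
  obtain K where K: "K > 0"
    "\<And>s t. 0 \<le> s \<Longrightarrow> s \<le> t \<Longrightarrow> t \<le> L \<Longrightarrow> norm (X t - X s) \<le> K * (t - s)"
    using primitive_lipschitz[OF assms] by metis
  have "K-lipschitz_on {0..L} X"
  proof (rule lipschitz_onI)
    fix s t assume "s \<in> {0..L}" "t \<in> {0..L}"
    then show "dist (X s) (X t) \<le> K * dist s t"
      using K(2)[of s t] K(2)[of t s] by (cases "s \<le> t") (auto simp: dist_norm norm_minus_commute)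
  qed (use K in auto)
  then show ?thesis by (rule lipschitz_on_continuous_on)
qed

lemma primitive_bounded:
  assumes "primitive L X x"
  shows "bounded (X ` {0..L})"
  by (intro compact_imp_bounded compact_continuous_image primitive_continuous[OF assms] compact_Icc)

lemma continuous_imp_measurable_on_Icc:
  fixes X :: "real \<Rightarrow> 'a::euclidean_space"
  shows "continuous_on {0..L} X \<Longrightarrow> X \<in> borel_measurable (lebesgue_on {0..L})"
  by (intro continuous_imp_measurable_on_sets_lebesgue) auto

lemma primitive_measurable:
  "primitive L X x \<Longrightarrow> X \<in> borel_measurable (lebesgue_on {0..L})"
  by (intro continuous_imp_measurable_on_Icc primitive_continuous)

text \<open>
  Increments at most quadratic in the step do not accumulate.  The product and chain rules below reduce to this remark, because two candidates for
  the same indefinite integral have increments that agree up to a quadratic error.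
\<close>
lemma quadratic_increments_imp_le:
  fixes D :: "real \<Rightarrow> real"
  assumes D: "\<And>s t. 0 \<le> s \<Longrightarrow> s \<le> t \<Longrightarrow> t \<le> L \<Longrightarrow> D t \<le> D s + C * (t - s)\<^sup>2"
    and st: "0 \<le> s" "s \<le> t" "t \<le> L"
  shows "D t \<le> D s"
proof (rule field_le_epsilon)
  fix e :: real assume e: "e > 0"
  obtain N :: nat where N: "N > 0" "\<bar>C\<bar> * (t - s)\<^sup>2 / e < real N"
    using reals_Archimedean2 by (metis gr0I less_le_trans not_less of_nat_0 order.strict_trans le0 of_nat_0_less_iff)
  define r where "r i = s + (t - s) * real i / real N" for i
  have r0: "r 0 = s" and rN: "r N = t" using N by (auto simp: r_def)
  have rr: "0 \<le> r i" "r i \<le> r (Suc i)" "r (Suc i) \<le> L" "r (Suc i) - r i = (t-s)/real N" if "i < N" for i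
  proof -
    show "0 \<le> r i" using st N by (auto simp: r_def)
    show d: "r (Suc i) - r i = (t-s)/real N" using N by (simp add: r_def field_simps)
    then show "r i \<le> r (Suc i)" using st N
      by (metis diff_ge_0_iff_ge divide_nonneg_nonneg of_nat_0_le_iff)
    have "(t - s) * real (Suc i) / real N \<le> (t - s) * 1"
      using that N st by (simp add: divide_le_eq) (intro mult_left_mono; simp)
    then show "r (Suc i) \<le> L" using st by (simp add: r_def)
  qed
  have "D t - D s = (\<Sum>i<N. D (r (Suc i)) - D (r i))"
    by (simp add: sum_lessThan_telescope[of "\<lambda>i. D (r i)"] r0 rN)
  also have "\<dots> \<le> (\<Sum>i<N. C * ((t-s)/real N)\<^sup>2)"
  proof (rule sum_mono)
    fix i assume "i \<in> {..<N}"
    then show "D (r (Suc i)) - D (r i) \<le> C * ((t-s)/real N)\<^sup>2"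
      using D[of "r i" "r (Suc i)"] rr[of i] by simp
  qed
  also have "\<dots> = C * (t-s)\<^sup>2 / real N"
    using N by (simp add: power_divide power2_eq_square)
  also have "\<dots> \<le> \<bar>C\<bar> * (t-s)\<^sup>2 / real N"
    by (intro divide_right_mono mult_right_mono) auto
  also have "\<dots> \<le> e" using N e by (simp add: field_simps)
  finally show "D t \<le> D s + e" by simp
qed

lemma quadratic_increments_imp_constant:
  fixes D :: "real \<Rightarrow> 'a::real_normed_vector"
  assumes D: "\<And>s t. 0 \<le> s \<Longrightarrow> s \<le> t \<Longrightarrow> t \<le> L \<Longrightarrow> norm (D t - D s) \<le> C * (t - s)\<^sup>2"
    and st: "0 \<le> s" "s \<le> t" "t \<le> L"
  shows "D t = D s"
proof -
  have "norm (D t - D s) \<le> norm (D s - D s)"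
  proof (rule quadratic_increments_imp_le[OF _ st, where C=C and D="\<lambda>t. norm (D t - D s)"])
    fix p q assume pq: "0 \<le> p" "p \<le> q" "q \<le> L"
    have "norm (D q - D s) \<le> norm (D p - D s) + norm (D q - D p)"
      using norm_triangle_ineq[of "D p - D s" "D q - D p"] by simp
    with D[OF pq] show "norm (D q - D s) \<le> norm (D p - D s) + C * (q - p)\<^sup>2" by simp
  qed
  then show ?thesis by simp
qed

lemma primitive_quadraticI:
  fixes X x :: "real \<Rightarrow> 'a::euclidean_space"
  assumes x: "x \<in> borel_measurable (lebesgue_on {0..L})" "bounded (x ` {0..L})"
    and q: "\<And>s t. 0 \<le> s \<Longrightarrow> s \<le> t \<Longrightarrow> t \<le> L \<Longrightarrow>
       norm (X t - X s - integral {s..t} x) \<le> C * (t - s)\<^sup>2"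
  shows "primitive L X x"
proof -
  have i: "x integrable_on {s..t}" if "0 \<le> s" "t \<le> L" for s t
    using bounded_measurable_absolutely_integrable[OF x that]
      set_lebesgue_integral_eq_integral(1) by blast
  have "X t - X s = integral {s..t} x" if st: "0 \<le> s" "s \<le> t" "t \<le> L" for s t
  proof -
    have split: "integral {0..s} x + integral {s..t} x = integral {0..t} x"
      if "0 \<le> s" "s \<le> t" "t \<le> L" for s t
      by (rule Henstock_Kurzweil_Integration.integral_combine) (use that i in auto)
    have "X t - integral {0..t} x = X s - integral {0..s} x"
    proof (rule quadratic_increments_imp_constant[where C=C and L=L and D="\<lambda>t. X t - integral {0..t} x", OF _ st])
      fix s t assume st: "0 \<le> s" "s \<le> t" "t \<le> L"
      have "X t - integral {0..t} x - (X s - integral {0..s} x) = X t - X s - integral {s..t} x"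
        using split[OF st] by (simp add: algebra_simps)
      then show "norm (X t - integral {0..t} x - (X s - integral {0..s} x)) \<le> C * (t - s)\<^sup>2"
        using q[OF st] by (simp only:)
    qed
    then show ?thesis unfolding split[OF st, symmetric] by (simp add: algebra_simps)
  qed
  then show ?thesis
    unfolding primitive_def using x i by (auto simp: has_integral_iff)
qed

lemma primitive_integralI:
  fixes x :: "real \<Rightarrow> 'a::euclidean_space"
  assumes x: "x \<in> borel_measurable (lebesgue_on {0..L})" "bounded (x ` {0..L})"
    and X: "\<And>t. t \<in> {0..L} \<Longrightarrow> X t = X 0 + integral {0..t} x"
  shows "primitive L X x"
proof (rule primitive_quadraticI[OF x, where C=0])
  fix s t assume st: "0 \<le> s" "s \<le> t" "t \<le> L"
  have "x integrable_on {0..t}"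
    using bounded_measurable_absolutely_integrable[OF x] st
      set_lebesgue_integral_eq_integral(1) by blast
  then have "integral {0..s} x + integral {s..t} x = integral {0..t} x"
    by (intro Henstock_Kurzweil_Integration.integral_combine) (use st in auto)
  then show "norm (X t - X s - integral {s..t} x) \<le> 0 * (t - s)\<^sup>2"
    using X[of s] X[of t] st by (simp add: algebra_simps)
qed

lemma primitive_bounded_linear:
  fixes X x :: "real \<Rightarrow> 'a::euclidean_space" and f :: "'a \<Rightarrow> 'b::euclidean_space"
  assumes X: "primitive L X x" and f: "bounded_linear f"
  shows "primitive L (\<lambda>t. f (X t)) (\<lambda>t. f (x t))"
  unfolding primitive_def
proof (intro conjI allI impI)
  have "continuous_on UNIV f" using f by (simp add: linear_continuous_on)
  then have "f \<in> borel_measurable borel" by (rule borel_measurable_continuous_onI)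
  then show "(\<lambda>t. f (x t)) \<in> borel_measurable (lebesgue_on {0..L})"
    using primitiveD(1)[OF X] by (rule measurable_compose_rev)
  show "bounded ((\<lambda>t. f (x t)) ` {0..L})"
    using bounded_linear_image[OF primitiveD(2)[OF X] f] by (simp add: image_image)
  fix s t assume "0 \<le> s" "s \<le> t" "t \<le> L"
  from has_integral_linear[OF primitiveD(3)[OF X this] f]
  show "((\<lambda>t. f (x t)) has_integral f (X t) - f (X s)) {s..t}"
    using f by (simp add: o_def bounded_linear.linear linear_diff)
qed

lemma primitive_const: "primitive L (\<lambda>_. c) (\<lambda>_. 0)"
  unfolding primitive_def by (auto simp: bounded_iff)

lemma primitive_add:
  fixes X x Y y :: "real \<Rightarrow> 'a::euclidean_space"
  assumes X: "primitive L X x" and Y: "primitive L Y y"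
  shows "primitive L (\<lambda>t. X t + Y t) (\<lambda>t. x t + y t)"
  unfolding primitive_def
proof (intro conjI allI impI)
  show "(\<lambda>t. x t + y t) \<in> borel_measurable (lebesgue_on {0..L})"
    using primitiveD(1)[OF X] primitiveD(1)[OF Y] by simp
  show "bounded ((\<lambda>t. x t + y t) ` {0..L})"
    using bounded_plus_comp[OF primitiveD(2)[OF X] primitiveD(2)[OF Y]] by simp
  fix s t assume "0 \<le> s" "s \<le> t" "t \<le> L"
  from has_integral_add[OF primitiveD(3)[OF X this] primitiveD(3)[OF Y this]]
  show "((\<lambda>t. x t + y t) has_integral X t + Y t - (X s + Y s)) {s..t}"
    by (simp add: algebra_simps)
qed

lemma primitive_diff:
  fixes X x Y y :: "real \<Rightarrow> 'a::euclidean_space"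
  assumes X: "primitive L X x" and Y: "primitive L Y y"
  shows "primitive L (\<lambda>t. X t - Y t) (\<lambda>t. x t - y t)"
  using primitive_add[OF X primitive_bounded_linear[OF Y bounded_linear_minus[OF bounded_linear_ident]]]
  by simp

lemma primitive_sum:
  fixes X x :: "'i \<Rightarrow> real \<Rightarrow> 'a::euclidean_space"
  assumes "\<And>i. i \<in> A \<Longrightarrow> primitive L (X i) (x i)"
  shows "primitive L (\<lambda>t. \<Sum>i\<in>A. X i t) (\<lambda>t. \<Sum>i\<in>A. x i t)"
  using assms
  by (induction A rule: infinite_finite_induct) (auto intro: primitive_const primitive_add)

lemma norm_mult_mono:
  fixes a b :: "'a::real_normed_algebra"
  assumes "norm a \<le> A" "norm b \<le> B"
  shows "norm (a * b) \<le> A * B"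
  by (rule order_trans[OF norm_mult_ineq]) (intro mult_mono' assms norm_ge_zero)

text \<open>The product rule.\<close>
lemma primitive_mult:
  fixes X x Y y :: "real \<Rightarrow> 'a::{euclidean_space,real_normed_algebra}"
  assumes X: "primitive L X x" and Y: "primitive L Y y"
  shows "primitive L (\<lambda>t. X t * Y t) (\<lambda>t. x t * Y t + X t * y t)"
proof -
  obtain K where K: "K > 0" "\<And>r. r \<in> {0..L} \<Longrightarrow> norm (x r) \<le> K"
    "\<And>s t. 0 \<le> s \<Longrightarrow> s \<le> t \<Longrightarrow> t \<le> L \<Longrightarrow> norm (X t - X s) \<le> K * (t - s)"
    using primitive_lipschitz[OF X] by metis
  obtain M where M: "M > 0" "\<And>r. r \<in> {0..L} \<Longrightarrow> norm (y r) \<le> M"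
    "\<And>s t. 0 \<le> s \<Longrightarrow> s \<le> t \<Longrightarrow> t \<le> L \<Longrightarrow> norm (Y t - Y s) \<le> M * (t - s)"
    using primitive_lipschitz[OF Y] by metis
  note mX = primitiveD(1)[OF X] primitive_measurable[OF X]
  note mY = primitiveD(1)[OF Y] primitive_measurable[OF Y]
  have meas: "(\<lambda>t. x t * Y t + X t * y t) \<in> borel_measurable (lebesgue_on {0..L})"
    using mX mY by (intro borel_measurable_add borel_measurable_times)
  obtain A where A: "\<And>r. r \<in> {0..L} \<Longrightarrow> norm (X r) \<le> A" "A > 0"
    using primitive_bounded[OF X] unfolding bounded_pos by blast
  obtain B where B: "\<And>r. r \<in> {0..L} \<Longrightarrow> norm (Y r) \<le> B" "B > 0"
    using primitive_bounded[OF Y] unfolding bounded_pos by blast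
  have bd: "bounded ((\<lambda>t. x t * Y t + X t * y t) ` {0..L})"
    unfolding bounded_iff
  proof (intro exI ballI)
    fix z assume "z \<in> (\<lambda>t. x t * Y t + X t * y t) ` {0..L}"
    then obtain t where t: "t \<in> {0..L}" "z = x t * Y t + X t * y t" by auto
    have "norm (x t * Y t) \<le> K * B"
      by (intro norm_mult_mono K(2) B(1) t(1))
    moreover have "norm (X t * y t) \<le> A * M"
      by (intro norm_mult_mono M(2) A(1) t(1))
    ultimately show "norm z \<le> K * B + A * M"
      unfolding t(2) by (rule norm_triangle_mono)
  qed
  show ?thesis
  proof (rule primitive_quadraticI[OF meas bd, where C="3 * (K * M)"])
    fix s t assume st: "0 \<le> s" "s \<le> t" "t \<le> L"
    have ix: "x integrable_on {s..t}" and iy: "y integrable_on {s..t}"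
      using primitiveD(5)[OF X st] primitiveD(5)[OF Y st] by auto
    let ?f = "\<lambda>r. x r * Y r + X r * y r"
    let ?g = "\<lambda>r. x r * Y s + X s * y r"
    have f: "?f integrable_on {s..t}"
      using bounded_measurable_absolutely_integrable[OF meas bd] st
        set_lebesgue_integral_eq_integral(1) by blast
    have gi: "(?g has_integral (X t - X s) * Y s + X s * (Y t - Y s)) {s..t}"
      by (intro has_integral_add has_integral_mult_left has_integral_mult_right primitiveD(3)[OF X] primitiveD(3)[OF Y] st)
    have "norm (integral {s..t} (\<lambda>r. ?f r - ?g r)) \<le> 2 * (K * M) * (t - s) * (t - s)"
    proof -
      have "norm (integral (cbox s t) (\<lambda>r. ?f r - ?g r)) \<le> (2 * (K * M) * (t - s)) * measure lborel (cbox s t)"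
      proof (rule integrable_bound)
        show "0 \<le> 2 * (K * M) * (t - s)" using K M st by simp
        show "(\<lambda>r. ?f r - ?g r) integrable_on cbox s t"
          unfolding cbox_interval using f gi by (intro integrable_diff) blast+
        fix r assume "r \<in> cbox s t"
        then have r: "s \<le> r" "r \<le> t" "r \<in> {0..L}" using st by auto
        have "?f r - ?g r = x r * (Y r - Y s) + (X r - X s) * y r" by (simp add: algebra_simps)
        moreover have "norm (x r * (Y r - Y s)) \<le> K * (M * (r - s))"
          using r st by (intro norm_mult_mono K(2) M(3)) auto
        moreover have "norm ((X r - X s) * y r) \<le> (K * (r - s)) * M"
          using r st by (intro norm_mult_mono M(2) K(3)) auto
        ultimately have "norm (?f r - ?g r) \<le> 2 * (K * M) * (r - s)"
          using norm_triangle_ineq[of "x r * (Y r - Y s)" "(X r - X s) * y r"]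
          by (simp add: algebra_simps)
        also have "\<dots> \<le> 2 * (K * M) * (t - s)" using r K M by simp
        finally show "norm (?f r - ?g r) \<le> 2 * (K * M) * (t - s)" .
      qed
      then show ?thesis using st by simp
    qed
    moreover have "integral {s..t} (\<lambda>r. ?f r - ?g r) = integral {s..t} ?f - ((X t - X s) * Y s + X s * (Y t - Y s))"
      using f gi by (simp add: integral_diff has_integral_iff)
    moreover have "norm ((X t - X s) * (Y t - Y s)) \<le> (K * (t - s)) * (M * (t - s))"
      by (intro norm_mult_mono K(3) M(3) st)
    moreover have "X t * Y t - X s * Y s - integral {s..t} ?f =
       (X t - X s) * (Y t - Y s) - (integral {s..t} ?f - ((X t - X s) * Y s + X s * (Y t - Y s)))"
      by (simp add: algebra_simps)
    ultimately have "norm (X t * Y t - X s * Y s - integral {s..t} ?f) \<le>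
        (K * (t - s)) * (M * (t - s)) + 2 * (K * M) * (t - s) * (t - s)"
      by (simp only:) (rule order_trans[OF norm_triangle_ineq4 add_mono])
    also have "\<dots> = 3 * (K * M) * (t - s)\<^sup>2"
      by (simp add: power2_eq_square algebra_simps)
    finally show "norm (X t * Y t - X s * Y s - integral {s..t} ?f) \<le> 3 * (K * M) * (t - s)\<^sup>2" .
  qed
qed

lemma mvt_closed_segment:
  fixes f f' :: "real \<Rightarrow> real"
  assumes f: "\<And>r. r \<in> closed_segment a b \<Longrightarrow> (f has_real_derivative f' r) (at r within closed_segment a b)"
  shows "\<exists>\<xi>\<in>closed_segment a b. f b - f a = f' \<xi> * (b - a)"
proof (cases "a \<le> b")
  case True
  then show ?thesis
    using mvt_very_simple[of a b f "\<lambda>r. (*) (f' r)"] f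
    by (auto simp: closed_segment_eq_real_ivl has_field_derivative_def)
next
  case False
  then have "\<exists>\<xi>\<in>closed_segment a b. f a - f b = f' \<xi> * (a - b)"
    using mvt_very_simple[of b a f "\<lambda>r. (*) (f' r)"] f
    by (auto simp: closed_segment_eq_real_ivl has_field_derivative_def)
  then show ?thesis by (force simp: algebra_simps)
qed

text \<open>The chain rule.\<close>
lemma primitive_chain:
  fixes X x f f' :: "real \<Rightarrow> real"
  assumes X: "primitive L X x" and S: "convex S" "\<And>t. t \<in> {0..L} \<Longrightarrow> X t \<in> S"
    and f: "\<And>r. r \<in> S \<Longrightarrow> (f has_real_derivative f' r) (at r within S)"
    and lip: "\<And>p r. p \<in> S \<Longrightarrow> r \<in> S \<Longrightarrow> \<bar>f' p - f' r\<bar> \<le> B * \<bar>p - r\<bar>"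
  shows "primitive L (\<lambda>t. f (X t)) (\<lambda>t. f' (X t) * x t)"
proof -
  obtain K where K: "K > 0" "\<And>r. r \<in> {0..L} \<Longrightarrow> norm (x r) \<le> K"
    "\<And>s t. 0 \<le> s \<Longrightarrow> s \<le> t \<Longrightarrow> t \<le> L \<Longrightarrow> norm (X t - X s) \<le> K * (t - s)"
    using primitive_lipschitz[OF X] by metis
  have lip': "\<bar>B\<bar>-lipschitz_on S f'"
  proof (rule lipschitz_onI)
    fix p r assume "p \<in> S" "r \<in> S"
    from lip[OF this] show "dist (f' p) (f' r) \<le> \<bar>B\<bar> * dist p r"
      by (simp add: dist_real_def) (meson abs_ge_self abs_ge_zero mult_right_mono order_trans)
  qed auto
  have cont: "continuous_on {0..L} (\<lambda>t. f' (X t))"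
    using continuous_on_compose2[OF lipschitz_on_continuous_on[OF lip'] primitive_continuous[OF X]] S by blast
  have meas: "(\<lambda>t. f' (X t) * x t) \<in> borel_measurable (lebesgue_on {0..L})"
    by (intro borel_measurable_times continuous_imp_measurable_on_Icc cont primitiveD(1)[OF X])
  obtain A where A: "\<And>r. r \<in> {0..L} \<Longrightarrow> norm (f' (X r)) \<le> A"
    using compact_imp_bounded[OF compact_continuous_image[OF cont compact_Icc]] unfolding bounded_iff by blast
  have bd: "bounded ((\<lambda>t. f' (X t) * x t) ` {0..L})"
    unfolding bounded_iff using norm_mult_mono[OF A K(2)] by blast
  show ?thesis
  proof (rule primitive_quadraticI[OF meas bd, where C="\<bar>B\<bar> * K * K"])
    fix s t assume st: "0 \<le> s" "s \<le> t" "t \<le> L"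
    let ?g = "\<lambda>r. f' (X r) * x r"
    have g: "?g integrable_on {s..t}"
      using bounded_measurable_absolutely_integrable[OF meas bd] st
        set_lebesgue_integral_eq_integral(1) by blast
    have XS: "X s \<in> S" "X t \<in> S" using S st by auto
    have seg: "closed_segment (X s) (X t) \<subseteq> S" by (intro closed_segment_subset XS S)
    have "\<exists>\<xi>\<in>closed_segment (X s) (X t). f (X t) - f (X s) = f' \<xi> * (X t - X s)"
      by (rule mvt_closed_segment) (meson DERIV_subset f seg subsetD)
    then obtain \<xi> where \<xi>: "\<xi> \<in> closed_segment (X s) (X t)" "f (X t) - f (X s) = f' \<xi> * (X t - X s)"
      by blast
    have gi: "((\<lambda>r. f' \<xi> * x r) has_integral f' \<xi> * (X t - X s)) {s..t}"
      by (intro has_integral_mult_right primitiveD(3)[OF X] st)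
    have "norm (integral (cbox s t) (\<lambda>r. f' \<xi> * x r - ?g r)) \<le> (\<bar>B\<bar> * K * K * (t - s)) * measure lborel (cbox s t)"
    proof (rule integrable_bound)
      show "0 \<le> \<bar>B\<bar> * K * K * (t - s)" using K st by simp
      show "(\<lambda>r. f' \<xi> * x r - ?g r) integrable_on cbox s t"
        unfolding cbox_interval using g gi by (intro integrable_diff) blast+
      fix r assume "r \<in> cbox s t"
      then have r: "s \<le> r" "r \<le> t" "r \<in> {0..L}" using st by auto
      have "\<bar>X t - X r\<bar> \<le> K * (t - s)" "\<bar>X r - X s\<bar> \<le> K * (t - s)"
      proof -
        have "K * (t - r) \<le> K * (t - s)" "K * (r - s) \<le> K * (t - s)"
          using r K by auto
        then show "\<bar>X t - X r\<bar> \<le> K * (t - s)" "\<bar>X r - X s\<bar> \<le> K * (t - s)"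
          using K(3)[of r t] K(3)[of s r] r st by auto
      qed
      then have "\<bar>\<xi> - X r\<bar> \<le> K * (t - s)"
        using \<xi>(1) by (auto simp: closed_segment_eq_real_ivl split: if_splits)
      then have "\<bar>f' \<xi> - f' (X r)\<bar> \<le> \<bar>B\<bar> * (K * (t - s))"
        using lip[of \<xi> "X r"] seg \<xi>(1) S(2)[OF r(3)]
        by (meson abs_ge_self abs_ge_zero mult_mono order_trans subsetD)
      then have "norm ((f' \<xi> - f' (X r)) * x r) \<le> \<bar>B\<bar> * (K * (t - s)) * K"
        using K(2)[OF r(3)] by (intro norm_mult_mono) auto
      then show "norm (f' \<xi> * x r - ?g r) \<le> \<bar>B\<bar> * K * K * (t - s)"
        by (simp add: algebra_simps)
    qed
    moreover have "integral {s..t} (\<lambda>r. f' \<xi> * x r - ?g r) = f (X t) - f (X s) - integral {s..t} ?g"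
      using g gi \<xi>(2) by (simp add: integral_diff has_integral_iff)
    ultimately show "norm (f (X t) - f (X s) - integral {s..t} ?g) \<le> \<bar>B\<bar> * K * K * (t - s)\<^sup>2"
      using st by (simp add: power2_eq_square mult_ac)
  qed
qed

lemma primitive_smooth:
  fixes f f' :: "real \<Rightarrow> real"
  assumes f: "\<And>t. t \<in> {0..L} \<Longrightarrow> (f has_real_derivative f' t) (at t within {0..L})"
    and f': "continuous_on {0..L} f'"
  shows "primitive L f f'"
  unfolding primitive_def
proof (intro conjI allI impI)
  show "f' \<in> borel_measurable (lebesgue_on {0..L})"
    by (rule continuous_imp_measurable_on_Icc[OF f'])
  show "bounded (f' ` {0..L})"
    by (intro compact_imp_bounded compact_continuous_image f' compact_Icc)
  fix s t assume "0 \<le> s" "s \<le> t" "t \<le> L"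
  then show "(f' has_integral f t - f s) {s..t}"
    by (intro fundamental_theorem_of_calculus)
      (auto intro!: has_vector_derivative_within_subset[OF f[unfolded has_real_derivative_iff_has_vector_derivative]])
qed

text \<open>Termwise integration of a normally convergent series.\<close>
lemma primitive_suminf:
  fixes X x :: "nat \<Rightarrow> real \<Rightarrow> 'a::euclidean_space"
  assumes X: "\<And>n. primitive L (X n) (x n)"
    and XM: "\<And>n t. t \<in> {0..L} \<Longrightarrow> norm (X n t) \<le> M n" "summable M"
    and xN: "\<And>n t. t \<in> {0..L} \<Longrightarrow> norm (x n t) \<le> N n" "summable N"
  shows "primitive L (\<lambda>t. \<Sum>n. X n t) (\<lambda>t. \<Sum>n. x n t)"
proof -
  have sX: "(\<lambda>n. X n t) sums (\<Sum>n. X n t)" if "t \<in> {0..L}" for t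
    using summable_comparison_test'[OF XM(2), of 0 "\<lambda>n. X n t"] XM(1)[OF that] by (simp add: summable_sums)
  have unif: "uniform_limit {0..L} (\<lambda>n t. \<Sum>i<n. x i t) (\<lambda>t. \<Sum>n. x n t) sequentially"
    by (rule Weierstrass_m_test[OF xN])
  have sx: "(\<lambda>n. x n t) sums (\<Sum>n. x n t)" if "t \<in> {0..L}" for t
    using summable_comparison_test'[OF xN(2), of 0 "\<lambda>n. x n t"] xN(1)[OF that] by (simp add: summable_sums)
  have meas: "(\<lambda>t. \<Sum>n. x n t) \<in> borel_measurable (lebesgue_on {0..L})"
  proof (rule borel_measurable_LIMSEQ_metric)
    show "(\<lambda>t. \<Sum>i<n. x i t) \<in> borel_measurable (lebesgue_on {0..L})" for n
      by (intro borel_measurable_sum primitiveD(1)[OF X])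
    show "(\<lambda>n. \<Sum>i<n. x i t) \<longlonglongrightarrow> (\<Sum>n. x n t)" if "t \<in> space (lebesgue_on {0..L})" for t
      using sx[of t] that by (simp add: sums_def space_restrict_space)
  qed
  have bd: "bounded ((\<lambda>t. \<Sum>n. x n t) ` {0..L})"
    unfolding bounded_iff
  proof (intro exI ballI)
    fix z assume "z \<in> (\<lambda>t. \<Sum>n. x n t) ` {0..L}"
    then obtain t where t: "t \<in> {0..L}" "z = (\<Sum>n. x n t)" by auto
    show "norm z \<le> suminf N"
      unfolding t(2) by (rule norm_suminf_le[OF xN(1)[OF t(1)] xN(2)])
  qed
  show ?thesis
    unfolding primitive_def
  proof (intro conjI allI impI meas bd)
    fix s t assume st: "0 \<le> s" "s \<le> t" "t \<le> L"
    have part: "((\<lambda>r. \<Sum>i<n. x i r) has_integral (\<Sum>i<n. X i t) - (\<Sum>i<n. X i s)) {s..t}" for n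
      using primitiveD(3)[OF primitive_sum[of "{..<n}" L X x] st] X by simp
    have bound: "norm (\<Sum>i<n. x i r) \<le> suminf N" if "r \<in> {s..t}" for n r
    proof -
      have r: "r \<in> {0..L}" using that st by auto
      have "norm (\<Sum>i<n. x i r) \<le> (\<Sum>i<n. N i)"
        by (intro sum_norm_le xN(1) r)
      also have "\<dots> \<le> suminf N"
        by (intro sum_le_suminf xN(2)) (use order_trans[OF norm_ge_zero xN(1)[OF r]] in auto)
      finally show ?thesis .
    qed
    have lim: "(\<lambda>n. (\<Sum>i<n. X i t) - (\<Sum>i<n. X i s)) \<longlonglongrightarrow> (\<Sum>n. X n t) - (\<Sum>n. X n s)"
      using sX[of s] sX[of t] st by (intro tendsto_diff) (auto simp: sums_def)
    have int: "(\<lambda>r. \<Sum>i<n. x i r) integrable_on {s..t}" for n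
      using part by blast
    have pw: "(\<lambda>n. \<Sum>i<n. x i r) \<longlonglongrightarrow> (\<Sum>n. x n r)" if "r \<in> {s..t}" for r
      using sx[of r] that st by (simp add: sums_def)
    have hint: "(\<lambda>_. suminf N) integrable_on {s..t}" by (rule integrable_const_ivl)
    note dc = dominated_convergence[OF int hint bound pw]
    have "integral {s..t} (\<lambda>r. \<Sum>i<n. x i r) = (\<Sum>i<n. X i t) - (\<Sum>i<n. X i s)" for n
      using part by (rule integral_unique)
    with dc lim show "((\<lambda>t. \<Sum>n. x n t) has_integral (\<Sum>n. X n t) - (\<Sum>n. X n s)) {s..t}"
      using LIMSEQ_unique[OF lim] by (simp add: has_integral_iff)
  qed
qed

text \<open>
  One step of a Riemann-Stieltjes sum for \<open>\<integral> Y dX\<close> has a quadratic error.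
\<close>
lemma primitive_weighted_increment:
  fixes X x Y y G :: "real \<Rightarrow> real"
  assumes X: "primitive L X x" and Y: "primitive L Y y" and G: "primitive L G (\<lambda>t. Y t * x t)"
  shows "\<exists>C\<ge>0. \<forall>s t. 0 \<le> s \<longrightarrow> s \<le> t \<longrightarrow> t \<le> L \<longrightarrow>
     \<bar>G t - G s - Y s * (X t - X s)\<bar> \<le> C * (t - s)\<^sup>2"
proof -
  obtain K where K: "K > 0" "\<And>r. r \<in> {0..L} \<Longrightarrow> norm (x r) \<le> K"
    using primitive_lipschitz[OF X] by metis
  obtain M where M: "M > 0" "\<And>s t. 0 \<le> s \<Longrightarrow> s \<le> t \<Longrightarrow> t \<le> L \<Longrightarrow> norm (Y t - Y s) \<le> M * (t - s)"
    using primitive_lipschitz[OF Y] by metis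
  have "\<bar>G t - G s - Y s * (X t - X s)\<bar> \<le> (M * K) * (t - s)\<^sup>2"
    if st: "0 \<le> s" "s \<le> t" "t \<le> L" for s t
  proof -
    have i: "((\<lambda>r. Y r * x r - Y s * x r) has_integral (G t - G s - Y s * (X t - X s))) {s..t}"
      by (intro has_integral_diff has_integral_mult_right primitiveD(3)[OF X] primitiveD(3)[OF G] st)
    have "norm (integral (cbox s t) (\<lambda>r. Y r * x r - Y s * x r)) \<le> (M * (t - s) * K) * measure lborel (cbox s t)"
    proof (rule integrable_bound)
      show "0 \<le> M * (t - s) * K" using K M st by simp
      show "(\<lambda>r. Y r * x r - Y s * x r) integrable_on cbox s t"
        unfolding cbox_interval using i by blast
      fix r assume "r \<in> cbox s t"
      then have r: "s \<le> r" "r \<le> t" "r \<in> {0..L}" using st by auto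
      have "norm (Y r - Y s) \<le> M * (r - s)" using r by (intro M(2) st(1)) auto
      also have "\<dots> \<le> M * (t - s)" using r M(1) by (intro mult_left_mono) auto
      finally have "norm (Y r - Y s) \<le> M * (t - s)" .
      then have "norm ((Y r - Y s) * x r) \<le> M * (t - s) * K"
        using K(2)[OF r(3)] by (intro norm_mult_mono)
      then show "norm (Y r * x r - Y s * x r) \<le> M * (t - s) * K" by (simp add: algebra_simps)
    qed
    then show ?thesis using integral_unique[OF i] st by (simp add: power2_eq_square mult_ac)
  qed
  then show ?thesis using K M by (intro exI[of _ "M * K"]) auto
qed

lemma primitive_mult_continuous_measurable:
  fixes X x f :: "real \<Rightarrow> real"
  assumes X: "primitive L X x" and f: "continuous_on {0..L} f"
  shows "(\<lambda>t. f t * x t) \<in> borel_measurable (lebesgue_on {0..L})" "bounded ((\<lambda>t. f t * x t) ` {0..L})"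
proof -
  show "(\<lambda>t. f t * x t) \<in> borel_measurable (lebesgue_on {0..L})"
    by (intro borel_measurable_times continuous_imp_measurable_on_Icc f primitiveD(1)[OF X])
  obtain A where A: "\<And>r. r \<in> {0..L} \<Longrightarrow> norm (f r) \<le> A"
    using compact_imp_bounded[OF compact_continuous_image[OF f compact_Icc]] unfolding bounded_iff by blast
  obtain K where K: "\<And>r. r \<in> {0..L} \<Longrightarrow> norm (x r) \<le> K"
    using primitive_lipschitz[OF X] by metis
  show "bounded ((\<lambda>t. f t * x t) ` {0..L})"
    unfolding bounded_iff using norm_mult_mono[OF A K] by blast
qed

section \<open>Projective norm of the iterated integrals\<close>

lemma stieltjes_integral_primitive:
  fixes X x f :: "real \<Rightarrow> real"
  assumes X: "primitive L X x" and f: "continuous_on {0..L} f" and t: "t \<in> {0..L}"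
  shows "stieltjes_integral 0 t f X = integral {0..t} (\<lambda>s. f s * x s)"
proof -
  define F where "F = (\<lambda>s. f s * x s)"
  have Fi: "F integrable_on {p..q}" if "0 \<le> p" "q \<le> L" for p q
    using bounded_measurable_absolutely_integrable[OF primitive_mult_continuous_measurable[OF X f] that]
      set_lebesgue_integral_eq_integral(1) unfolding F_def by blast
  obtain K where K: "K > 0" "\<And>r. r \<in> {0..L} \<Longrightarrow> norm (x r) \<le> K"
    using primitive_lipschitz[OF X] by metis
  have "((\<lambda>p. \<Sum>(y, k)\<in>p. f y * (X (Sup k) - X (Inf k))) \<longlongrightarrow> integral {0..t} F) (division_filter {0..t})"
  proof (rule tendstoI)
    fix e :: real assume e: "e > 0"
    define e' where "e' = e / (2 * (K * t + 1))"
    have Kt: "K * t \<ge> 0" using K t by simp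
    have e': "e' > 0" using e Kt by (simp add: e'_def)
    have "uniformly_continuous_on {0..L} f"
      by (intro compact_uniformly_continuous f compact_Icc)
    then obtain d where d: "d > 0" "\<And>p q. p \<in> {0..L} \<Longrightarrow> q \<in> {0..L} \<Longrightarrow> dist q p < d \<Longrightarrow> dist (f q) (f p) < e'"
      using e' unfolding uniformly_continuous_on_def by metis
    have "dist (\<Sum>(y, k)\<in>p. f y * (X (Sup k) - X (Inf k))) (integral {0..t} F) < e"
      if p: "p tagged_division_of {0..t}" and fine: "(\<lambda>y. ball y d) fine p" for p
    proof -
      have each: "norm (f y * (X (Sup k) - X (Inf k)) - integral k F) \<le> e' * K * measure lborel k"
        if yk: "(y, k) \<in> p" for y k
      proof -
        obtain a b where k: "k = {a..b}" "y \<in> {a..b}" "{a..b} \<subseteq> {0..t}"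
          using tagged_division_ofD(2,3,4)[OF p yk] by (metis cbox_interval)
        then have ab: "0 \<le> a" "a \<le> b" "b \<le> L" using t by auto
        have i: "((\<lambda>r. f y * x r - F r) has_integral (f y * (X b - X a) - integral {a..b} F)) {a..b}"
          using Fi[OF ab(1,3)]
          by (intro has_integral_diff has_integral_mult_right primitiveD(3)[OF X] ab integrable_integral)
        have "norm (integral (cbox a b) (\<lambda>r. f y * x r - F r)) \<le> (e' * K) * measure lborel (cbox a b)"
        proof (rule integrable_bound)
          show "0 \<le> e' * K" using K e' by simp
          show "(\<lambda>r. f y * x r - F r) integrable_on cbox a b"
            unfolding cbox_interval using i by blast
          fix r assume r: "r \<in> cbox a b"
          have "r \<in> ball y d" using fineD[OF fine yk] r k by auto
          then have "norm (f y - f r) \<le> e'"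
            using d(2)[of r y] r k t ab by (auto simp: dist_norm norm_minus_commute)
          then have "norm ((f y - f r) * x r) \<le> e' * K"
            using K(2)[of r] r ab by (intro norm_mult_mono) auto
          then show "norm (f y * x r - F r) \<le> e' * K" by (simp add: F_def algebra_simps)
        qed
        then show ?thesis using integral_unique[OF i] ab k by simp
      qed
      have fin: "finite p" using p by blast
      have "integral {0..t} F = (\<Sum>(y, k)\<in>p. integral k F)"
        using integral_combine_tagged_division_topdown[of F 0 t p] p Fi[of 0 t] t by simp
      then have "norm ((\<Sum>(y, k)\<in>p. f y * (X (Sup k) - X (Inf k))) - integral {0..t} F)
          = norm (\<Sum>(y, k)\<in>p. f y * (X (Sup k) - X (Inf k)) - integral k F)"
        by (simp add: sum_subtractf case_prod_unfold)
      also have "\<dots> \<le> (\<Sum>(y, k)\<in>p. e' * K * measure lborel k)"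
        using each by (intro sum_norm_le) auto
      also have "\<dots> = e' * K * (\<Sum>(y, k)\<in>p. measure lborel k)"
        by (simp add: sum_distrib_left case_prod_unfold)
      also have "(\<Sum>(y, k)\<in>p. measure lborel k) = t"
        using additive_content_tagged_division[of p 0 t] p t by simp
      also have "e' * K * t = e * (K * t / (2 * (K * t + 1)))" by (simp add: e'_def)
      also have "\<dots> < e * 1" using e Kt by (intro mult_strict_left_mono) (auto simp: divide_less_eq)
      also have "e * 1 = e" by simp
      finally show ?thesis by (simp add: dist_norm)
    qed
    then show "\<forall>\<^sub>F p in division_filter {0..t}. dist (\<Sum>(y, k)\<in>p. f y * (X (Sup k) - X (Inf k))) (integral {0..t} F) < e"
      unfolding eventually_division_filter using gauge_ball[OF d(1)] by blast
  qed
  moreover have "division_filter {0..t} \<noteq> bot"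
    using division_filter_not_empty[of 0 t] by simp
  ultimately show ?thesis
    unfolding stieltjes_integral_def F_def using tendsto_Lim by blast
qed

text \<open>
  The sums whose infimum is the projective norm of \<open>\<xi>\<close>.  For \<open>n = 0\<close> this set may be empty, since the elementary
  tensor of order 0 is 1 and only natural numbers are sums of it; hence the assumptions \<open>n > 0\<close> below.
\<close>
definition representation_sums :: "nat \<Rightarrow> 'd::finite tensor \<Rightarrow> real set" where
  "representation_sums n \<xi> = {(\<Sum>i<m. \<Prod>k<n. norm (v i k)) | (m::nat) (v :: nat \<Rightarrow> nat \<Rightarrow> real ^ 'd).
            \<forall>I\<in>{..<n} \<rightarrow>\<^sub>E UNIV. \<xi> I = (\<Sum>i<m. elementary_tensor n (v i) I)}"

lemma projective_norm_eq_Inf: "projective_norm n \<xi> = Inf (representation_sums n \<xi>)"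
  unfolding projective_norm_def representation_sums_def ..

lemma representation_sums_nonneg: "r \<in> representation_sums n \<xi> \<Longrightarrow> 0 \<le> r"
  unfolding representation_sums_def by (auto intro!: sum_nonneg prod_nonneg)

lemma projective_norm_le: "r \<in> representation_sums n \<xi> \<Longrightarrow> projective_norm n \<xi> \<le> r"
  unfolding projective_norm_eq_Inf
  by (rule cInf_lower) (auto simp: bdd_below_def intro: representation_sums_nonneg)

lemma projective_norm_approx:
  assumes "representation_sums n \<xi> \<noteq> {}" "e > 0"
  obtains r where "r \<in> representation_sums n \<xi>" "r < projective_norm n \<xi> + e"
  using assms cInf_lessD[of "representation_sums n \<xi>" "projective_norm n \<xi> + e"]
  unfolding projective_norm_eq_Inf by auto

lemma representation_sums_cong:
  assumes "\<And>I. I \<in> {..<n} \<rightarrow>\<^sub>E UNIV \<Longrightarrow> \<xi> I = \<eta> I"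
  shows "representation_sums n \<xi> = representation_sums n \<eta>"
  unfolding representation_sums_def using assms by auto

lemma representation_sums_zero: "0 \<in> representation_sums n (\<lambda>I. 0)"
  unfolding representation_sums_def by (auto intro!: exI[of _ 0])

lemma representation_sums_add:
  fixes \<xi> \<eta> :: "'d::finite tensor"
  assumes "r \<in> representation_sums n \<xi>" "q \<in> representation_sums n \<eta>"
  shows "r + q \<in> representation_sums n (\<lambda>I. \<xi> I + \<eta> I)"
proof -
  obtain m and v :: "nat \<Rightarrow> nat \<Rightarrow> real ^ 'd" where v: "r = (\<Sum>i<m. \<Prod>k<n. norm (v i k))"
    "\<And>I. I\<in>{..<n} \<rightarrow>\<^sub>E UNIV \<Longrightarrow> \<xi> I = (\<Sum>i<m. elementary_tensor n (v i) I)"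
    using assms(1) unfolding representation_sums_def by blast
  obtain l and u :: "nat \<Rightarrow> nat \<Rightarrow> real ^ 'd" where u: "q = (\<Sum>i<l. \<Prod>k<n. norm (u i k))"
    "\<And>I. I\<in>{..<n} \<rightarrow>\<^sub>E UNIV \<Longrightarrow> \<eta> I = (\<Sum>i<l. elementary_tensor n (u i) I)"
    using assms(2) unfolding representation_sums_def by blast
  define z where "z i = (if i < m then v i else u (i - m))" for i
  have split: "(\<Sum>i<m+l. f (z i)) = (\<Sum>i<m. f (v i)) + (\<Sum>i<l. f (u i))" for f :: "(nat \<Rightarrow> real ^ 'd) \<Rightarrow> real"
  proof -
    have "(\<Sum>i<m+l. f (z i)) = (\<Sum>i<m. f (z i)) + (\<Sum>i=m..<m+l. f (z i))"
      by (metis lessThan_atLeast0 le0 le_add1 sum.atLeastLessThan_concat)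
    also have "(\<Sum>i=m..<m+l. f (z i)) = (\<Sum>i<l. f (z (i + m)))"
      using sum.shift_bounds_nat_ivl[of "\<lambda>i. f (z i)" 0 m l] by (simp add: lessThan_atLeast0 add.commute)
    finally show ?thesis by (simp add: z_def)
  qed
  show ?thesis
    unfolding representation_sums_def
    by (intro CollectI exI[of _ "m + l"] exI[of _ z])
      (simp add: split[of "\<lambda>w. elementary_tensor n w _"] split[of "\<lambda>w. \<Prod>k<n. norm (w k)"] v u)
qed

lemma representation_sums_extend:
  fixes \<xi> :: "'d::finite tensor" and x :: "real ^ 'd"
  assumes r: "r \<in> representation_sums n \<xi>"
    and \<xi>: "\<And>I J. (\<And>k. k < n \<Longrightarrow> I k = J k) \<Longrightarrow> \<xi> I = \<xi> J"
  shows "r * norm x \<in> representation_sums (Suc n) (\<lambda>I. \<xi> I * x $ I n)"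
proof -
  obtain m and v :: "nat \<Rightarrow> nat \<Rightarrow> real ^ 'd" where v: "r = (\<Sum>i<m. \<Prod>k<n. norm (v i k))"
    "\<And>I. I\<in>{..<n} \<rightarrow>\<^sub>E UNIV \<Longrightarrow> \<xi> I = (\<Sum>i<m. elementary_tensor n (v i) I)"
    using r unfolding representation_sums_def by blast
  define z where "z i = (v i)(n := x)" for i
  have "(\<Prod>k<Suc n. norm (z i k)) = (\<Prod>k<n. norm (v i k)) * norm x" for i
    by (simp add: z_def)
  moreover have "\<xi> I * x $ I n = (\<Sum>i<m. elementary_tensor (Suc n) (z i) I)" for I
  proof -
    have "\<xi> I = \<xi> (restrict I {..<n})" by (rule \<xi>) auto
    also have "\<dots> = (\<Sum>i<m. elementary_tensor n (v i) (restrict I {..<n}))"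
      by (rule v(2)) auto
    finally show ?thesis by (simp add: elementary_tensor_def z_def sum_distrib_right)
  qed
  ultimately show ?thesis
    unfolding representation_sums_def v(1)
    by (intro CollectI exI[of _ m] exI[of _ z]) (simp add: sum_distrib_right)
qed

lemma representation_sums_scale:
  fixes \<xi> :: "'d::finite tensor"
  assumes r: "r \<in> representation_sums n \<xi>" and n: "n > 0"
  shows "\<bar>c\<bar> * r \<in> representation_sums n (\<lambda>I. c * \<xi> I)"
proof -
  obtain m and v :: "nat \<Rightarrow> nat \<Rightarrow> real ^ 'd" where v: "r = (\<Sum>i<m. \<Prod>k<n. norm (v i k))"
    "\<And>I. I\<in>{..<n} \<rightarrow>\<^sub>E UNIV \<Longrightarrow> \<xi> I = (\<Sum>i<m. elementary_tensor n (v i) I)"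
    using r unfolding representation_sums_def by blast
  define z where "z i = (v i)(0 := c *\<^sub>R v i 0)" for i
  have n': "{..<n} = insert 0 {1..<n}" "0 \<notin> {1..<n}" using n by auto
  have "(\<Prod>k<n. norm (z i k)) = \<bar>c\<bar> * (\<Prod>k<n. norm (v i k))" for i
    using n' by (simp add: z_def)
  moreover have "elementary_tensor n (z i) I = c * elementary_tensor n (v i) I" for i I
    using n' by (simp add: z_def elementary_tensor_def)
  ultimately show ?thesis
    unfolding representation_sums_def v(1)
    by (intro CollectI exI[of _ m] exI[of _ z]) (simp add: sum_distrib_left v(2))
qed

lemma representation_sums_basis:
  fixes \<xi> :: "'d::finite tensor"
  assumes n: "n > 0"
  shows "(\<Sum>J\<in>{..<n} \<rightarrow>\<^sub>E UNIV. \<bar>\<xi> J\<bar>) \<in> representation_sums n \<xi>"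
proof -
  have one: "1 \<in> representation_sums n (\<lambda>I. if I = J then 1 else 0)"
    if J: "J \<in> {..<n} \<rightarrow>\<^sub>E (UNIV :: 'd set)" for J
  proof -
    have "(if I = J then 1 else 0) = elementary_tensor n (\<lambda>k. axis (J k) 1) I"
      if I: "I \<in> {..<n} \<rightarrow>\<^sub>E (UNIV :: 'd set)" for I
    proof (cases "I = J")
      case False
      then obtain k where "k < n" "I k \<noteq> J k"
        using PiE_ext[OF I J] by auto
      then show ?thesis using False by (auto simp: elementary_tensor_def axis_def)
    qed (simp add: elementary_tensor_def axis_def)
    then show ?thesis
      unfolding representation_sums_def
      by (intro CollectI exI[of _ 1] exI[of _ "\<lambda>_ k. axis (J k) 1"]) (simp add: norm_axis_1)
  qed
  have "(\<Sum>J\<in>A. \<bar>\<xi> J\<bar>) \<in> representation_sums n (\<lambda>I. \<Sum>J\<in>A. \<xi> J * (if I = J then 1 else 0))"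
    if "finite A" "A \<subseteq> {..<n} \<rightarrow>\<^sub>E UNIV" for A
    using that
  proof (induction A rule: finite_induct)
    case empty
    then show ?case using representation_sums_zero by simp
  next
    case (insert J A)
    then have J: "J \<in> {..<n} \<rightarrow>\<^sub>E UNIV" and A: "A \<subseteq> {..<n} \<rightarrow>\<^sub>E UNIV" by auto
    from representation_sums_add[OF representation_sums_scale[OF one[OF J] n, of "\<xi> J"] insert.IH[OF A]] 
    show ?case using insert.hyps by simp
  qed
  from this[of "{..<n} \<rightarrow>\<^sub>E UNIV"] have "(\<Sum>J\<in>{..<n} \<rightarrow>\<^sub>E UNIV. \<bar>\<xi> J\<bar>) \<in>
    representation_sums n (\<lambda>I. \<Sum>J\<in>{..<n} \<rightarrow>\<^sub>E UNIV. \<xi> J * (if I = J then 1 else 0))"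
    by (simp add: finite_PiE)
  also have "\<dots> = representation_sums n \<xi>"
    by (rule representation_sums_cong)
       (simp add: if_distrib finite_PiE sum.delta' cong: if_cong)
  finally show ?thesis .
qed

lemma representation_sums_nonempty: "n > 0 \<Longrightarrow> representation_sums n \<xi> \<noteq> {}"
  using representation_sums_basis by blast

lemma projective_norm_scale_le:
  assumes n: "n > 0"
  shows "projective_norm n (\<lambda>I. c * \<xi> I) \<le> \<bar>c\<bar> * projective_norm n \<xi>"
proof (rule field_le_epsilon)
  fix e :: real assume e: "e > 0"
  then have "e / (\<bar>c\<bar> + 1) > 0" by simp
  from projective_norm_approx[OF representation_sums_nonempty[OF n] this, of \<xi>]
  obtain r where r: "r \<in> representation_sums n \<xi>" "r < projective_norm n \<xi> + e / (\<bar>c\<bar> + 1)" by blast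
  have "projective_norm n (\<lambda>I. c * \<xi> I) \<le> \<bar>c\<bar> * r"
    by (rule projective_norm_le[OF representation_sums_scale[OF r(1) n]])
  also have "\<dots> \<le> \<bar>c\<bar> * (projective_norm n \<xi> + e / (\<bar>c\<bar> + 1))"
    using r(2) by (intro mult_left_mono) auto
  also have "\<dots> \<le> \<bar>c\<bar> * projective_norm n \<xi> + e"
    using e by (simp add: field_simps)
  finally show "projective_norm n (\<lambda>I. c * \<xi> I) \<le> \<bar>c\<bar> * projective_norm n \<xi> + e" .
qed

text \<open>
  The projective norm is subadditive, satisfies \<open>\<parallel>\<xi> \<otimes> x\<parallel> \<le> \<parallel>\<xi>\<parallel> * norm x\<close>, and is bounded by the sum of the absolute
  values of the coordinates; this is the combination of the three facts that one time step requires.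
\<close>
lemma projective_norm_step_le:
  fixes \<xi> \<eta> \<zeta> :: "'d::finite tensor" and x :: "real ^ 'd"
  assumes \<xi>: "\<And>I J. (\<And>k. k < n \<Longrightarrow> I k = J k) \<Longrightarrow> \<xi> I = \<xi> J" "representation_sums n \<xi> \<noteq> {}"
  shows "projective_norm (Suc n) \<zeta> \<le> projective_norm (Suc n) \<eta> + projective_norm n \<xi> * norm x
     + (\<Sum>I\<in>{..<Suc n} \<rightarrow>\<^sub>E UNIV. \<bar>\<zeta> I - \<eta> I - \<xi> I * x $ I n\<bar>)"
proof (rule field_le_epsilon)
  fix e :: real assume e: "e > 0"
  let ?R = "\<lambda>I. \<zeta> I - \<eta> I - \<xi> I * x $ I n"
  obtain r where r: "r \<in> representation_sums (Suc n) \<eta>" "r < projective_norm (Suc n) \<eta> + e/2"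
    using projective_norm_approx[OF representation_sums_nonempty, of "Suc n" "e/2" \<eta>] e by auto
  have "norm x + 1 > 0" using norm_ge_zero[of x] by linarith
  then have "e / (2 * (norm x + 1)) > 0" using e by simp
  then obtain q where q: "q \<in> representation_sums n \<xi>" "q < projective_norm n \<xi> + e / (2 * (norm x + 1))"
    using projective_norm_approx[OF \<xi>(2)] by blast
  have "r + q * norm x + (\<Sum>I\<in>{..<Suc n} \<rightarrow>\<^sub>E UNIV. \<bar>?R I\<bar>) \<in> representation_sums (Suc n) (\<lambda>I. \<eta> I + \<xi> I * x $ I n + ?R I)"
    by (intro representation_sums_add r representation_sums_extend q \<xi>(1) representation_sums_basis) auto
  then have "projective_norm (Suc n) \<zeta> \<le> r + q * norm x + (\<Sum>I\<in>{..<Suc n} \<rightarrow>\<^sub>E UNIV. \<bar>?R I\<bar>)"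
    by (intro projective_norm_le) simp
  moreover have "q * norm x \<le> projective_norm n \<xi> * norm x + e / (2 * (norm x + 1)) * norm x"
    unfolding distrib_right[symmetric] using q by (intro mult_right_mono) auto
  moreover have "e / (2 * (norm x + 1)) * norm x \<le> e/2"
  proof -
    have "e / (2 * (norm x + 1)) * norm x = e/2 * (norm x / (norm x + 1))" by simp
    also have "\<dots> \<le> e/2 * 1" using e \<open>norm x + 1 > 0\<close> by (intro mult_left_mono) (auto simp: divide_le_eq)
    finally show ?thesis by simp
  qed
  ultimately show "projective_norm (Suc n) \<zeta> \<le> projective_norm (Suc n) \<eta> + projective_norm n \<xi> * norm x
     + (\<Sum>I\<in>{..<Suc n} \<rightarrow>\<^sub>E UNIV. \<bar>?R I\<bar>) + e"
    using r by linarith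
qed

lemma iterated_integral_cong:
  "(\<And>k. k < n \<Longrightarrow> I k = J k) \<Longrightarrow> iterated_integral \<gamma> n t I = iterated_integral \<gamma> n t J"
proof (induction n arbitrary: t)
  case (Suc n)
  then have "iterated_integral \<gamma> n s I = iterated_integral \<gamma> n s J" for s by auto
  with Suc.prems[of n] show ?case by simp
qed simp

lemma primitive_iterated_integral:
  fixes \<gamma> :: "real \<Rightarrow> real ^ 'd"
  assumes \<gamma>: "\<And>j. primitive L (\<lambda>t. \<gamma> t $ j) (h j)"
  shows "primitive L (\<lambda>t. iterated_integral \<gamma> (Suc n) t I) (\<lambda>t. iterated_integral \<gamma> n t I * h (I n) t)"
proof (induction n)
  case 0
  have "iterated_integral \<gamma> (Suc 0) t I = integral {0..t} (\<lambda>s. iterated_integral \<gamma> 0 s I * h (I 0) s)" if "t \<in> {0..L}" for t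
    using stieltjes_integral_primitive[OF \<gamma>[of "I 0"], of "\<lambda>_. 1" t] that by simp
  then show ?case
    using primitive_mult_continuous_measurable[OF \<gamma>[of "I 0"], of "\<lambda>_. 1"]
    by (intro primitive_integralI) auto
next
  case (Suc n)
  let ?f = "\<lambda>t. iterated_integral \<gamma> (Suc n) t I"
  have c: "continuous_on {0..L} ?f" by (rule primitive_continuous[OF Suc])
  have "iterated_integral \<gamma> (Suc (Suc n)) t I = integral {0..t} (\<lambda>s. ?f s * h (I (Suc n)) s)" if "t \<in> {0..L}" for t
    using stieltjes_integral_primitive[OF \<gamma>[of "I (Suc n)"] c that] by simp
  then show ?case
    using primitive_mult_continuous_measurable[OF \<gamma>[of "I (Suc n)"] c]
    by (intro primitive_integralI) auto
qed

lemma iterated_integral_Suc_0: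
  fixes \<gamma> :: "real \<Rightarrow> real ^ 'd"
  assumes \<gamma>: "\<And>j. primitive L (\<lambda>t. \<gamma> t $ j) (h j)" and "L \<ge> 0"
  shows "iterated_integral \<gamma> (Suc n) 0 I = 0"
proof -
  have "continuous_on {0..L} (\<lambda>t. iterated_integral \<gamma> n t I)"
    using primitive_continuous[OF primitive_iterated_integral[OF \<gamma>]] by (cases n) simp_all
  from stieltjes_integral_primitive[OF \<gamma> this, of 0 "I n"] \<open>L \<ge> 0\<close> show ?thesis by simp
qed

lemma power_diff_ge:
  fixes s t :: real
  assumes "0 \<le> s" "s \<le> t"
  shows "real (Suc n) * s ^ n * (t - s) \<le> t ^ Suc n - s ^ Suc n"
proof (induction n)
  case (Suc n)
  have "real (Suc (Suc n)) * s ^ Suc n * (t - s) = s * (real (Suc n) * s ^ n * (t - s)) + s ^ Suc n * (t - s)"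
    by (simp add: algebra_simps)
  also have "\<dots> \<le> t * (t ^ Suc n - s ^ Suc n) + s ^ Suc n * (t - s)"
    using assms Suc by (intro add_mono mult_mono) auto
  also have "\<dots> = t ^ Suc (Suc n) - s ^ Suc (Suc n)" by (simp add: algebra_simps)
  finally show ?case .
qed simp

text \<open>
  In a time step from \<open>s\<close> to \<open>t\<close> the iterated integral of order \<open>n + 1\<close> changes by the tensor product of the one of
  order \<open>n\<close> with the increment of the path, up to an error quadratic in \<open>t - s\<close>.
\<close>
lemma projective_norm_iterated_integral_le:
  fixes \<gamma> :: "real \<Rightarrow> real ^ 'd"
  assumes \<gamma>: "\<And>j. primitive L (\<lambda>t. \<gamma> t $ j) (h j)"
    and lip: "\<And>s t. 0 \<le> s \<Longrightarrow> s \<le> t \<Longrightarrow> t \<le> L \<Longrightarrow> norm (\<gamma> t - \<gamma> s) \<le> t - s"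
    and t: "0 \<le> t" "t \<le> L"
  shows "projective_norm n (iterated_integral \<gamma> n t) \<le> t ^ n / fact n"
  using t
proof (induction n arbitrary: t)
  case 0
  have "1 \<in> representation_sums 0 (iterated_integral \<gamma> 0 t)"
    unfolding representation_sums_def
    by (intro CollectI exI[of _ 1] exI[of _ "\<lambda>_ _. 0"]) (simp add: elementary_tensor_def)
  then show ?case using projective_norm_le by fastforce
next
  case (Suc n)
  let ?g = "iterated_integral \<gamma>"
  let ?A = "{..<Suc n} \<rightarrow>\<^sub>E (UNIV :: 'd set)"
  have ne: "representation_sums n (?g n s) \<noteq> {}" for s
  proof (cases "n = 0")
    case True
    have "1 \<in> representation_sums 0 (?g 0 s)"
      unfolding representation_sums_def
      by (intro CollectI exI[of _ 1] exI[of _ "\<lambda>_ _. 0"]) (simp add: elementary_tensor_def)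
    then show ?thesis using True by auto
  qed (simp add: representation_sums_nonempty)
  have "\<exists>C\<ge>0. \<forall>s t. 0 \<le> s \<longrightarrow> s \<le> t \<longrightarrow> t \<le> L \<longrightarrow>
     \<bar>?g (Suc n) t I - ?g (Suc n) s I - ?g n s I * (\<gamma> t $ I n - \<gamma> s $ I n)\<bar> \<le> C * (t - s)\<^sup>2" for I
  proof -
    have "\<exists>y. primitive L (\<lambda>t. ?g n t I) y"
    proof (cases n)
      case 0
      then show ?thesis using primitive_const by auto
    next
      case (Suc m)
      then show ?thesis using primitive_iterated_integral[OF \<gamma>, of m I] by blast
    qed
    then show ?thesis using primitive_weighted_increment[OF \<gamma> _ primitive_iterated_integral[OF \<gamma>]] by blast
  qed
  then obtain C where C: "\<And>I s t. 0 \<le> s \<Longrightarrow> s \<le> t \<Longrightarrow> t \<le> L \<Longrightarrow>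
     \<bar>?g (Suc n) t I - ?g (Suc n) s I - ?g n s I * (\<gamma> t $ I n - \<gamma> s $ I n)\<bar> \<le> C I * (t - s)\<^sup>2"
    by metis
  define D where "D t = projective_norm (Suc n) (?g (Suc n) t) - t ^ Suc n / fact (Suc n)" for t
  have "D t \<le> D 0"
  proof (rule quadratic_increments_imp_le[where C="\<Sum>I\<in>?A. C I" and D=D])
    fix s t assume st: "0 \<le> s" "s \<le> t" "t \<le> L"
    have "projective_norm (Suc n) (?g (Suc n) t) \<le> projective_norm (Suc n) (?g (Suc n) s)
       + projective_norm n (?g n s) * norm (\<gamma> t - \<gamma> s)
       + (\<Sum>I\<in>?A. \<bar>?g (Suc n) t I - ?g (Suc n) s I - ?g n s I * (\<gamma> t - \<gamma> s) $ I n\<bar>)"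
      by (rule projective_norm_step_le[OF iterated_integral_cong ne])
    also have "(\<Sum>I\<in>?A. \<bar>?g (Suc n) t I - ?g (Suc n) s I - ?g n s I * (\<gamma> t - \<gamma> s) $ I n\<bar>)
        \<le> (\<Sum>I\<in>?A. C I * (t - s)\<^sup>2)"
      using C[OF st] by (intro sum_mono) (simp del: iterated_integral.simps)
    also have "projective_norm n (?g n s) * norm (\<gamma> t - \<gamma> s) \<le> s ^ n / fact n * (t - s)"
      using Suc.IH[of s] lip[OF st] st by (intro mult_mono) auto
    also have "s ^ n / fact n * (t - s) = real (Suc n) * s ^ n * (t - s) / fact (Suc n)"
      by (simp add: divide_simps)
    also have "\<dots> \<le> (t ^ Suc n - s ^ Suc n) / fact (Suc n)"
      using power_diff_ge[OF st(1,2)] by (intro divide_right_mono) auto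
    finally show "D t \<le> D s + (\<Sum>I\<in>?A. C I) * (t - s)\<^sup>2"
      by (simp add: D_def sum_distrib_right diff_divide_distrib del: iterated_integral.simps)
  qed (use Suc.prems in auto)
  moreover have "projective_norm (Suc n) (?g (Suc n) 0) \<le> 0"
  proof -
    have "?g (Suc n) 0 = (\<lambda>I. 0)"
      using iterated_integral_Suc_0[OF \<gamma>] Suc.prems by (auto simp del: iterated_integral.simps)
    then show ?thesis using projective_norm_le[OF representation_sums_zero] by metis
  qed
  ultimately show ?case by (simp add: D_def del: iterated_integral.simps)
qed

section \<open>Words and the shuffle product\<close>

lemma primitive_unique:
  assumes X: "primitive L X x" and Y: "primitive L Y y" and eq: "\<And>t. t \<in> {0..L} \<Longrightarrow> x t = y t"
    and 0: "X 0 = Y 0" and t: "t \<in> {0..L}"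
  shows "X t = Y t"
proof -
  have "integral {0..t} x = integral {0..t} y"
    using eq t by (intro Henstock_Kurzweil_Integration.integral_cong) auto
  then show ?thesis using primitiveD(4)[OF X, of 0 t] primitiveD(4)[OF Y, of 0 t] 0 t by simp
qed

lemma primitive_cong:
  assumes X: "primitive L X x" and eq: "\<And>t. t \<in> {0..L} \<Longrightarrow> x t = y t" "\<And>t. t \<in> {0..L} \<Longrightarrow> X t = Y t"
  shows "primitive L Y y"
  unfolding primitive_def
proof (intro conjI allI impI)
  show "y \<in> borel_measurable (lebesgue_on {0..L})"
    using primitiveD(1)[OF X] by (rule measurable_cong[THEN iffD1, rotated]) (simp add: eq)
  show "bounded (y ` {0..L})"
    using primitiveD(2)[OF X] image_cong[OF refl eq(1), of "{0..L}"] by simp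
  fix s t assume st: "0 \<le> s" "s \<le> t" "t \<le> L"
  show "(y has_integral Y t - Y s) {s..t}"
    using primitiveD(3)[OF X st] has_integral_cong[of "{s..t}" x y] eq st by simp
qed

lemma primitive_mult_left:
  fixes X x :: "real \<Rightarrow> 'a::{euclidean_space,real_normed_algebra}"
  shows "primitive L X x \<Longrightarrow> primitive L (\<lambda>t. c * X t) (\<lambda>t. c * x t)"
  by (rule primitive_bounded_linear[OF _ bounded_linear_mult_right])

lemma primitive_sum_list:
  fixes X x :: "'i \<Rightarrow> real \<Rightarrow> 'a::euclidean_space"
  assumes "\<And>i. primitive L (X i) (x i)"
  shows "primitive L (\<lambda>t. \<Sum>i\<leftarrow>l. X i t) (\<lambda>t. \<Sum>i\<leftarrow>l. x i t)"
  using assms by (induction l) (auto intro: primitive_const primitive_add)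

text \<open>
  All shuffles of two words, listed with multiplicity.
\<close>
fun shuffle_list :: "'a list \<Rightarrow> 'a list \<Rightarrow> 'a list list" where
  "shuffle_list [] b = [b]"
| "shuffle_list a [] = [a]"
| "shuffle_list (x # a) (y # b) = map ((#) x) (shuffle_list a (y # b)) @ map ((#) y) (shuffle_list (x # a) b)"

lemma length_shuffle_list: "length (shuffle_list a b) = (length a + length b) choose length a"
  by (induction a b rule: shuffle_list.induct) auto

lemma length_shuffle_list_elem: "c \<in> set (shuffle_list a b) \<Longrightarrow> length c = length a + length b"
  by (induction a b arbitrary: c rule: shuffle_list.induct) auto

lemma norm_sum_list_le: "norm (\<Sum>x\<leftarrow>l. f x) \<le> (\<Sum>x\<leftarrow>l. norm (f x))"
  by (induction l) (auto intro: norm_triangle_le)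

lemma has_integral_power_fact:
  fixes t :: real
  assumes "0 \<le> t"
  shows "((\<lambda>s. s ^ n / fact n) has_integral t ^ Suc n / fact (Suc n)) {0..t}"
proof -
  have "((\<lambda>s. s ^ n / fact n) has_integral t ^ Suc n / fact (Suc n) - 0 ^ Suc n / fact (Suc n)) {0..t}"
  proof (rule fundamental_theorem_of_calculus[OF assms])
    fix s assume "s \<in> {0..t}"
    have "((\<lambda>s. s ^ Suc n / fact (Suc n)) has_real_derivative (real (Suc n) * s ^ n) / fact (Suc n)) (at s within {0..t})"
      by (intro derivative_eq_intros | simp)+
    also have "(real (Suc n) * s ^ n) / fact (Suc n) = s ^ n / fact n" by (simp add: divide_simps)
    finally show "((\<lambda>s. s ^ Suc n / fact (Suc n)) has_vector_derivative s ^ n / fact n) (at s within {0..t})"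
      by (simp add: has_real_derivative_iff_has_vector_derivative)
  qed
  then show ?thesis by simp
qed

text \<open>
  The unit speed path with measurable angle function \<open>\<beta>\<close>, up to translation.
\<close>
locale angle_path =
  fixes L :: real and \<beta> :: "real \<Rightarrow> real"
  assumes L_pos: "L > 0" and measurable_angle: "\<beta> \<in> borel_measurable (lebesgue_on {0..L})"
begin

text \<open>
  The two letters: the velocity as a complex number, and its conjugate.
\<close>
definition letter :: "bool \<Rightarrow> real \<Rightarrow> complex" where
  "letter x t = (if x then cis (\<beta> t) else cnj (cis (\<beta> t)))"

lemma norm_letter [simp]: "norm (letter x t) = 1"
  by (simp add: letter_def)

lemma letter_measurable: "letter x \<in> borel_measurable (lebesgue_on {0..L})"
proof -
  have "(\<lambda>t. cis (\<beta> t)) \<in> borel_measurable (lebesgue_on {0..L})"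
    using measurable_angle by (rule measurable_compose) (auto intro!: borel_measurable_continuous_onI continuous_intros)
  moreover have "(\<lambda>t. cis (- \<beta> t)) \<in> borel_measurable (lebesgue_on {0..L})"
    using measurable_angle by (rule measurable_compose) (auto intro!: borel_measurable_continuous_onI continuous_intros)
  ultimately show ?thesis by (cases x) (simp_all add: letter_def cis_cnj[symmetric] cong: measurable_cong)
qed

text \<open>
  The iterated integral of a word over \<open>0 < t\<^sub>1 < \<dots> < t\<^sub>n < t\<close>.  The head of the list belongs to the last, that is
  outermost, time variable.
\<close>
primrec word_integral :: "bool list \<Rightarrow> real \<Rightarrow> complex" where
  "word_integral [] t = 1"
| "word_integral (x # c) t = integral {0..t} (\<lambda>s. letter x s * word_integral c s)"

lemma primitive_letter_integral:
  assumes "continuous_on {0..L} f"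
  shows "primitive L (\<lambda>t. integral {0..t} (\<lambda>s. letter x s * f s)) (\<lambda>t. letter x t * f t)"
proof (rule primitive_integralI)
  show "(\<lambda>t. letter x t * f t) \<in> borel_measurable (lebesgue_on {0..L})"
    by (intro borel_measurable_times letter_measurable continuous_imp_measurable_on_Icc assms)
  have "bounded (f ` {0..L})"
    by (intro compact_imp_bounded compact_continuous_image assms compact_Icc)
  then show "bounded ((\<lambda>t. letter x t * f t) ` {0..L})"
    by (auto simp: bounded_iff norm_mult)
qed simp

lemma primitive_word_integral:
  "primitive L (word_integral (x # c)) (\<lambda>t. letter x t * word_integral c t)"
proof (induction c arbitrary: x)
  case Nil
  then show ?case using primitive_letter_integral[of "\<lambda>_. 1" x] by simp
next
  case (Cons y c)
  from primitive_letter_integral[OF primitive_continuous[OF this], of x] show ?case by simp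
qed

lemma word_integral_0: "word_integral (x # c) 0 = 0"
  by simp

lemma norm_word_integral_le: "0 \<le> t \<Longrightarrow> t \<le> L \<Longrightarrow> norm (word_integral c t) \<le> t ^ length c / fact (length c)"
proof (induction c arbitrary: t)
  case (Cons x c)
  note P = primitive_word_integral[of x c]
  have "norm (word_integral (x # c) t) \<le> t ^ Suc (length c) / fact (Suc (length c))"
    unfolding word_integral.simps(2) integral_unique[OF has_integral_power_fact[OF Cons.prems(1)], symmetric]
  proof (rule integral_norm_bound_integral)
    show "(\<lambda>s. letter x s * word_integral c s) integrable_on {0..t}"
      using primitiveD(5)[OF P, of 0 t] Cons.prems by simp
    show "(\<lambda>s. s ^ length c / fact (length c)) integrable_on {0..t}"
      using has_integral_power_fact[OF Cons.prems(1)] by blast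
    show "norm (letter x s * word_integral c s) \<le> s ^ length c / fact (length c)" if "s \<in> {0..t}" for s
      using Cons.IH[of s] that Cons.prems by (simp add: norm_mult)
  qed
  then show ?case by simp
qed simp

text \<open>
  By the product rule both sides are indefinite integrals of the same function.
\<close>
lemma word_integral_mult:
  "t \<in> {0..L} \<Longrightarrow> word_integral a t * word_integral b t = (\<Sum>c\<leftarrow>shuffle_list a b. word_integral c t)"
proof (induction a b arbitrary: t rule: shuffle_list.induct)
  case (3 x a y b)
  let ?V = word_integral
  have sl: "(\<Sum>c\<leftarrow>map ((#) x) l. ?V c t) = (\<Sum>c\<leftarrow>l. ?V (x # c) t)" for x l t
    by (simp add: o_def)
  show ?case
  proof (rule primitive_unique[OF _ _ _ _ 3(3)])
    show "primitive L (\<lambda>t. ?V (x # a) t * ?V (y # b) t)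
       (\<lambda>t. letter x t * ?V a t * ?V (y # b) t + ?V (x # a) t * (letter y t * ?V b t))"
      by (intro primitive_mult primitive_word_integral)
    have "primitive L (\<lambda>t. (\<Sum>c\<leftarrow>shuffle_list a (y # b). ?V (x # c) t) + (\<Sum>c\<leftarrow>shuffle_list (x # a) b. ?V (y # c) t))
       (\<lambda>t. (\<Sum>c\<leftarrow>shuffle_list a (y # b). letter x t * ?V c t) + (\<Sum>c\<leftarrow>shuffle_list (x # a) b. letter y t * ?V c t))"
      by (intro primitive_add primitive_sum_list primitive_word_integral)
    then show "primitive L (\<lambda>t. \<Sum>c\<leftarrow>shuffle_list (x # a) (y # b). ?V c t)
       (\<lambda>t. letter x t * (\<Sum>c\<leftarrow>shuffle_list a (y # b). ?V c t) + letter y t * (\<Sum>c\<leftarrow>shuffle_list (x # a) b. ?V c t))"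
      by (simp only: shuffle_list.simps map_append sum_list_append sl sum_list_const_mult)
    fix s assume s: "s \<in> {0..L}"
    show "letter x s * ?V a s * ?V (y # b) s + ?V (x # a) s * (letter y s * ?V b s)
      = letter x s * (\<Sum>c\<leftarrow>shuffle_list a (y # b). ?V c s) + letter y s * (\<Sum>c\<leftarrow>shuffle_list (x # a) b. ?V c s)"
      unfolding 3(1)[OF s, symmetric] 3(2)[OF s, symmetric] by (simp only: mult_ac)
  next
    have "(\<Sum>c\<leftarrow>l. ?V (z # c) 0) = 0" for z l
      by (induction l) auto
    then show "?V (x # a) 0 * ?V (y # b) 0 = (\<Sum>c\<leftarrow>shuffle_list (x # a) (y # b). ?V c 0)"
      by (simp only: shuffle_list.simps map_append sum_list_append sl word_integral_0 mult_zero_left add_0)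
  qed
qed simp_all

text \<open>
  The largest modulus of \<open>n!\<close> times the iterated integral over \<open>[0, L]\<close> of a word of length \<open>n\<close>.
\<close>
definition max_word :: "nat \<Rightarrow> real" where
  "max_word n = Max ((\<lambda>c. fact n * norm (word_integral c L)) ` {c. length c = n})"

lemma finite_words: "finite {c :: bool list. length c = n}"
  using finite_lists_length_eq[of "UNIV :: bool set" n] by simp

lemma words_nonempty: "{c :: bool list. length c = n} \<noteq> {}"
  by (auto intro: exI[of _ "replicate n True"])

lemma max_word_ge: "length c = n \<Longrightarrow> fact n * norm (word_integral c L) \<le> max_word n"
  unfolding max_word_def using finite_words by (intro Max_ge) auto

lemma max_word_obtain:
  obtains c where "length c = n" "max_word n = fact n * norm (word_integral c L)"
proof -
  have "max_word n \<in> (\<lambda>c. fact n * norm (word_integral c L)) ` {c. length c = n}"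
    unfolding max_word_def using finite_words words_nonempty by (intro Max_in) auto
  then show ?thesis using that by auto
qed

lemma max_word_supermult: "max_word n * max_word m \<le> max_word (n + m)"
proof -
  obtain a where a: "length a = n" "max_word n = fact n * norm (word_integral a L)"
    by (rule max_word_obtain)
  obtain b where b: "length b = m" "max_word m = fact m * norm (word_integral b L)"
    by (rule max_word_obtain)
  have "norm (word_integral a L) * norm (word_integral b L) = norm (\<Sum>c\<leftarrow>shuffle_list a b. word_integral c L)"
    unfolding norm_mult[symmetric] using word_integral_mult[of L a b] L_pos by simp
  also have "\<dots> \<le> (\<Sum>c\<leftarrow>shuffle_list a b. norm (word_integral c L))"
    by (rule norm_sum_list_le)
  also have "\<dots> \<le> (\<Sum>c\<leftarrow>shuffle_list a b. max_word (n + m) / fact (n + m))"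
    using max_word_ge[of _ "n + m"] length_shuffle_list_elem[of _ a b] a b
    by (intro sum_list_mono) (auto simp: field_simps)
  also have "\<dots> = real ((n + m) choose n) * (max_word (n + m) / fact (n + m))"
    by (simp add: sum_list_triv length_shuffle_list a b)
  also have "\<dots> = max_word (n + m) / (fact n * fact m)"
    using binomial_fact[of n "n + m", where ?'a = real] by (simp add: field_simps)
  finally show ?thesis unfolding a b by (simp add: field_simps)
qed

section \<open>Word integrals as functionals of the tensor of iterated integrals\<close>

text \<open>
  The letter \<open>x\<close> as a complex linear form on \<open>\<real>\<^sup>2\<close>, by its coefficients in the standard basis.
\<close>
definition letter_coeff :: "bool \<Rightarrow> 2 \<Rightarrow> complex" where
  "letter_coeff x j = (if j = 1 then 1 else if x then \<i> else - \<i>)"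

text \<open>
  The coordinates of the velocity.
\<close>
definition velocity :: "2 \<Rightarrow> real \<Rightarrow> real" where
  "velocity j t = (if j = 1 then cos (\<beta> t) else sin (\<beta> t))"

text \<open>
  The tensor product of the letters of \<open>c\<close>, as a multilinear form in coordinates.  The list is reversed, because the
  factor with index 0 of a tensor belongs to the innermost time variable.
\<close>
definition word_coeff :: "bool list \<Rightarrow> (nat \<Rightarrow> 2) \<Rightarrow> complex" where
  "word_coeff c I = (\<Prod>k<length c. letter_coeff (rev c ! k) (I k))"

lemma letter_eq_velocity: "letter x t = (\<Sum>j\<in>UNIV. letter_coeff x j * of_real (velocity j t))"
  by (simp add: letter_def letter_coeff_def velocity_def sum_2 complex_eq_iff)

lemma norm_letter_coeff: "norm (\<Sum>j\<in>UNIV. letter_coeff x j * of_real (v $ j)) = norm v"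
  by (simp add: letter_coeff_def sum_2 norm_vec_def L2_set_def cmod_def)

lemma sum_PiE_Suc:
  fixes f :: "(nat \<Rightarrow> 'd::finite) \<Rightarrow> 'a::comm_monoid_add"
  shows "(\<Sum>I\<in>{..<Suc n} \<rightarrow>\<^sub>E UNIV. f I) = (\<Sum>J\<in>{..<n} \<rightarrow>\<^sub>E UNIV. \<Sum>j\<in>UNIV. f (J(n := j)))"
proof -
  have "(\<Sum>I\<in>{..<Suc n} \<rightarrow>\<^sub>E UNIV. f I) = (\<Sum>(j, J)\<in>UNIV \<times> ({..<n} \<rightarrow>\<^sub>E UNIV). f (J(n := j)))"
    unfolding lessThan_Suc PiE_insert_eq
    by (subst sum.reindex) (auto intro!: inj_combinator sum.cong)
  also have "\<dots> = (\<Sum>J\<in>{..<n} \<rightarrow>\<^sub>E UNIV. \<Sum>j\<in>UNIV. f (J(n := j)))"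
    by (subst sum.cartesian_product[symmetric]) (rule sum.swap)
  finally show ?thesis .
qed

lemma word_coeff_Cons: "word_coeff (x # c) (J(length c := j)) = letter_coeff x j * word_coeff c J"
  by (simp add: word_coeff_def nth_append mult.commute)

lemma word_integral_eq_sum:
  fixes \<gamma> :: "real \<Rightarrow> real ^ 2"
  assumes \<gamma>: "\<And>j. primitive L (\<lambda>t. \<gamma> t $ j) (velocity j)"
  shows "t \<in> {0..L} \<Longrightarrow> word_integral c t =
    (\<Sum>I\<in>{..<length c} \<rightarrow>\<^sub>E UNIV. word_coeff c I * of_real (iterated_integral \<gamma> (length c) t I))"
proof (induction c arbitrary: t)
  case Nil
  then show ?case by (simp add: word_coeff_def)
next
  case (Cons x c)
  let ?n = "length c" and ?g = "iterated_integral \<gamma>"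
  show ?case
  proof (rule primitive_unique[OF primitive_word_integral _ _ _ Cons.prems])
    show "primitive L (\<lambda>t. \<Sum>I\<in>{..<length (x # c)} \<rightarrow>\<^sub>E UNIV. word_coeff (x # c) I * of_real (?g (length (x # c)) t I))
      (\<lambda>t. \<Sum>I\<in>{..<length (x # c)} \<rightarrow>\<^sub>E UNIV. word_coeff (x # c) I * of_real (?g ?n t I * velocity (I ?n) t))"
      unfolding list.size(4) add_Suc_right add_0_right
      by (intro primitive_sum primitive_mult_left primitive_bounded_linear[OF primitive_iterated_integral[OF \<gamma>]] bounded_linear_of_real)
    fix s assume s: "s \<in> {0..L}"
    have "letter x s * word_integral c s = (\<Sum>j\<in>UNIV. letter_coeff x j * of_real (velocity j s)) *
      (\<Sum>J\<in>{..<?n} \<rightarrow>\<^sub>E UNIV. word_coeff c J * of_real (?g ?n s J))"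
      by (simp add: letter_eq_velocity Cons.IH[OF s])
    also have "\<dots> = (\<Sum>J\<in>{..<?n} \<rightarrow>\<^sub>E UNIV. \<Sum>j\<in>UNIV. 
       letter_coeff x j * of_real (velocity j s) * (word_coeff c J * of_real (?g ?n s J)))"
      by (subst sum.swap) (simp add: sum_product)
    also have "\<dots> = (\<Sum>J\<in>{..<?n} \<rightarrow>\<^sub>E UNIV. \<Sum>j\<in>UNIV. word_coeff (x # c) (J(?n := j)) *
       of_real (?g ?n s (J(?n := j)) * velocity ((J(?n := j)) ?n) s))"
    proof (intro sum.cong refl)
      fix J :: "nat \<Rightarrow> 2" and j
      have "?g ?n s (J(?n := j)) = ?g ?n s J" by (rule iterated_integral_cong) auto
      then show "letter_coeff x j * of_real (velocity j s) * (word_coeff c J * of_real (?g ?n s J)) =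
        word_coeff (x # c) (J(?n := j)) * of_real (?g ?n s (J(?n := j)) * velocity ((J(?n := j)) ?n) s)"
        by (simp add: word_coeff_Cons mult_ac)
    qed
    also have "\<dots> = (\<Sum>I\<in>{..<length (x # c)} \<rightarrow>\<^sub>E UNIV. word_coeff (x # c) I * of_real (?g ?n s I * velocity (I ?n) s))"
      by (simp add: sum_PiE_Suc)
    finally show "letter x s * word_integral c s = \<dots>" .
  next
    show "word_integral (x # c) 0 = (\<Sum>I\<in>{..<length (x # c)} \<rightarrow>\<^sub>E UNIV. word_coeff (x # c) I * of_real (?g (length (x # c)) 0 I))"
      using iterated_integral_Suc_0[OF \<gamma>] L_pos by (simp del: iterated_integral.simps)
  qed
qed

text \<open>
  Each letter is a form of norm 1, so the word is a functional of norm at most 1 for the projective norm.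
\<close>
lemma word_functional_le:
  fixes \<xi> :: "2 tensor"
  assumes r: "r \<in> representation_sums (length c) \<xi>"
  shows "norm (\<Sum>I\<in>{..<length c} \<rightarrow>\<^sub>E UNIV. word_coeff c I * of_real (\<xi> I)) \<le> r"
proof -
  let ?n = "length c"
  obtain m and v :: "nat \<Rightarrow> nat \<Rightarrow> real ^ 2" where v: "r = (\<Sum>i<m. \<Prod>k<?n. norm (v i k))"
    "\<And>I. I\<in>{..<?n} \<rightarrow>\<^sub>E UNIV \<Longrightarrow> \<xi> I = (\<Sum>i<m. elementary_tensor ?n (v i) I)"
    using r unfolding representation_sums_def by blast
  have "(\<Sum>I\<in>{..<?n} \<rightarrow>\<^sub>E UNIV. word_coeff c I * of_real (\<xi> I)) =
    (\<Sum>I\<in>{..<?n} \<rightarrow>\<^sub>E UNIV. \<Sum>i<m. \<Prod>k<?n. letter_coeff (rev c ! k) (I k) * of_real (v i k $ I k))"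
    by (simp add: v(2) word_coeff_def elementary_tensor_def sum_distrib_left prod.distrib)
  also have "\<dots> = (\<Sum>i<m. \<Sum>I\<in>{..<?n} \<rightarrow>\<^sub>E UNIV. \<Prod>k<?n. letter_coeff (rev c ! k) (I k) * of_real (v i k $ I k))"
    by (rule sum.swap)
  also have "\<dots> = (\<Sum>i<m. \<Prod>k<?n. \<Sum>j\<in>UNIV. letter_coeff (rev c ! k) j * of_real (v i k $ j))"
    by (subst prod_sum_PiE) auto
  also have "norm \<dots> \<le> r"
    unfolding v(1) by (intro sum_norm_le) (simp add: prod_norm[symmetric] norm_letter_coeff)
  finally show ?thesis .
qed

lemma max_word_le_projective_norm:
  fixes \<gamma> :: "real \<Rightarrow> real ^ 2"
  assumes \<gamma>: "\<And>j. primitive L (\<lambda>t. \<gamma> t $ j) (velocity j)" and n: "n > 0"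
  shows "max_word n \<le> projective_norm n (\<lambda>I. fact n * iterated_integral \<gamma> n L I)"
  unfolding projective_norm_eq_Inf
proof (rule cInf_greatest[OF representation_sums_nonempty[OF n]])
  fix r assume r: "r \<in> representation_sums n (\<lambda>I. fact n * iterated_integral \<gamma> n L I)"
  obtain c where c: "length c = n" "max_word n = fact n * norm (word_integral c L)"
    by (rule max_word_obtain)
  have "fact n * word_integral c L =
     (\<Sum>I\<in>{..<length c} \<rightarrow>\<^sub>E UNIV. word_coeff c I * of_real (fact n * iterated_integral \<gamma> n L I))"
    using word_integral_eq_sum[OF \<gamma>, of L c] L_pos c by (simp add: sum_distrib_left mult_ac)
  then have "norm (fact n * word_integral c L) \<le> r"
    using word_functional_le[of r c "\<lambda>I. fact n * iterated_integral \<gamma> n L I"] r c(1) by (simp only:)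
  then show "max_word n \<le> r" unfolding c by (simp add: norm_mult)
qed

lemma projective_norm_le_power:
  fixes \<gamma> :: "real \<Rightarrow> real ^ 2"
  assumes \<gamma>: "\<And>j. primitive L (\<lambda>t. \<gamma> t $ j) (velocity j)"
    and lip: "\<And>s t. 0 \<le> s \<Longrightarrow> s \<le> t \<Longrightarrow> t \<le> L \<Longrightarrow> norm (\<gamma> t - \<gamma> s) \<le> t - s" and n: "n > 0"
  shows "projective_norm n (\<lambda>I. fact n * iterated_integral \<gamma> n L I) \<le> L ^ n"
proof -
  have "projective_norm n (\<lambda>I. fact n * iterated_integral \<gamma> n L I) \<le> \<bar>fact n\<bar> * projective_norm n (iterated_integral \<gamma> n L)"
    by (rule projective_norm_scale_le[OF n])
  also have "\<dots> \<le> \<bar>fact n\<bar> * (L ^ n / fact n)"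
    using L_pos by (intro mult_left_mono projective_norm_iterated_integral_le[OF \<gamma> lip]) auto
  finally show ?thesis by simp
qed

end

section \<open>The hyperbolic development\<close>

lemma primitive_nonpos_le:
  fixes X x :: "real \<Rightarrow> real"
  assumes X: "primitive L X x" and neg: "\<And>t. t \<in> {0..L} \<Longrightarrow> x t \<le> 0" and st: "0 \<le> s" "s \<le> t" "t \<le> L"
  shows "X t \<le> X s"
proof -
  have "X t - X s \<le> 0"
    by (rule has_integral_le[OF primitiveD(3)[OF X st] has_integral_0]) (use neg st in auto)
  then show ?thesis by simp
qed

lemma primitive_cnj: "primitive L X x \<Longrightarrow> primitive L (\<lambda>t. cnj (X t)) (\<lambda>t. cnj (x t))"
  by (rule primitive_bounded_linear[OF _ bounded_linear_cnj])

lemma primitive_Re: "primitive L X x \<Longrightarrow> primitive L (\<lambda>t. Re (X t)) (\<lambda>t. Re (x t))"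
  by (rule primitive_bounded_linear[OF _ bounded_linear_Re])

lemma primitive_Im: "primitive L X x \<Longrightarrow> primitive L (\<lambda>t. Im (X t)) (\<lambda>t. Im (x t))"
  by (rule primitive_bounded_linear[OF _ bounded_linear_Im])

lemma primitive_of_real: "primitive L X x \<Longrightarrow> primitive L (\<lambda>t. complex_of_real (X t)) (\<lambda>t. complex_of_real (x t))"
  by (rule primitive_bounded_linear[OF _ bounded_linear_of_real])

lemma continuous_positive_lower_bound:
  fixes X :: "real \<Rightarrow> real"
  assumes "continuous_on {0..L} X" "\<And>t. t \<in> {0..L} \<Longrightarrow> X t > 0"
  obtains m where "m > 0" "\<And>t. t \<in> {0..L} \<Longrightarrow> X t \<ge> m"
proof (cases "L \<ge> 0")
  case True
  then obtain t where "t \<in> {0..L}" "\<And>s. s \<in> {0..L} \<Longrightarrow> X t \<le> X s"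
    using continuous_attains_inf[OF compact_Icc _ assms(1)] by auto
  then show ?thesis using that[of "X t"] assms(2) by blast
qed (use that[of 1] in auto)

lemma primitive_inverse:
  fixes X x :: "real \<Rightarrow> real"
  assumes X: "primitive L X x" and pos: "\<And>t. t \<in> {0..L} \<Longrightarrow> X t > 0"
  shows "primitive L (\<lambda>t. 1 / X t) (\<lambda>t. - (1 / (X t)\<^sup>2) * x t)"
proof -
  obtain m where m: "m > 0" "\<And>t. t \<in> {0..L} \<Longrightarrow> X t \<ge> m"
    using continuous_positive_lower_bound[OF primitive_continuous[OF X] pos] by blast
  show ?thesis
  proof (rule primitive_chain[OF X, where S="{m..}" and f="\<lambda>r. 1 / r" and f'="\<lambda>r. - (1 / r\<^sup>2)" and B="1/m\<^sup>2 * (2/m)"])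
    fix r assume "r \<in> {m..}"
    then have "r \<noteq> 0" using m by auto
    then show "((\<lambda>r. 1 / r) has_real_derivative - (1 / r\<^sup>2)) (at r within {m..})"
      by (auto intro!: derivative_eq_intros simp: power2_eq_square)
  next
    fix p r assume pr: "p \<in> {m..}" "r \<in> {m..}"
    then have pos: "p > 0" "r > 0" using m by auto
    have "- (1 / p\<^sup>2) - - (1 / r\<^sup>2) = ((p - r) * (1 / (p * r))) * (1 / p + 1 / r)"
      using pos by (simp add: field_simps power2_eq_square)
    then have "\<bar>- (1 / p\<^sup>2) - - (1 / r\<^sup>2)\<bar> = \<bar>p - r\<bar> * (1 / (p * r)) * (1 / p + 1 / r)"
      using pos by (simp add: abs_mult)
    also have "\<dots> \<le> \<bar>p - r\<bar> * (1 / m\<^sup>2) * (1 / m + 1 / m)"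
      using pr m pos unfolding power2_eq_square
      by (intro mult_mono add_mono divide_left_mono) auto
    finally show "\<bar>- (1 / p\<^sup>2) - - (1 / r\<^sup>2)\<bar> \<le> 1/m\<^sup>2 * (2/m) * \<bar>p - r\<bar>"
      by (simp add: mult_ac)
  qed (use m in auto)
qed

lemma primitive_ln:
  fixes X x :: "real \<Rightarrow> real"
  assumes X: "primitive L X x" and pos: "\<And>t. t \<in> {0..L} \<Longrightarrow> X t > 0"
  shows "primitive L (\<lambda>t. ln (X t)) (\<lambda>t. 1 / X t * x t)"
proof -
  obtain m where m: "m > 0" "\<And>t. t \<in> {0..L} \<Longrightarrow> X t \<ge> m"
    using continuous_positive_lower_bound[OF primitive_continuous[OF X] pos] by blast
  show ?thesis
  proof (rule primitive_chain[OF X, where S="{m..}" and f=ln and f'="\<lambda>r. 1 / r" and B="1/m\<^sup>2"])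
    fix r assume "r \<in> {m..}"
    then show "(ln has_real_derivative 1 / r) (at r within {m..})"
      using m by (auto intro!: derivative_eq_intros)
  next
    fix p r assume pr: "p \<in> {m..}" "r \<in> {m..}"
    then have pos: "p > 0" "r > 0" using m by auto
    have "1 / p - 1 / r = (r - p) * (1 / (p * r))"
      using pos by (simp add: field_simps)
    then have "\<bar>1 / p - 1 / r\<bar> = \<bar>p - r\<bar> * (1 / (p * r))"
      using pos by (simp add: abs_mult abs_minus_commute)
    also have "\<dots> \<le> \<bar>p - r\<bar> * (1 / m\<^sup>2)"
      using pr m pos unfolding power2_eq_square
      by (intro mult_mono divide_left_mono) auto
    finally show "\<bar>1 / p - 1 / r\<bar> \<le> 1/m\<^sup>2 * \<bar>p - r\<bar>"
      by (simp add: mult_ac)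
  qed (use m in auto)
qed

context angle_path begin

text \<open>
  The word of length \<open>n\<close> with alternating letters whose innermost letter is \<open>cnj w\<close>.
\<close>
primrec alternating_word :: "nat \<Rightarrow> bool list" where
  "alternating_word 0 = []"
| "alternating_word (Suc n) = odd n # alternating_word n"

lemma length_alternating_word [simp]: "length (alternating_word n) = n"
  by (induction n) auto

abbreviation alt :: "nat \<Rightarrow> real \<Rightarrow> complex" where
  "alt n \<equiv> word_integral (alternating_word n)"

text \<open>
  The power series with parameter \<open>\<mu>\<close> of the integrals of the alternating words, restricted to even lengths for
  \<open>b = True\<close> and to odd lengths for \<open>b = False\<close>.  The two series are the first column of the matrix that solves the linear
  equation with generator \<open>\<mu>\<close> times the matrix with zero diagonal and off-diagonal entries \<open>w\<close> and \<open>cnj w\<close>.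
\<close>
definition development_term :: "bool \<Rightarrow> complex \<Rightarrow> nat \<Rightarrow> real \<Rightarrow> complex" where
  "development_term b \<mu> n t = (if even n = b then \<mu> ^ n * alt n t else 0)"

definition development :: "bool \<Rightarrow> complex \<Rightarrow> real \<Rightarrow> complex" where
  "development b \<mu> t = (\<Sum>n. development_term b \<mu> n t)"

lemma norm_development_term_le:
  assumes t: "t \<in> {0..L}"
  shows "norm (development_term b \<mu> n t) \<le> (norm \<mu> * L) ^ n /\<^sub>R fact n"
proof -
  have "norm (alt n t) \<le> t ^ n / fact n"
    using norm_word_integral_le[of t "alternating_word n"] t by simp
  also have "\<dots> \<le> L ^ n / fact n"
    using t by (intro divide_right_mono power_mono) auto
  finally have "norm \<mu> ^ n * norm (alt n t) \<le> norm \<mu> ^ n * (L ^ n / fact n)"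
    by (intro mult_left_mono) auto
  then show ?thesis
    using L_pos by (auto simp: development_term_def norm_mult norm_power power_mult_distrib divide_inverse mult_ac)
qed

lemma summable_exp_series: "summable (\<lambda>n. (x::real) ^ n /\<^sub>R fact n)"
  by (rule summable_exp_generic)

lemma summable_development: "t \<in> {0..L} \<Longrightarrow> summable (\<lambda>n. development_term b \<mu> n t)"
  by (rule summable_comparison_test'[OF summable_exp_series, of 0]) (use norm_development_term_le in auto)

lemma primitive_development:
  "primitive L (development b \<mu>) (\<lambda>t. \<mu> * letter b t * development (\<not> b) \<mu> t)"
proof -
  define dterm where "dterm n t = (case n of 0 \<Rightarrow> 0 | Suc m \<Rightarrow> \<mu> * letter b t * development_term (\<not> b) \<mu> m t)" for n t
  define N where "N n = (case n of 0 \<Rightarrow> 0 | Suc m \<Rightarrow> norm \<mu> * ((norm \<mu> * L) ^ m /\<^sub>R fact m))" for n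
  have P: "primitive L (development_term b \<mu> n) (dterm n)" for n
  proof (cases n)
    case 0
    have "primitive L (\<lambda>t. if b then 1 else 0) (\<lambda>_. 0 :: complex)" by (rule primitive_const)
    then show ?thesis
      by (rule primitive_cong) (auto simp: 0 dterm_def development_term_def)
  next
    case (Suc m)
    show ?thesis
    proof (cases "even n = b")
      case True
      have "primitive L (\<lambda>t. \<mu> ^ n * alt n t) (\<lambda>t. \<mu> ^ n * (letter (odd m) t * alt m t))"
        unfolding Suc alternating_word.simps by (intro primitive_mult_left primitive_word_integral)
      then show ?thesis
        by (rule primitive_cong) (use True in \<open>auto simp: Suc dterm_def development_term_def\<close>)
    next
      case False
      have "primitive L (\<lambda>t. 0) (\<lambda>_. 0 :: complex)" by (rule primitive_const)
      then show ?thesis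
        by (rule primitive_cong) (use False in \<open>auto simp: Suc dterm_def development_term_def\<close>)
    qed
  qed
  have "summable (\<lambda>m. N (Suc m))"
    unfolding N_def nat.case by (intro summable_mult summable_exp_series)
  then have sN: "summable N" by (simp only: summable_Suc_iff)
  have bN: "norm (dterm n t) \<le> N n" if t: "t \<in> {0..L}" for n t
    using norm_development_term_le[OF t]
    by (auto simp: N_def dterm_def norm_mult split: nat.split intro!: mult_left_mono)
  have "primitive L (\<lambda>t. \<Sum>n. development_term b \<mu> n t) (\<lambda>t. \<Sum>n. dterm n t)"
    by (rule primitive_suminf[OF P norm_development_term_le summable_exp_series bN sN])
  then show ?thesis
  proof (rule primitive_cong)
    fix t assume t: "t \<in> {0..L}"
    have "summable (\<lambda>n. dterm n t)"
      by (rule summable_comparison_test'[OF sN, of 0]) (use bN t in auto)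
    then have "(\<Sum>n. dterm n t) = (\<Sum>n. dterm (Suc n) t)"
      using suminf_split_head[of "\<lambda>n. dterm n t"] by (simp add: dterm_def)
    also have "\<dots> = \<mu> * letter b t * development (\<not> b) \<mu> t"
      unfolding development_def
      by (subst suminf_mult[symmetric]) (use summable_development[OF t] in \<open>auto simp: dterm_def\<close>)
    finally show "(\<Sum>n. dterm n t) = \<mu> * letter b t * development (\<not> b) \<mu> t" .
  qed (simp add: development_def)
qed

lemma development_0: "development b \<mu> 0 = (if b then 1 else 0)"
proof -
  have z: "alt n 0 = 0" if "n > 0" for n
    using that by (cases n) auto
  have "development b \<mu> 0 = (\<Sum>n\<in>{0}. development_term b \<mu> n 0)"
    unfolding development_def by (rule suminf_finite) (auto simp: development_term_def z)
  then show ?thesis by (auto simp: development_term_def)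
qed

lemma sum_norm_development_le:
  assumes A: "\<And>n. fact n * norm (alt n L) \<le> l ^ n" and l: "l \<ge> 0"
  shows "norm (development True \<mu> L) + norm (development False \<mu> L) \<le> exp (norm \<mu> * l)"
proof -
  have LL: "L \<in> {0..L}" using L_pos by simp
  have s: "summable (\<lambda>n. norm (development_term b \<mu> n L))" for b
    by (rule summable_comparison_test'[OF summable_exp_series, of 0]) (use norm_development_term_le[OF LL] in auto)
  have "norm (development True \<mu> L) + norm (development False \<mu> L) \<le>
     (\<Sum>n. norm (development_term True \<mu> n L)) + (\<Sum>n. norm (development_term False \<mu> n L))"
    unfolding development_def by (intro add_mono summable_norm s)
  also have "\<dots> = (\<Sum>n. norm (development_term True \<mu> n L) + norm (development_term False \<mu> n L))"
    by (rule suminf_add[OF s s])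
  also have "\<dots> \<le> (\<Sum>n. (norm \<mu> * l) ^ n /\<^sub>R fact n)"
  proof (rule suminf_le[OF _ summable_add[OF s s] summable_exp_series])
    fix n
    have "norm \<mu> ^ n * norm (alt n L) \<le> norm \<mu> ^ n * (l ^ n / fact n)"
      using A[of n] by (intro mult_left_mono) (auto simp: field_simps)
    then show "norm (development_term True \<mu> n L) + norm (development_term False \<mu> n L) \<le> (norm \<mu> * l) ^ n /\<^sub>R fact n"
      by (auto simp: development_term_def norm_mult norm_power power_mult_distrib divide_inverse mult_ac)
  qed
  also have "\<dots> = exp (norm \<mu> * l)" by (simp add: exp_def)
  finally show ?thesis .
qed

lemma letter_cnj: "cnj (letter b t) = letter (\<not> b) t"
  by (simp add: letter_def)

text \<open>
  The Hermitian part of the generator has norm \<open>\<bar>Re \<mu>\<bar>\<close>, so only the real part of the parameter contributes to the growth.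
\<close>
lemma development_energy_le:
  "(norm (development True \<mu> L))\<^sup>2 + (norm (development False \<mu> L))\<^sup>2 \<le> exp (2 * \<bar>Re \<mu>\<bar> * L)"
proof -
  let ?P = "development True \<mu>" and ?Q = "development False \<mu>"
  let ?N = "\<lambda>t. Re (?P t * cnj (?P t)) + Re (?Q t * cnj (?Q t))"
  let ?k = "\<bar>Re \<mu>\<bar>"
  have N: "?N t = (norm (?P t))\<^sup>2 + (norm (?Q t))\<^sup>2" for t
    by (simp add: complex_mult_cnj cmod_def flip: power2_eq_square)
  let ?n = "\<lambda>t. Re ((\<mu> * letter True t * ?Q t) * cnj (?P t) + ?P t * cnj (\<mu> * letter True t * ?Q t))
       + Re ((\<mu> * letter False t * ?P t) * cnj (?Q t) + ?Q t * cnj (\<mu> * letter False t * ?P t))"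
  have pN: "primitive L ?N ?n"
    using primitive_development[of True \<mu>] primitive_development[of False \<mu>]
    by (intro primitive_add primitive_Re primitive_mult primitive_cnj) simp_all
  have pE: "primitive L (\<lambda>t. exp (- 2 * ?k * t)) (\<lambda>t. - 2 * ?k * exp (- 2 * ?k * t))"
    by (rule primitive_smooth) (auto intro!: derivative_eq_intros continuous_intros)
  have "exp (- 2 * ?k * L) * ?N L \<le> exp (- 2 * ?k * 0) * ?N 0"
  proof (rule primitive_nonpos_le[OF primitive_mult[OF pE pN]])
    fix t assume "t \<in> {0..L}"
    define c where "c = letter True t * ?Q t * cnj (?P t)"
    have "?n t = 4 * Re \<mu> * Re c"
      by (simp add: c_def letter_cnj[of True, simplified, symmetric] algebra_simps)
    also have "\<dots> \<le> 4 * (?k * norm c)"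
      using abs_Re_le_cmod[of c] mult_mono[of "\<bar>Re \<mu>\<bar>" "\<bar>Re \<mu>\<bar>" "\<bar>Re c\<bar>" "norm c"]
      by (simp add: abs_mult[symmetric])
    also have "norm c = norm (?Q t) * norm (?P t)" by (simp add: c_def norm_mult)
    also have "4 * (?k * (norm (?Q t) * norm (?P t))) \<le> 2 * ?k * ?N t"
      using mult_left_mono[OF sum_squares_bound[of "norm (?Q t)" "norm (?P t)"], of "2 * ?k"]
      unfolding N by (simp add: algebra_simps)
    finally have "exp (- 2 * ?k * t) * (?n t - 2 * ?k * ?N t) \<le> 0"
      by (intro mult_nonneg_nonpos) auto
    then show "- 2 * ?k * exp (- 2 * ?k * t) * ?N t + exp (- 2 * ?k * t) * ?n t \<le> 0"
      by (simp add: algebra_simps)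
  qed (use L_pos in auto)
  then have "exp (- (2 * ?k * L)) * ?N L \<le> 1" by (simp add: development_0)
  then show ?thesis unfolding N by (simp add: exp_minus field_simps)
qed

text \<open>
  For a real parameter the development has determinant 1.
\<close>
lemma development_det:
  fixes l :: real
  assumes t: "t \<in> {0..L}"
  shows "(norm (development True l t))\<^sup>2 - (norm (development False l t))\<^sup>2 = 1"
proof -
  let ?P = "development True l" and ?Q = "development False l"
  let ?N = "\<lambda>t. ?P t * cnj (?P t) - ?Q t * cnj (?Q t)"
  have pN: "primitive L ?N (\<lambda>t. ((l * letter True t * ?Q t) * cnj (?P t) + ?P t * cnj (l * letter True t * ?Q t))
       - ((l * letter False t * ?P t) * cnj (?Q t) + ?Q t * cnj (l * letter False t * ?P t)))"
    using primitive_development[of True l] primitive_development[of False l]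
    by (intro primitive_diff primitive_mult primitive_cnj) simp_all
  have "?N t = 1"
  proof (rule primitive_unique[OF pN primitive_const _ _ t])
    fix t
    show "((l * letter True t * ?Q t) * cnj (?P t) + ?P t * cnj (l * letter True t * ?Q t))
       - ((l * letter False t * ?P t) * cnj (?Q t) + ?Q t * cnj (l * letter False t * ?P t)) = 0"
      by (simp add: letter_cnj algebra_simps)
  qed (simp add: development_0)
  then have "of_real ((norm (?P t))\<^sup>2 - (norm (?Q t))\<^sup>2) = (1 :: complex)"
    by (simp only: of_real_diff complex_norm_square)
  then show ?thesis using of_real_eq_1_iff by blast
qed

text \<open>
  A solution without zeros of \<open>z' = l w cnj z\<close> on \<open>[0, L]\<close>.
\<close>
definition solution :: "real \<Rightarrow> (real \<Rightarrow> complex) \<Rightarrow> bool" where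
  "solution l z \<longleftrightarrow> primitive L z (\<lambda>t. l * cis (\<beta> t) * cnj (z t)) \<and> (\<forall>t\<in>{0..L}. z t \<noteq> 0)"

text \<open>
  The value of a solution can be prescribed at any time \<open>s\<close>, because the development up to time \<open>s\<close> is invertible.
\<close>
lemma exists_solution:
  fixes l :: real
  assumes s: "s \<in> {0..L}" and z\<^sub>1: "z\<^sub>1 \<noteq> 0"
  obtains z where "solution l z" "z s = z\<^sub>1"
    "norm (z L) \<le> (norm (development True l L) + norm (development False l L)) * norm (z 0)"
proof -
  let ?P = "development True l" and ?Q = "development False l"
  \<comment> \<open>The inverse of the real linear map that takes \<open>z 0\<close> to \<open>z s\<close>; its determinant is 1.\<close>
  define z\<^sub>0 where "z\<^sub>0 = cnj (?P s) * z\<^sub>1 - cnj (?Q s) * cnj z\<^sub>1"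
  define z where "z t = ?P t * z\<^sub>0 + cnj (?Q t * z\<^sub>0)" for t
  have det: "?P t * cnj (?P t) - ?Q t * cnj (?Q t) = 1" if "t \<in> {0..L}" for t
    using arg_cong[OF development_det[OF that, of l], of complex_of_real]
    by (simp only: of_real_diff complex_norm_square of_real_1)
  have "z s = (?P s * cnj (?P s) - ?Q s * cnj (?Q s)) * z\<^sub>1"
    by (simp add: z_def z\<^sub>0_def algebra_simps)
  then have zs: "z s = z\<^sub>1" using det[OF s] by simp
  then have "z\<^sub>0 \<noteq> 0" using z\<^sub>1 by (auto simp: z_def)
  have nz: "z t \<noteq> 0" if t: "t \<in> {0..L}" for t
  proof
    assume "z t = 0"
    then have "?P t * z\<^sub>0 = - cnj (?Q t * z\<^sub>0)" by (simp add: z_def add_eq_0_iff2)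
    then have "norm (?P t * z\<^sub>0) = norm (- cnj (?Q t * z\<^sub>0))" by (rule arg_cong)
    then have "norm (?P t) = norm (?Q t)" using \<open>z\<^sub>0 \<noteq> 0\<close> by (simp add: norm_mult)
    then show False using development_det[OF t, of l] by simp
  qed
  have p: "primitive L z (\<lambda>t. (l * letter True t * ?Q t) * z\<^sub>0 + cnj ((l * letter False t * ?P t) * z\<^sub>0))"
    unfolding z_def using primitive_development[of True l] primitive_development[of False l]
    by (intro primitive_add primitive_cnj primitive_bounded_linear[OF _ bounded_linear_mult_left]) simp_all
  have "primitive L z (\<lambda>t. l * cis (\<beta> t) * cnj (z t))"
    using p by (rule primitive_cong) (simp_all add: z_def letter_def algebra_simps)
  then have sol: "solution l z" using nz by (simp add: solution_def)
  have "norm (z L) \<le> norm (?P L * z\<^sub>0) + norm (cnj (?Q L * z\<^sub>0))"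
    unfolding z_def by (rule norm_triangle_ineq)
  also have "\<dots> = (norm (?P L) + norm (?Q L)) * norm z\<^sub>0"
    by (simp add: norm_mult algebra_simps)
  finally have "norm (z L) \<le> (norm (?P L) + norm (?Q L)) * norm (z 0)"
    by (simp add: z_def development_0)
  with that sol zs show ?thesis by blast
qed

end

section \<open>Dynamics of the direction of a solution\<close>

lemma sum_integral_uniform_partition:
  fixes F :: "real \<Rightarrow> 'a::banach"
  assumes F: "F integrable_on {0..L}" and L: "L \<ge> 0" and K: "K > 0" and k: "k \<le> K"
  shows "(\<Sum>i<k. integral {L * real i / real K..L * real (Suc i) / real K} F) = integral {0..L * real k / real K} F"
  using k
proof (induction k)
  case (Suc k)
  have le: "L * real i / real K \<le> L" if "i \<le> K" for i
  proof -
    have "L * real i \<le> L * real K" using L that by (intro mult_left_mono) auto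
    then show ?thesis using K by (simp add: divide_le_eq)
  qed
  have "integral {0..L * real k / real K} F + integral {L * real k / real K..L * real (Suc k) / real K} F
      = integral {0..L * real (Suc k) / real K} F"
  proof (rule Henstock_Kurzweil_Integration.integral_combine)
    show "0 \<le> L * real k / real K" using L by simp
    show "L * real k / real K \<le> L * real (Suc k) / real K"
      using L by (intro divide_right_mono mult_left_mono) auto
    show "F integrable_on {0..L * real (Suc k) / real K}"
      by (rule integrable_on_subinterval[OF F]) (use le[OF Suc.prems] in auto)
  qed
  then show ?case using Suc by simp
qed simp

lemma AE_lebesgue_on_obtain:
  assumes "AE t in lebesgue_on S. P t" "S \<in> sets lebesgue"
  obtains N where "negligible N" "\<And>t. t \<in> S \<Longrightarrow> t \<notin> N \<Longrightarrow> P t"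
proof -
  have "AE t in lebesgue. t \<in> S \<longrightarrow> P t"
    using assms by (simp add: AE_restrict_space_iff)
  from AE_E3[OF this] obtain N where "\<And>x. x \<in> space lebesgue - N \<Longrightarrow> x \<in> S \<longrightarrow> P x" "N \<in> null_sets lebesgue"
    by blast
  then show ?thesis using that[of N] by (auto simp: negligible_iff_null_sets)
qed

lemma has_integral_mono_negligible:
  fixes f g :: "real \<Rightarrow> real"
  assumes f: "(f has_integral i) S" and g: "(g has_integral j) S" and N: "negligible N"
    and le: "\<And>t. t \<in> S \<Longrightarrow> t \<notin> N \<Longrightarrow> f t \<le> g t"
  shows "i \<le> j"
proof -
  have "((\<lambda>t. if t \<in> N then g t else f t) has_integral i) S"
    by (rule has_integral_spike[OF N _ f]) auto
  then show ?thesis by (rule has_integral_le[OF _ g]) (use le in auto)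
qed

context angle_path begin

lemma norm_letter_diff_integrable:
  assumes h: "continuous_on {0..L} h" and st: "0 \<le> s" "t \<le> L"
  shows "(\<lambda>r. norm (letter b r - h r)) integrable_on {s..t}"
proof -
  have m: "(\<lambda>r. letter b r - h r) \<in> borel_measurable (lebesgue_on {0..L})"
    by (intro borel_measurable_diff letter_measurable continuous_imp_measurable_on_Icc h)
  obtain A where A: "\<And>r. r \<in> {0..L} \<Longrightarrow> norm (h r) \<le> A"
    using compact_imp_bounded[OF compact_continuous_image[OF h compact_Icc]] unfolding bounded_iff by blast
  have "norm (letter b r - h r) \<le> 1 + A" if "r \<in> {0..L}" for r
    using norm_triangle_ineq4[of "letter b r" "h r"] A[OF that] by simp
  then have b: "bounded ((\<lambda>r. letter b r - h r) ` {0..L})" unfolding bounded_iff by blast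
  show ?thesis
    using absolutely_integrable_norm[OF bounded_measurable_absolutely_integrable[OF m b st]]
      set_lebesgue_integral_eq_integral(1) by (simp add: o_def) blast
qed

text \<open>
  A continuous function close to the velocity in \<open>L\<^sup>1\<close> that keeps the bound 1.
\<close>
lemma continuous_approximation:
  assumes e: "e > 0"
  obtains h where "continuous_on {0..L} h" "\<And>t. norm (h t) \<le> 1"
    "integral {0..L} (\<lambda>t. norm (letter True t - h t)) < e"
proof -
  \<comment> \<open>A measurable function is a limit almost everywhere of continuous functions; these are cut off to the unit disc.\<close>
  have "letter True measurable_on {0..L}"
    using letter_measurable measurable_on_iff_borel_measurable[of "{0..L}" "letter True"] by auto
  then obtain N g where N: "negligible N" and g: "\<And>n. continuous_on UNIV (g n)"
    and lim: "\<And>x. x \<notin> N \<Longrightarrow> (\<lambda>n. g n x) \<longlonglongrightarrow> (if x \<in> {0..L} then letter True x else 0)"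
    unfolding measurable_on_def by blast
  define h where "h n x = g n x /\<^sub>R max 1 (norm (g n x))" for n x
  have hc: "continuous_on {0..L} (h n)" for n
    unfolding h_def by (intro continuous_intros continuous_on_subset[OF g]) auto
  have h1: "norm (h n x) \<le> 1" for n x
    by (auto simp: h_def field_simps max_def)
  define F where "F n x = (if x \<in> N then 0 else norm (letter True x - h n x))" for n x
  have eq: "integral {0..L} (F n) = integral {0..L} (\<lambda>t. norm (letter True t - h n t))" for n
    by (rule integral_spike[OF N]) (simp add: F_def)
  have int: "F n integrable_on {0..L}" for n
    by (rule integrable_spike[OF norm_letter_diff_integrable[OF hc] N]) (auto simp: F_def)
  have bound: "norm (F n x) \<le> 2" for n x
    using norm_triangle_ineq4[of "letter True x" "h n x"] h1[of n x] by (auto simp: F_def)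
  have pw: "(\<lambda>n. F n x) \<longlonglongrightarrow> 0" if x: "x \<in> {0..L}" for x
  proof (cases "x \<in> N")
    case False
    have "(\<lambda>n. g n x) \<longlonglongrightarrow> letter True x" using lim[OF False] x by simp
    then have "(\<lambda>n. norm (letter True x - h n x)) \<longlonglongrightarrow> norm (letter True x - letter True x /\<^sub>R max 1 (norm (letter True x)))"
      unfolding h_def by (intro tendsto_intros) auto
    then show ?thesis using False by (simp add: F_def)
  qed (simp add: F_def)
  have "(\<lambda>n. integral {0..L} (F n)) \<longlonglongrightarrow> integral {0..L} (\<lambda>_. 0)"
    by (rule dominated_convergence(2)[OF int integrable_const_ivl[of 2] bound pw])
  then have "(\<lambda>n. integral {0..L} (F n)) \<longlonglongrightarrow> 0" by simp
  then have "eventually (\<lambda>n. integral {0..L} (F n) < e) sequentially"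
    using e by (rule order_tendstoD)
  then obtain n where "integral {0..L} (F n) < e"
    using eventually_happens by force
  then show ?thesis using that[OF hc h1] unfolding eq by blast
qed

text \<open>
  The direction of the path is, up to a small error in \<open>L\<^sup>1\<close>, a step function on a uniform partition.
\<close>
lemma step_approximation:
  assumes e: "e > 0"
  obtains K :: nat and v where "K > 0" "\<And>i. norm (v i) \<le> 1"
    "(\<Sum>i<K. integral {L * real i / real K..L * real (Suc i) / real K} (\<lambda>t. norm (letter True t - v i))) \<le> e"
proof -
  obtain h where h: "continuous_on {0..L} h" "\<And>t. norm (h t) \<le> 1"
    "integral {0..L} (\<lambda>t. norm (letter True t - h t)) < e/2"
    using continuous_approximation[of "e/2"] e by auto
  have "uniformly_continuous_on {0..L} h"
    by (intro compact_uniformly_continuous h compact_Icc)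
  then obtain d where d: "d > 0" "\<And>p q. p \<in> {0..L} \<Longrightarrow> q \<in> {0..L} \<Longrightarrow> dist q p < d \<Longrightarrow> dist (h q) (h p) < e/(2*L)"
    using e L_pos unfolding uniformly_continuous_on_def by (metis divide_pos_pos mult_pos_pos zero_less_numeral)
  obtain K :: nat where K: "L / d < real K" using reals_Archimedean2 by blast
  have K0: "K > 0" using K L_pos d(1) by (metis divide_pos_pos gr0I not_less_iff_gr_or_eq of_nat_0 order_less_trans)
  let ?a = "\<lambda>i. L * real i / real K"
  have sub: "0 \<le> ?a i" "?a i \<le> ?a (Suc i)" "?a (Suc i) \<le> L" "?a (Suc i) - ?a i = L / real K" if "i < K" for i
  proof -
    show "0 \<le> ?a i" using L_pos by simp
    show *: "?a (Suc i) - ?a i = L / real K" by (simp add: field_simps add_divide_distrib)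
    show "?a i \<le> ?a (Suc i)" using * L_pos by (metis diff_ge_0_iff_ge divide_nonneg_nonneg of_nat_0_le_iff less_imp_le)
    have "L * real (Suc i) \<le> L * real K" using L_pos that by (intro mult_left_mono) auto
    then show "?a (Suc i) \<le> L" using K0 by (simp add: divide_le_eq)
  qed
  define v where "v i = h (?a i)" for i
  let ?G = "\<lambda>t. norm (letter True t - h t)"
  have each: "integral {?a i..?a (Suc i)} (\<lambda>t. norm (letter True t - v i)) \<le> integral {?a i..?a (Suc i)} ?G + e / (2 * real K)"
    if i: "i < K" for i
  proof -
    note s = sub[OF i]
    have iG: "?G integrable_on {?a i..?a (Suc i)}"
      by (rule norm_letter_diff_integrable[OF h(1)]) (use s in auto)
    have "integral {?a i..?a (Suc i)} (\<lambda>t. norm (letter True t - v i)) \<le> integral {?a i..?a (Suc i)} (\<lambda>t. ?G t + e/(2*L))"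
    proof (rule integral_le)
      show "(\<lambda>t. norm (letter True t - v i)) integrable_on {?a i..?a (Suc i)}"
        by (rule norm_letter_diff_integrable) (use s in auto)
      show "(\<lambda>t. ?G t + e/(2*L)) integrable_on {?a i..?a (Suc i)}"
        by (intro integrable_add iG integrable_const_ivl)
      fix t assume t: "t \<in> {?a i..?a (Suc i)}"
      have "L / real K < d" using K K0 d(1) L_pos by (simp add: field_simps)
      then have "dist (h t) (h (?a i)) < e/(2*L)"
        using t s by (intro d(2)) (auto simp: dist_real_def)
      then show "norm (letter True t - v i) \<le> ?G t + e/(2*L)"
        using norm_triangle_ineq[of "letter True t - h t" "h t - h (?a i)"] by (simp add: v_def dist_norm)
    qed
    also have "\<dots> = integral {?a i..?a (Suc i)} ?G + integral {?a i..?a (Suc i)} (\<lambda>t. e/(2*L))"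
      by (rule Henstock_Kurzweil_Integration.integral_add[OF iG integrable_const_ivl])
    also have "integral {?a i..?a (Suc i)} (\<lambda>t. e/(2*L)) = (?a (Suc i) - ?a i) * (e / (2*L))"
      using s by simp
    also have "\<dots> = e / (2 * real K)"
      unfolding s(4) using L_pos by simp
    finally show ?thesis .
  qed
  have "(\<Sum>i<K. integral {?a i..?a (Suc i)} (\<lambda>t. norm (letter True t - v i))) \<le>
      (\<Sum>i<K. integral {?a i..?a (Suc i)} ?G + e / (2 * real K))"
    using each by (intro sum_mono) auto
  also have "\<dots> = (\<Sum>i<K. integral {?a i..?a (Suc i)} ?G) + e/2"
    using K0 by (simp add: sum.distrib)
  also have "(\<Sum>i<K. integral {?a i..?a (Suc i)} ?G) = integral {0..L} ?G"
    using sum_integral_uniform_partition[OF norm_letter_diff_integrable[OF h(1), of 0 L True], of K K] K0 L_pos by simp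
  finally show ?thesis
    using that[OF K0, of v] h(2,3) by (force simp: v_def)
qed

text \<open>
  The direction of \<open>z\<^sup>2\<close>, and the cosine of the angle that it forms with the velocity of the path.
\<close>
definition direction :: "(real \<Rightarrow> complex) \<Rightarrow> real \<Rightarrow> complex" where
  "direction z t = (z t)\<^sup>2 / of_real ((norm (z t))\<^sup>2)"

definition alignment :: "(real \<Rightarrow> complex) \<Rightarrow> real \<Rightarrow> real" where
  "alignment z t = Re (cis (\<beta> t) * cnj (direction z t))"

lemma norm_direction: "z t \<noteq> 0 \<Longrightarrow> norm (direction z t) = 1"
  by (simp add: direction_def norm_divide norm_power)

lemma abs_alignment_le: "z t \<noteq> 0 \<Longrightarrow> \<bar>alignment z t\<bar> \<le> 1"
  using abs_Re_le_cmod[of "cis (\<beta> t) * cnj (direction z t)"] norm_direction[of z t]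
  by (simp add: alignment_def norm_mult)

lemma solution_nonzero: "solution l z \<Longrightarrow> t \<in> {0..L} \<Longrightarrow> z t \<noteq> 0"
  by (simp add: solution_def)

lemma solution_primitive: "solution l z \<Longrightarrow> primitive L z (\<lambda>t. l * cis (\<beta> t) * cnj (z t))"
  by (simp add: solution_def)

lemma primitive_solution_square:
  assumes z: "solution l z"
  shows "primitive L (\<lambda>t. (z t)\<^sup>2) (\<lambda>t. of_real (2 * l * (norm (z t))\<^sup>2) * cis (\<beta> t))"
  using primitive_mult[OF solution_primitive[OF z] solution_primitive[OF z]]
proof (rule primitive_cong)
  fix t
  show "l * cis (\<beta> t) * cnj (z t) * z t + z t * (l * cis (\<beta> t) * cnj (z t)) = of_real (2 * l * (norm (z t))\<^sup>2) * cis (\<beta> t)"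
    by (simp only: of_real_mult[of _ "(norm (z t))\<^sup>2"] complex_norm_square) (simp add: algebra_simps)
qed (simp add: power2_eq_square)

lemma primitive_solution_norm:
  assumes z: "solution l z"
  shows "primitive L (\<lambda>t. (norm (z t))\<^sup>2) (\<lambda>t. 2 * l * (norm (z t))\<^sup>2 * alignment z t)"
proof (rule primitive_cong[OF primitive_Re[OF primitive_mult[OF solution_primitive[OF z] primitive_cnj[OF solution_primitive[OF z]]]]])
  fix t assume t: "t \<in> {0..L}"
  show "Re (z t * cnj (z t)) = (norm (z t))\<^sup>2"
    by (metis Re_complex_of_real complex_norm_square)
  have "cnj (direction z t) * of_real ((norm (z t))\<^sup>2) = (cnj (z t))\<^sup>2"
    using solution_nonzero[OF z t] by (simp add: direction_def)
  then have "(norm (z t))\<^sup>2 * alignment z t = Re (cis (\<beta> t) * (cnj (z t))\<^sup>2)"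
    unfolding alignment_def by (simp flip: \<open>cnj (direction z t) * of_real ((norm (z t))\<^sup>2) = (cnj (z t))\<^sup>2\<close> add: algebra_simps)
  moreover have "Re (l * cis (\<beta> t) * cnj (z t) * cnj (z t) + z t * cnj (l * cis (\<beta> t) * cnj (z t)))
     = 2 * l * Re (cis (\<beta> t) * (cnj (z t))\<^sup>2)"
    by (simp add: power2_eq_square algebra_simps)
  ultimately show "Re (l * cis (\<beta> t) * cnj (z t) * cnj (z t) + z t * cnj (l * cis (\<beta> t) * cnj (z t)))
     = 2 * l * (norm (z t))\<^sup>2 * alignment z t" by simp
qed

lemma primitive_alignment:
  assumes z: "solution l z" and l: "l > 0"
  shows "primitive L (\<lambda>t. 1 / (2 * l) * ln ((norm (z t))\<^sup>2)) (alignment z)"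
proof -
  have "primitive L (\<lambda>t. ln ((norm (z t))\<^sup>2)) (\<lambda>t. 1 / (norm (z t))\<^sup>2 * (2 * l * (norm (z t))\<^sup>2 * alignment z t))"
    by (rule primitive_ln[OF primitive_solution_norm[OF z]]) (use solution_nonzero[OF z] in auto)
  from primitive_mult_left[OF this, of "1/(2*l)"] show ?thesis
    by (rule primitive_cong) (use solution_nonzero[OF z] l in auto)
qed

lemma solution_growth:
  assumes z: "solution l z" and l: "l > 0"
  shows "norm (z L) = norm (z 0) * exp (l * integral {0..L} (alignment z))"
proof -
  have nz: "z 0 \<noteq> 0" "z L \<noteq> 0" using solution_nonzero[OF z] L_pos by auto
  have "integral {0..L} (alignment z) = 1 / (2 * l) * ln ((norm (z L))\<^sup>2) - 1 / (2 * l) * ln ((norm (z 0))\<^sup>2)"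
    using primitiveD(4)[OF primitive_alignment[OF z l], of 0 L] L_pos by simp
  also have "\<dots> = (ln (norm (z L)) - ln (norm (z 0))) / l"
    using nz l by (simp add: ln_realpow field_simps)
  finally have "l * integral {0..L} (alignment z) = ln (norm (z L)) - ln (norm (z 0))" using l by simp
  then show ?thesis using nz by (simp add: exp_diff)
qed

lemma primitive_direction:
  assumes z: "solution l z"
  shows "primitive L (direction z) (\<lambda>t. of_real (2 * l) * (cis (\<beta> t) - of_real (alignment z t) * direction z t))"
proof -
  have "primitive L (\<lambda>t. 1 / (norm (z t))\<^sup>2) (\<lambda>t. - (1 / ((norm (z t))\<^sup>2)\<^sup>2) * (2 * l * (norm (z t))\<^sup>2 * alignment z t))"
    by (rule primitive_inverse[OF primitive_solution_norm[OF z]]) (use solution_nonzero[OF z] in auto)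
  from primitive_mult[OF primitive_solution_square[OF z] primitive_of_real[OF this]] show ?thesis
  proof (rule primitive_cong)
    fix t assume t: "t \<in> {0..L}"
    show "(z t)\<^sup>2 * complex_of_real (1 / (norm (z t))\<^sup>2) = direction z t" by (simp add: direction_def)
    show "of_real (2 * l * (norm (z t))\<^sup>2) * cis (\<beta> t) * of_real (1 / (norm (z t))\<^sup>2) +
       (z t)\<^sup>2 * of_real (- (1 / ((norm (z t))\<^sup>2)\<^sup>2) * (2 * l * (norm (z t))\<^sup>2 * alignment z t)) =
       of_real (2 * l) * (cis (\<beta> t) - of_real (alignment z t) * direction z t)"
      using solution_nonzero[OF z t] by (simp add: direction_def field_simps power2_eq_square)
  qed
qed

lemma alignment_square_integrable:
  assumes z: "solution l z" and l: "l > 0" and st: "0 \<le> s" "t \<le> L"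
  shows "(\<lambda>t. 1 - (alignment z t)\<^sup>2) integrable_on {s..t}"
proof -
  have "(\<lambda>t. 1 - (alignment z t)\<^sup>2) \<in> borel_measurable (lebesgue_on {0..L})"
    using primitiveD(1)[OF primitive_alignment[OF z l]] by measurable
  moreover have "bounded ((\<lambda>t. 1 - (alignment z t)\<^sup>2) ` {0..L})"
    unfolding bounded_iff
    using abs_alignment_le[of z] solution_nonzero[OF z]
    by (intro exI[of _ 1]) (auto simp: abs_square_le_1)
  ultimately show ?thesis
    using bounded_measurable_absolutely_integrable[OF _ _ st] set_lebesgue_integral_eq_integral(1) by blast
qed

text \<open>
  For large \<open>l\<close> the direction \<open>u\<close> of a solution is close to \<open>w\<close> or to \<open>- w\<close> except on a set of small measure.  Since
  \<open>u' = 2 l q\<close> with \<open>q = w - c u\<close> and \<open>Re (q cnj w) = 1 - c\<^sup>2\<close>, where \<open>c\<close> is the alignment, the claim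
  follows with \<open>w\<close> replaced by a step function with \<open>K\<close> steps: \<open>u\<close> is bounded, so each step contributes at most \<open>1 / l\<close>.
\<close>
lemma alignment_square_small:
  assumes e: "e > 0"
  obtains \<Lambda> where "\<Lambda> > 0" "\<And>l z. l \<ge> \<Lambda> \<Longrightarrow> solution l z \<Longrightarrow> integral {0..L} (\<lambda>t. 1 - (alignment z t)\<^sup>2) \<le> e"
proof -
  obtain K :: nat and v where K: "K > 0" and v: "\<And>i. norm (v i) \<le> 1" and step:
    "(\<Sum>i<K. integral {L * real i / real K..L * real (Suc i) / real K} (\<lambda>t. norm (letter True t - v i))) \<le> e/2"
    using step_approximation[of "e/2"] e by auto
  let ?a = "\<lambda>i. L * real i / real K"
  have sub: "0 \<le> ?a i" "?a i \<le> ?a (Suc i)" "?a (Suc i) \<le> L" if "i < K" for i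
  proof -
    show "0 \<le> ?a i" using L_pos by simp
    show "?a i \<le> ?a (Suc i)" using L_pos by (intro divide_right_mono mult_left_mono) auto
    have "L * real (Suc i) \<le> L * real K" using L_pos that by (intro mult_left_mono) auto
    then show "?a (Suc i) \<le> L" using K by (simp add: divide_le_eq)
  qed
  show ?thesis
  proof (rule that)
    show "2 * real K / e > 0" using K e by simp
    fix l z assume l: "l \<ge> 2 * real K / e" and z: "solution l z"
    have l0: "l > 0" using l \<open>2 * real K / e > 0\<close> by linarith
    let ?q = "\<lambda>t. cis (\<beta> t) - of_real (alignment z t) * direction z t"
    have each: "integral {?a i..?a (Suc i)} (\<lambda>t. 1 - (alignment z t)\<^sup>2) \<le>
      integral {?a i..?a (Suc i)} (\<lambda>t. norm (letter True t - v i)) + 1 / l" if i: "i < K" for i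
    proof -
      note s = sub[OF i]
      have sub0: "{?a i..?a (Suc i)} \<subseteq> {0..L}" using s by auto
      define J where "J = Re ((direction z (?a (Suc i)) - direction z (?a i)) * cnj (v i)) / (2 * l)"
      have "((\<lambda>t. Re (of_real (2 * l) * ?q t * cnj (v i)) / (2 * l)) has_integral J) {?a i..?a (Suc i)}"
        unfolding J_def
        using has_integral_linear[OF has_integral_mult_left[OF primitiveD(3)[OF primitive_direction[OF z] s], of "cnj (v i)"] bounded_linear_Re]
        by (intro has_integral_divide) (simp add: o_def)
      then have hJ: "((\<lambda>t. Re (?q t * cnj (v i))) has_integral J) {?a i..?a (Suc i)}"
        by (rule has_integral_eq[rotated]) (use l0 in \<open>simp add: algebra_simps add_divide_distrib diff_divide_distrib\<close>)
      have hN: "((\<lambda>t. norm (letter True t - v i)) has_integral integral {?a i..?a (Suc i)} (\<lambda>t. norm (letter True t - v i))) {?a i..?a (Suc i)}"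
        by (intro integrable_integral norm_letter_diff_integrable) (use s in auto)
      have hS: "((\<lambda>t. 1 - (alignment z t)\<^sup>2) has_integral integral {?a i..?a (Suc i)} (\<lambda>t. 1 - (alignment z t)\<^sup>2)) {?a i..?a (Suc i)}"
        by (intro integrable_integral alignment_square_integrable[OF z l0]) (use s in auto)
      have "integral {?a i..?a (Suc i)} (\<lambda>t. 1 - (alignment z t)\<^sup>2) \<le> integral {?a i..?a (Suc i)} (\<lambda>t. norm (letter True t - v i)) + J"
      proof (rule has_integral_le[OF hS has_integral_add[OF hN hJ]])
        fix t assume "t \<in> {?a i..?a (Suc i)}"
        then have t: "t \<in> {0..L}" using sub0 by blast
        let ?w = "cis (\<beta> t)" and ?u = "direction z t" and ?c = "alignment z t"
        have u: "norm ?u = 1" using norm_direction[of z t, OF solution_nonzero[OF z t]] .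
        have ww: "?w * cnj ?w = 1" by (simp add: complex_norm_square[symmetric])
        have uu: "?u * cnj ?u = 1" using u by (simp add: complex_norm_square[symmetric])
        have c: "Re (?u * cnj ?w) = ?c" by (simp add: alignment_def algebra_simps)
        have "Re (?q t * cnj ?w) = Re (?w * cnj ?w) - ?c * Re (?u * cnj ?w)"
          by (simp add: algebra_simps)
        then have 1: "Re (?q t * cnj ?w) = 1 - ?c\<^sup>2"
          unfolding ww c by (simp add: power2_eq_square)
        have "?q t * cnj (?q t) = ?w * cnj ?w - of_real ?c * (?w * cnj ?u + cnj (?w * cnj ?u)) + of_real ?c * of_real ?c * (?u * cnj ?u)"
          by (simp add: algebra_simps)
        also have "\<dots> = 1 - of_real ?c * of_real (2 * ?c) + of_real ?c * of_real ?c"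
          unfolding ww uu complex_add_cnj by (simp add: alignment_def)
        also have "\<dots> = of_real (1 - ?c\<^sup>2)" by (simp add: power2_eq_square)
        finally have "of_real ((norm (?q t))\<^sup>2) = complex_of_real (1 - ?c\<^sup>2)" unfolding complex_norm_square .
        then have "(norm (?q t))\<^sup>2 = 1 - ?c\<^sup>2" using of_real_eq_iff by blast
        then have "(norm (?q t))\<^sup>2 \<le> 1\<^sup>2" by simp
        then have q1: "norm (?q t) \<le> 1" by (rule power2_le_imp_le) simp
        have "1 - ?c\<^sup>2 = Re (?q t * cnj (?w - v i)) + Re (?q t * cnj (v i))"
          unfolding 1[symmetric] by (simp add: algebra_simps)
        also have "Re (?q t * cnj (?w - v i)) \<le> norm (?q t) * norm (?w - v i)"
          using complex_Re_le_cmod[of "?q t * cnj (?w - v i)"] by (simp only: norm_mult complex_mod_cnj)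
        also have "\<dots> \<le> norm (?w - v i)" using q1 by (intro mult_left_le_one_le) auto
        finally show "1 - ?c\<^sup>2 \<le> norm (letter True t - v i) + Re (?q t * cnj (v i))" by (simp add: letter_def)
      qed
      moreover have "J \<le> 1 / l"
      proof -
        have nz: "z (?a i) \<noteq> 0" "z (?a (Suc i)) \<noteq> 0" using solution_nonzero[OF z] sub0 s by auto
        have "Re ((direction z (?a (Suc i)) - direction z (?a i)) * cnj (v i)) \<le> norm (direction z (?a (Suc i)) - direction z (?a i)) * norm (v i)"
          using complex_Re_le_cmod[of "(direction z (?a (Suc i)) - direction z (?a i)) * cnj (v i)"] by (simp only: norm_mult complex_mod_cnj)
        also have "\<dots> \<le> 2 * 1"
          using norm_triangle_ineq4[of "direction z (?a (Suc i))" "direction z (?a i)"] nz v[of i]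
          by (intro mult_mono) (simp_all add: norm_direction)
        finally have "J \<le> 2 * 1 / (2 * l)"
          unfolding J_def by (rule divide_right_mono) (use l0 in simp)
        then show ?thesis by simp
      qed
      ultimately show ?thesis by linarith
    qed
    have "integral {0..L} (\<lambda>t. 1 - (alignment z t)\<^sup>2) = (\<Sum>i<K. integral {?a i..?a (Suc i)} (\<lambda>t. 1 - (alignment z t)\<^sup>2))"
      using sum_integral_uniform_partition[OF alignment_square_integrable[OF z l0, of 0 L], of K K] K L_pos by simp
    also have "\<dots> \<le> (\<Sum>i<K. integral {?a i..?a (Suc i)} (\<lambda>t. norm (letter True t - v i)) + 1 / l)"
      using each by (intro sum_mono) auto
    also have "\<dots> \<le> e/2 + real K / l" using step by (simp add: sum.distrib)
    also have "real K / l \<le> e/2" using l l0 e by (simp add: field_simps)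
    finally show "integral {0..L} (\<lambda>t. 1 - (alignment z t)\<^sup>2) \<le> e" by simp
  qed
qed

end

lemma Im_of_real_mult: "Im (complex_of_real r * x) = r * Im x"
  by simp

section \<open>Growth of the development along cusps\<close>

text \<open>
  If \<open>u\<close> has argument in \<open>[a, a + pi]\<close> and \<open>b\<close> is in that interval at distance at least \<open>\<kappa>\<close> from its end points, the angle between the
  two directions is at most \<open>pi - \<kappa>\<close>.
\<close>
lemma Re_cis_cnj_ge:
  assumes u: "norm u = 1" "Im (u * cis (- a)) \<ge> 0" and b: "a + \<kappa> \<le> b" "b \<le> a + pi - \<kappa>" and \<kappa>: "0 \<le> \<kappa>"
  shows "Re (cis b * cnj u) \<ge> - cos \<kappa>"
proof -
  define p where "p = u * cis (- a)"
  have np: "norm p = 1" by (simp add: p_def norm_mult u)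
  then have sq: "(Re p)\<^sup>2 + (Im p)\<^sup>2 = 1" by (simp add: cmod_def)
  have x: "- 1 \<le> Re p" "Re p \<le> 1" using abs_Re_le_cmod[of p] np by auto
  define \<phi> where "\<phi> = arccos (Re p)"
  have \<phi>: "0 \<le> \<phi>" "\<phi> \<le> pi" "cos \<phi> = Re p" using x by (auto simp: \<phi>_def arccos_lbound arccos_ubound)
  have "sin \<phi> = sqrt (1 - (Re p)\<^sup>2)" using x by (simp add: \<phi>_def sin_arccos)
  also have "1 - (Re p)\<^sup>2 = (Im p)\<^sup>2" using sq by simp
  also have "sqrt ((Im p)\<^sup>2) = Im p" using u(2) by (simp add: p_def)
  finally have "p = cis \<phi>" using \<phi>(3) by (simp add: complex_eq_iff)
  moreover have "u = p * cis a" by (simp add: p_def cis_mult mult.assoc)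
  ultimately have "u = cis (\<phi> + a)" by (simp add: cis_mult)
  then have "cis b * cnj u = cis (b - a - \<phi>)"
    by (simp add: cis_cnj cis_mult algebra_simps)
  then have "Re (cis b * cnj u) = cos \<bar>b - a - \<phi>\<bar>" by simp
  also have "\<dots> \<ge> cos (pi - \<kappa>)"
    using b \<phi> \<kappa> by (intro cos_monotone_0_pi_le) auto
  finally show ?thesis by simp
qed

context angle_path begin

text \<open>
  The loss of growth rate of a solution against the maximal rate.
\<close>
definition "defect z t = 1 - alignment z t"

lemma defect_bounds: 
  assumes "solution l z" "t \<in> {0..L}" 
  shows "0 \<le> defect z t" "defect z t \<le> 2"
  using abs_alignment_le[of z t] solution_nonzero[OF assms] by (auto simp: defect_def)

lemma primitive_defect:
  assumes z: "solution l z" and l: "l > 0"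
  shows "primitive L (\<lambda>t. t - 1 / (2 * l) * ln ((norm (z t))\<^sup>2)) (defect z)"
proof -
  have "primitive L (\<lambda>t. t) (\<lambda>t. 1)"
    by (rule primitive_smooth) (auto intro!: derivative_eq_intros continuous_intros)
  from primitive_diff[OF this primitive_alignment[OF z l]] show ?thesis
    by (rule primitive_cong) (simp_all add: defect_def)
qed

lemma defect_integrable:
  assumes "solution l z" "l > 0" "0 \<le> s" "t \<le> L"
  shows "defect z integrable_on {s..t}"
  using primitiveD(5)[OF primitive_defect[OF assms(1,2)], of s t] assms(3,4)
  by (cases "s \<le> t") (auto simp: integrable_on_empty)

lemma integral_defect_combine:
  assumes "solution l z" "l > 0" "0 \<le> s" "s \<le> t" "t \<le> r" "r \<le> L"
  shows "integral {s..t} (defect z) + integral {t..r} (defect z) = integral {s..r} (defect z)"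
  by (rule Henstock_Kurzweil_Integration.integral_combine) (use assms defect_integrable[OF assms(1,2)] in auto)

lemma integral_defect_nonneg:
  assumes "solution l z" "l > 0" "0 \<le> s" "t \<le> L"
  shows "0 \<le> integral {s..t} (defect z)"
  by (rule integral_nonneg[OF defect_integrable[OF assms]]) (use defect_bounds[OF assms(1)] assms in auto)

lemma integral_defect_le:
  assumes "solution l z" "l > 0" "0 \<le> s" "s \<le> t" "t \<le> L"
  shows "integral {s..t} (defect z) \<le> 2 * (t - s)"
proof -
  have "integral {s..t} (defect z) \<le> integral {s..t} (\<lambda>_. 2)"
    by (rule integral_le[OF defect_integrable[OF assms(1,2,3,5)] integrable_const_ivl]) (use defect_bounds[OF assms(1)] assms in auto)
  then show ?thesis using assms by simp
qed

text \<open>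
  While the angle of the path is in \<open>[a, a + pi]\<close>, the distance of \<open>z\<^sup>2\<close> to the boundary of the half-plane of
  the arguments in \<open>[a, a + pi]\<close>, counted with sign, is nondecreasing.
\<close>
lemma half_plane_invariant:
  assumes z: "solution l z" and l: "l > 0" and uv: "0 \<le> s" "s \<le> t" "t \<le> v" "u \<le> s" "v \<le> L"
    and a: "AE r in lebesgue_on {u..v}. \<beta> r \<in> {a..a + pi}"
    and s: "Im ((z s)\<^sup>2 * cis (- a)) \<ge> 0"
  shows "Im ((z t)\<^sup>2 * cis (- a)) \<ge> 0"
proof -
  obtain N where N: "negligible N" "\<And>r. r \<in> {u..v} \<Longrightarrow> r \<notin> N \<Longrightarrow> \<beta> r \<in> {a..a + pi}"
    using AE_lebesgue_on_obtain[OF a] by auto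
  have P: "primitive L (\<lambda>t. Im ((z t)\<^sup>2 * cis (- a))) (\<lambda>t. Im ((of_real (2 * l * (norm (z t))\<^sup>2) * cis (\<beta> t)) * cis (- a)))"
    by (intro primitive_Im primitive_bounded_linear[OF primitive_solution_square[OF z] bounded_linear_mult_left])
  have "0 \<le> Im ((z t)\<^sup>2 * cis (- a)) - Im ((z s)\<^sup>2 * cis (- a))"
  proof (rule has_integral_mono_negligible[OF has_integral_0 primitiveD(3)[OF P] N(1)])
    fix r assume r: "r \<in> {s..t}" "r \<notin> N"
    then have "\<beta> r \<in> {a..a + pi}" using N(2)[of r] uv by auto
    then have "0 \<le> sin (\<beta> r - a)" by (intro sin_ge_zero) auto
    moreover have "of_real (2 * l * (norm (z r))\<^sup>2) * cis (\<beta> r) * cis (- a) = of_real (2 * l * (norm (z r))\<^sup>2) * cis (\<beta> r - a)"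
      by (simp add: mult.assoc cis_mult)
    ultimately show "0 \<le> Im (of_real (2 * l * (norm (z r))\<^sup>2) * cis (\<beta> r) * cis (- a))"
      using l by (simp only: Im_of_real_mult) simp
  qed (use uv in auto)
  then show ?thesis using s by simp
qed

lemma half_plane_direction:
  assumes "z t \<noteq> 0"
  shows "Im ((z t)\<^sup>2 * cis (- a)) \<ge> 0 \<longleftrightarrow> Im (direction z t * cis (- a)) \<ge> 0"
proof -
  have "(z t)\<^sup>2 * cis (- a) = of_real ((norm (z t))\<^sup>2) * (direction z t * cis (- a))"
    using assms by (simp add: direction_def)
  then have "Im ((z t)\<^sup>2 * cis (- a)) = (norm (z t))\<^sup>2 * Im (direction z t * cis (- a))"
    by (simp only: Im_of_real_mult)
  then show ?thesis using assms by (simp add: zero_le_mult_iff)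
qed

lemma alignment_ge_in_half_plane:
  assumes z: "z t \<noteq> 0" and hp: "Im ((z t)\<^sup>2 * cis (- a)) \<ge> 0" and \<beta>: "\<beta> t \<in> {a + \<kappa>..a + pi - \<kappa>}" and "0 \<le> \<kappa>"
  shows "alignment z t \<ge> - cos \<kappa>"
  unfolding alignment_def
  by (rule Re_cis_cnj_ge[where a=a]) (use assms half_plane_direction[of z t] in \<open>auto simp: norm_direction\<close>)

lemma alignment_le_outside_half_plane:
  assumes z: "z t \<noteq> 0" and hp: "\<not> Im ((z t)\<^sup>2 * cis (- a)) \<ge> 0" and \<beta>: "\<beta> t \<in> {a + \<kappa>..a + pi - \<kappa>}" and "0 \<le> \<kappa>"
  shows "alignment z t \<le> cos \<kappa>"
proof -
  have "Re (cis (\<beta> t) * cnj (- direction z t)) \<ge> - cos \<kappa>"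
    by (rule Re_cis_cnj_ge[where a=a]) (use assms half_plane_direction[of z t] in \<open>auto simp: norm_direction\<close>)
  then show ?thesis by (simp add: alignment_def)
qed

text \<open>
  The part of the condition on a regular cusp with angle \<open>a\<close> that the argument uses: the set \<open>F\<close> need not be a union of
  intervals, and the exceptional null set is made explicit.
\<close>
definition cusp_at :: "real \<Rightarrow> real \<Rightarrow> real \<Rightarrow> bool" where
  "cusp_at a u v \<longleftrightarrow> (AE t in lebesgue_on {u..v}. \<beta> t \<in> {a..a + pi}) \<and>
     (\<forall>\<delta>>0. \<exists>F \<kappa> N. closed F \<and> F \<subseteq> {u..v} \<and> 0 < \<kappa> \<and> \<kappa> \<le> pi/2 \<and> negligible N \<and>
       measure lebesgue ({u..v} - F) < \<delta> \<and> (\<forall>t\<in>F - N. \<beta> t \<in> {a + \<kappa>..a + pi - \<kappa>}))"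

lemma regular_cusp_imp_cusp_at:
  assumes "regular_cusp \<beta> u v"
  shows "\<exists>a. cusp_at a u v"
proof -
  from assms obtain a where uv: "u < v" and a: "AE t in lebesgue_on {u..v}. \<beta> t \<in> {a..a + pi}" and
    F: "\<forall>\<delta>>0. \<exists>F a' b'. closed F \<and> F \<subseteq> {u..v} \<and>
           (\<exists>\<J>. finite \<J> \<and> disjoint \<J> \<and> (\<forall>J\<in>\<J>. \<exists>c d. c \<le> d \<and> J = {c..d}) \<and> F = \<Union>\<J>) \<and>
           a' > a \<and> b' < a + pi \<and> measure lebesgue ({u..v} - F) < \<delta> \<and>
           (AE t in lebesgue_on F. \<beta> t \<in> {a'..b'})"
    unfolding regular_cusp_def by blast
  show ?thesis
    unfolding cusp_at_def
  proof (intro exI[of _ a] conjI a allI impI)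
    fix \<delta> :: real assume "\<delta> > 0"
    with F obtain F a' b' where F: "closed F" "F \<subseteq> {u..v}" "a' > a" "b' < a + pi" "measure lebesgue ({u..v} - F) < \<delta>"
      and ae: "AE t in lebesgue_on F. \<beta> t \<in> {a'..b'}" by metis
    have "F \<in> sets lebesgue" using F(1) by auto
    then obtain N where N: "negligible N" "\<And>t. t \<in> F \<Longrightarrow> t \<notin> N \<Longrightarrow> \<beta> t \<in> {a'..b'}"
      using AE_lebesgue_on_obtain[OF ae] by blast
    define \<kappa> where "\<kappa> = min (pi/2) (min (a' - a) (a + pi - b'))"
    have "\<kappa> \<le> pi/2" unfolding \<kappa>_def by (rule min.cobounded1)
    moreover have "0 < \<kappa>" "a + \<kappa> \<le> a'" "b' \<le> a + pi - \<kappa>" using F by (auto simp: \<kappa>_def)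
    moreover have "\<beta> t \<in> {a + \<kappa>..a + pi - \<kappa>}" if "t \<in> F - N" for t
      using N(2)[of t] that calculation by auto
    ultimately show "\<exists>F \<kappa> N. closed F \<and> F \<subseteq> {u..v} \<and> 0 < \<kappa> \<and> \<kappa> \<le> pi/2 \<and> negligible N \<and>
       measure lebesgue ({u..v} - F) < \<delta> \<and> (\<forall>t\<in>F - N. \<beta> t \<in> {a + \<kappa>..a + pi - \<kappa>})"
      using F N(1) by blast
  qed
qed

lemma cos_less_one: "0 < \<kappa> \<Longrightarrow> \<kappa> \<le> pi/2 \<Longrightarrow> cos \<kappa> < 1"
  using cos_monotone_0_pi[of 0 \<kappa>] by simp

text \<open>
  Inside a cusp the defect is small from the moment on when the direction has entered the half-plane: on \<open>F\<close> the
  alignment \<open>c\<close> stays away from \<open>- 1\<close>, so that \<open>1 - c\<close> is at most a constant times \<open>1 - c\<^sup>2\<close>.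
\<close>
lemma defect_small_in_cusp:
  assumes uv: "0 \<le> u" "v \<le> L"
    and cusp: "cusp_at a u v"
    and \<delta>: "\<delta> > 0"
  obtains \<Lambda> where "\<Lambda> > 0" "\<And>l z \<tau>. l \<ge> \<Lambda> \<Longrightarrow> solution l z \<Longrightarrow> u \<le> \<tau> \<Longrightarrow> \<tau> \<le> v \<Longrightarrow>
     Im ((z \<tau>)\<^sup>2 * cis (- a)) \<ge> 0 \<Longrightarrow> integral {\<tau>..v} (defect z) \<le> \<delta>"
proof -
  obtain F \<kappa> N where F: "closed F" "F \<subseteq> {u..v}" "measure lebesgue ({u..v} - F) < \<delta>/4"
    and \<kappa>: "0 < \<kappa>" "\<kappa> \<le> pi/2" and N: "negligible N" "\<And>t. t \<in> F - N \<Longrightarrow> \<beta> t \<in> {a + \<kappa>..a + pi - \<kappa>}"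
    using cusp \<delta> unfolding cusp_at_def by (metis zero_less_divide_iff zero_less_numeral)
  have a: "AE t in lebesgue_on {u..v}. \<beta> t \<in> {a..a + pi}" using cusp by (simp add: cusp_at_def)
  define m where "m = 1 - cos \<kappa>"
  have m: "m > 0" using cos_less_one[OF \<kappa>] by (simp add: m_def)
  obtain \<Lambda> where \<Lambda>: "\<Lambda> > 0" "\<And>l z. l \<ge> \<Lambda> \<Longrightarrow> solution l z \<Longrightarrow> integral {0..L} (\<lambda>t. 1 - (alignment z t)\<^sup>2) \<le> m * \<delta> / 2"
    using alignment_square_small[of "m * \<delta> / 2"] m \<delta> by auto
  show ?thesis
  proof (rule that[OF \<Lambda>(1)])
    fix l z \<tau> assume l: "l \<ge> \<Lambda>" and z: "solution l z" and \<tau>: "u \<le> \<tau>" "\<tau> \<le> v" and hp: "Im ((z \<tau>)\<^sup>2 * cis (- a)) \<ge> 0"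
    have l0: "l > 0" using l \<Lambda>(1) by simp
    let ?S = "\<lambda>t. 1 - (alignment z t)\<^sup>2"
    let ?G = "{u..v} - F"
    have lm: "?G \<inter> {\<tau>..v} \<in> lmeasurable"
      using F(1) by (intro fmeasurable_Int_fmeasurable fmeasurable_Diff) auto
    have lm': "?G \<in> lmeasurable" using F(1) by (intro fmeasurable_Diff) auto
    have hG: "(indicator ?G has_integral measure lebesgue (?G \<inter> {\<tau>..v})) {\<tau>..v}"
      using lm by (simp add: has_integral_iff integral_indicator integrable_on_indicator)
    have hS: "(?S has_integral integral {\<tau>..v} ?S) {\<tau>..v}"
      by (intro integrable_integral alignment_square_integrable[OF z l0]) (use uv \<tau> in auto)
    have "integral {\<tau>..v} (defect z) \<le> 1 / m * integral {\<tau>..v} ?S + 2 * measure lebesgue (?G \<inter> {\<tau>..v})"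
    proof (rule has_integral_mono_negligible[OF integrable_integral[OF defect_integrable[OF z l0]] has_integral_add[OF has_integral_mult_right[OF hS] has_integral_mult_right[OF hG]] N(1)])
      fix t assume t: "t \<in> {\<tau>..v}" "t \<notin> N"
      have tL: "t \<in> {0..L}" using t \<tau> uv by auto
      have nz: "z t \<noteq> 0" by (rule solution_nonzero[OF z tL])
      have al: "\<bar>alignment z t\<bar> \<le> 1" by (rule abs_alignment_le[of z t, OF nz])
      have S0: "?S t \<ge> 0" using al by (simp add: abs_square_le_1)
      show "defect z t \<le> 1 / m * ?S t + 2 * indicator ?G t"
      proof (cases "t \<in> F")
        case True
        have "Im ((z t)\<^sup>2 * cis (- a)) \<ge> 0"
          by (rule half_plane_invariant[OF z l0 _ _ _ \<tau>(1) uv(2) a hp]) (use t uv \<tau> in auto)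
        then have "alignment z t \<ge> - cos \<kappa>"
          using N(2)[of t] True t nz \<kappa> by (intro alignment_ge_in_half_plane) auto
        then have "m \<le> 1 + alignment z t" by (simp add: m_def)
        then have "m * (1 - alignment z t) \<le> (1 + alignment z t) * (1 - alignment z t)"
          using al by (intro mult_right_mono) auto
        then have "m * defect z t \<le> ?S t" by (simp add: defect_def power2_eq_square algebra_simps)
        then show ?thesis using m True by (simp add: field_simps)
      next
        case False
        then have "indicator ?G t = (1::real)" using t \<tau> by auto
        then show ?thesis using defect_bounds[OF z tL] divide_nonneg_pos[OF S0 m] by simp
      qed
    qed (use uv \<tau> in auto)
    moreover have "integral {\<tau>..v} ?S \<le> m * \<delta> / 2"
    proof -
      have "integral {\<tau>..v} ?S \<le> integral {0..L} ?S"
        using \<tau> uv abs_alignment_le[of z] solution_nonzero[OF z]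
        by (intro integral_subset_le alignment_square_integrable[OF z l0]) (auto simp: abs_square_le_1)
      then show ?thesis using \<Lambda>(2)[OF l z] by linarith
    qed
    then have "1 / m * integral {\<tau>..v} ?S \<le> 1 / m * (m * \<delta> / 2)"
      using m by (intro mult_left_mono) auto
    moreover have "measure lebesgue (?G \<inter> {\<tau>..v}) \<le> measure lebesgue ?G"
      using lm' lm by (intro measure_mono_fmeasurable) auto
    moreover have "1 / m * (m * \<delta> / 2) = \<delta> / 2" using m by simp
    moreover have "I \<le> \<delta>" if "I \<le> J + 2 * A" "J \<le> K" "A \<le> B" "K = \<delta> / 2" "B < \<delta> / 4" for I J K A B :: real
      using that by linarith
    ultimately show "integral {\<tau>..v} (defect z) \<le> \<delta>" using F(3) by blast
  qed
qed

text \<open>A solution that stays out of the half-plane has a defect that is bounded below.\<close>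
lemma defect_large_outside_half_plane:
  assumes uv: "0 \<le> u" "v \<le> L" and pq: "u \<le> p" "p < q" "q \<le> v"
    and cusp: "cusp_at a u v"
  obtains m where "m > 0" "\<And>l z. l > 0 \<Longrightarrow> solution l z \<Longrightarrow> (\<And>t. t \<in> {p..q} \<Longrightarrow> \<not> Im ((z t)\<^sup>2 * cis (- a)) \<ge> 0) \<Longrightarrow>
     integral {p..q} (defect z) \<ge> m"
proof -
  obtain F \<kappa> N where F: "closed F" "F \<subseteq> {u..v}" "measure lebesgue ({u..v} - F) < (q - p)/2"
    and \<kappa>: "0 < \<kappa>" "\<kappa> \<le> pi/2" and N: "negligible N" "\<And>t. t \<in> F - N \<Longrightarrow> \<beta> t \<in> {a + \<kappa>..a + pi - \<kappa>}"
    using cusp pq(2) unfolding cusp_at_def by (metis diff_gt_0_iff_gt half_gt_zero)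
  define m where "m = 1 - cos \<kappa>"
  have m: "m > 0" using cos_less_one[OF \<kappa>] by (simp add: m_def)
  show ?thesis
  proof (rule that)
    show "m * ((q - p) / 2) > 0" using m pq by simp
    fix l z assume l: "l > 0" and z: "solution l z"
      and hp: "\<And>t. t \<in> {p..q} \<Longrightarrow> \<not> Im ((z t)\<^sup>2 * cis (- a)) \<ge> 0"
    have lm: "F \<inter> {p..q} \<in> lmeasurable"
      using F(1) by (metis closed_Int_compact compact_Icc lmeasurable_compact)
    have hF: "(indicator F has_integral measure lebesgue (F \<inter> {p..q})) {p..q}"
      using lm by (simp add: has_integral_iff integral_indicator integrable_on_indicator)
    have lm': "{u..v} - F \<in> lmeasurable" using F(1) by (intro fmeasurable_Diff) auto
    have "q - p = measure lebesgue {p..q}" using pq by simp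
    also have "\<dots> \<le> measure lebesgue ((F \<inter> {p..q}) \<union> ({u..v} - F))"
      using lm lm' pq by (intro measure_mono_fmeasurable fmeasurable.Un) auto
    also have "\<dots> \<le> measure lebesgue (F \<inter> {p..q}) + measure lebesgue ({u..v} - F)"
      using lm lm' by (intro measure_Un_le) auto
    finally have "q - p \<le> measure lebesgue (F \<inter> {p..q}) + measure lebesgue ({u..v} - F)" .
    moreover have "x / 2 \<le> A" if "x \<le> A + B" "B < x / 2" for x A B :: real using that by linarith
    ultimately have "(q - p) / 2 \<le> measure lebesgue (F \<inter> {p..q})" using F(3) by blast
    then have "m * ((q - p) / 2) \<le> m * measure lebesgue (F \<inter> {p..q})" using m by simp
    also have "\<dots> \<le> integral {p..q} (defect z)"
    proof (rule has_integral_mono_negligible[OF has_integral_mult_right[OF hF] integrable_integral[OF defect_integrable[OF z l]] N(1)])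
      fix t assume t: "t \<in> {p..q}" "t \<notin> N"
      have tL: "t \<in> {0..L}" using t pq uv by auto
      show "m * indicator F t \<le> defect z t"
      proof (cases "t \<in> F")
        case True
        then have "alignment z t \<le> cos \<kappa>"
          using N(2)[of t] t hp[of t] solution_nonzero[OF z tL] \<kappa>
          by (intro alignment_le_outside_half_plane[where a=a]) auto
        then show ?thesis using True by (simp add: m_def defect_def)
      qed (use defect_bounds[OF z tL] in simp)
    qed (use uv pq in auto)
    finally show "m * ((q - p) / 2) \<le> integral {p..q} (defect z)" .
  qed
qed

text \<open>
  Chaining cusps: the defect tends to 0 on every \<open>[s\<^sub>0, t]\<close> with \<open>t < L\<close>, uniformly in the solutions that
  start at time \<open>s\<^sub>0\<close> in the half-plane of a cusp around \<open>s\<^sub>0\<close>.  If the defect is small up to a time \<open>q\<close> inside the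
  next cusp, the direction must have entered its half-plane before \<open>q\<close>, for otherwise the defect would be bounded below.
\<close>
lemma defect_small_interior:
  assumes cusps: "strongly_tree_reduced \<beta> L" and s\<^sub>0: "0 < s\<^sub>0" "s\<^sub>0 < L"
  obtains a where "\<And>t \<delta>. s\<^sub>0 \<le> t \<Longrightarrow> t < L \<Longrightarrow> \<delta> > 0 \<Longrightarrow> \<exists>\<Lambda>>0. \<forall>l\<ge>\<Lambda>. \<forall>z. solution l z \<longrightarrow>
     Im ((z s\<^sub>0)\<^sup>2 * cis (- a)) \<ge> 0 \<longrightarrow> integral {s\<^sub>0..t} (defect z) \<le> \<delta>"
proof -
  have cusp: "\<exists>u v a. 0 \<le> u \<and> u < t \<and> t < v \<and> v \<le> L \<and> cusp_at a u v" if t: "t \<in> {0<..<L}" for t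
  proof -
    obtain u v where uv: "t \<in> {u<..<v}" "regular_cusp \<beta> (max u 0) (min v L)"
      using cusps t unfolding strongly_tree_reduced_def by blast
    from regular_cusp_imp_cusp_at[OF uv(2)] obtain a where "cusp_at a (max u 0) (min v L)" ..
    then show ?thesis using uv(1) t
      by (intro exI[of _ "max u 0"] exI[of _ "min v L"] exI[of _ a]) auto
  qed
  have "s\<^sub>0 \<in> {0<..<L}" using s\<^sub>0 by simp
  from cusp[OF this] obtain u\<^sub>0 v\<^sub>0 a\<^sub>0 where uv0: "0 \<le> u\<^sub>0" "u\<^sub>0 < s\<^sub>0" "s\<^sub>0 < v\<^sub>0" "v\<^sub>0 \<le> L"
    and cusp0: "cusp_at a\<^sub>0 u\<^sub>0 v\<^sub>0"
    by blast
  define good where "good t \<longleftrightarrow> (\<forall>\<delta>>0. \<exists>\<Lambda>>0. \<forall>l\<ge>\<Lambda>. \<forall>z. solution l z \<longrightarrow>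
     Im ((z s\<^sub>0)\<^sup>2 * cis (- a\<^sub>0)) \<ge> 0 \<longrightarrow> integral {s\<^sub>0..t} (defect z) \<le> \<delta>)" for t
  define T where "T = {t \<in> {s\<^sub>0..L}. good t}"
  have v0: "good v\<^sub>0"
    unfolding good_def
  proof (intro allI impI)
    fix \<delta> :: real assume "\<delta> > 0"
    from defect_small_in_cusp[OF uv0(1,4) cusp0 this]
    obtain \<Lambda> where "\<Lambda> > 0" "\<And>l z \<tau>. l \<ge> \<Lambda> \<Longrightarrow> solution l z \<Longrightarrow> u\<^sub>0 \<le> \<tau> \<Longrightarrow> \<tau> \<le> v\<^sub>0 \<Longrightarrow>
     Im ((z \<tau>)\<^sup>2 * cis (- a\<^sub>0)) \<ge> 0 \<Longrightarrow> integral {\<tau>..v\<^sub>0} (defect z) \<le> \<delta>" by metis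
    then show "\<exists>\<Lambda>>0. \<forall>l\<ge>\<Lambda>. \<forall>z. solution l z \<longrightarrow> Im ((z s\<^sub>0)\<^sup>2 * cis (- a\<^sub>0)) \<ge> 0 \<longrightarrow> integral {s\<^sub>0..v\<^sub>0} (defect z) \<le> \<delta>"
      using uv0 by (intro exI[of _ \<Lambda>]) auto
  qed
  have bdd: "bdd_above T" by (auto simp: T_def bdd_above_def)
  have v0T: "v\<^sub>0 \<in> T" using v0 uv0 by (auto simp: T_def)
  \<comment> \<open>\<open>T\<close> consists of the times up to which the defect tends to 0; a cusp around its supremum would extend it.\<close>
  have SupT: "Sup T = L"
  proof (rule ccontr)
    assume "Sup T \<noteq> L"
    moreover have "Sup T \<le> L" using v0T by (intro cSup_least) (auto simp: T_def)
    ultimately have SL: "Sup T < L" by simp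
    have Sv: "v\<^sub>0 \<le> Sup T" by (rule cSup_upper[OF v0T bdd])
    have "Sup T \<in> {0<..<L}" using SL Sv uv0 s\<^sub>0 by simp
    from cusp[OF this] obtain u v a where uv: "0 \<le> u" "u < Sup T" "Sup T < v" "v \<le> L"
      and cusp1: "cusp_at a u v"
      by blast
    define p where "p = max u s\<^sub>0"
    have "p < Sup T" using uv Sv uv0 by (simp add: p_def)
    then obtain q where q: "q \<in> T" "p < q" using less_cSupD[of T p] v0T by blast
    have qS: "q \<le> Sup T" by (rule cSup_upper[OF q(1) bdd])
    have pq: "u \<le> p" "p < q" "q \<le> v" "s\<^sub>0 \<le> p" using q uv qS by (auto simp: p_def)
    obtain m where m: "m > 0" "\<And>l z. l > 0 \<Longrightarrow> solution l z \<Longrightarrow> (\<And>t. t \<in> {p..q} \<Longrightarrow> \<not> Im ((z t)\<^sup>2 * cis (- a)) \<ge> 0) \<Longrightarrow>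
       integral {p..q} (defect z) \<ge> m"
      using defect_large_outside_half_plane[OF uv(1,4) pq(1-3) cusp1] by metis
    have "good v"
      unfolding good_def
    proof (intro allI impI)
      fix \<delta> :: real assume \<delta>: "\<delta> > 0"
      then have "\<delta>/2 > 0" by simp
      from defect_small_in_cusp[OF uv(1,4) cusp1 this]
      obtain \<Lambda>\<^sub>1 where \<Lambda>1: "\<Lambda>\<^sub>1 > 0" "\<And>l z \<tau>. l \<ge> \<Lambda>\<^sub>1 \<Longrightarrow> solution l z \<Longrightarrow> u \<le> \<tau> \<Longrightarrow> \<tau> \<le> v \<Longrightarrow>
        Im ((z \<tau>)\<^sup>2 * cis (- a)) \<ge> 0 \<Longrightarrow> integral {\<tau>..v} (defect z) \<le> \<delta>/2" by metis
      have "min (\<delta>/2) (m/2) > 0" using \<delta> m by simp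
      then obtain \<Lambda>\<^sub>2 where \<Lambda>2: "\<Lambda>\<^sub>2 > 0" "\<And>l z. l \<ge> \<Lambda>\<^sub>2 \<Longrightarrow> solution l z \<Longrightarrow>
         Im ((z s\<^sub>0)\<^sup>2 * cis (- a\<^sub>0)) \<ge> 0 \<Longrightarrow> integral {s\<^sub>0..q} (defect z) \<le> min (\<delta>/2) (m/2)"
        using q(1) unfolding T_def good_def by blast
      show "\<exists>\<Lambda>>0. \<forall>l\<ge>\<Lambda>. \<forall>z. solution l z \<longrightarrow> Im ((z s\<^sub>0)\<^sup>2 * cis (- a\<^sub>0)) \<ge> 0 \<longrightarrow> integral {s\<^sub>0..v} (defect z) \<le> \<delta>"
      proof (intro exI[of _ "max \<Lambda>\<^sub>1 \<Lambda>\<^sub>2"] conjI allI impI)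
        show "max \<Lambda>\<^sub>1 \<Lambda>\<^sub>2 > 0" using \<Lambda>1(1) by simp
        fix l z assume l: "l \<ge> max \<Lambda>\<^sub>1 \<Lambda>\<^sub>2" and z: "solution l z" and hp: "Im ((z s\<^sub>0)\<^sup>2 * cis (- a\<^sub>0)) \<ge> 0"
        have l0: "l > 0" and l1: "l \<ge> \<Lambda>\<^sub>1" and l2: "l \<ge> \<Lambda>\<^sub>2" using l \<Lambda>1(1) by auto
        note qd = \<Lambda>2(2)[OF l2 z hp]
        have split: "integral {s\<^sub>0..p} (defect z) + integral {p..q} (defect z) = integral {s\<^sub>0..q} (defect z)"
          by (rule integral_defect_combine[OF z l0]) (use pq uv s\<^sub>0 in auto)
        have "integral {s\<^sub>0..p} (defect z) \<ge> 0"
          by (rule integral_defect_nonneg[OF z l0]) (use pq uv s\<^sub>0 in auto)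
        then have "integral {p..q} (defect z) < m" using split qd m(1) by simp
        then obtain \<tau> where \<tau>: "\<tau> \<in> {p..q}" "Im ((z \<tau>)\<^sup>2 * cis (- a)) \<ge> 0"
          using m(2)[OF l0 z] by (meson not_le)
        have "integral {\<tau>..v} (defect z) \<le> \<delta>/2"
          by (rule \<Lambda>1(2)[OF l1 z _ _ \<tau>(2)]) (use \<tau>(1) pq in auto)
        moreover have "integral {s\<^sub>0..\<tau>} (defect z) + integral {\<tau>..v} (defect z) = integral {s\<^sub>0..v} (defect z)"
          by (rule integral_defect_combine[OF z l0]) (use pq uv s\<^sub>0 \<tau>(1) in auto)
        moreover have "integral {s\<^sub>0..\<tau>} (defect z) + integral {\<tau>..q} (defect z) = integral {s\<^sub>0..q} (defect z)"
          by (rule integral_defect_combine[OF z l0]) (use pq uv s\<^sub>0 \<tau>(1) in auto)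
        moreover have "integral {\<tau>..q} (defect z) \<ge> 0"
          by (rule integral_defect_nonneg[OF z l0]) (use pq uv s\<^sub>0 \<tau>(1) in auto)
        ultimately show "integral {s\<^sub>0..v} (defect z) \<le> \<delta>" using qd by linarith
      qed
    qed
    then have "v \<in> T" using uv Sv uv0 by (auto simp: T_def)
    then have "v \<le> Sup T" by (rule cSup_upper[OF _ bdd])
    then show False using uv by simp
  qed
  show ?thesis
  proof (rule that)
    fix t \<delta> :: real assume t: "s\<^sub>0 \<le> t" "t < L" and \<delta>: "\<delta> > 0"
    obtain q where q: "q \<in> T" "t < q" using less_cSupD[of T t] v0T t SupT by auto
    then obtain \<Lambda> where \<Lambda>: "\<Lambda> > 0" "\<And>l z. l \<ge> \<Lambda> \<Longrightarrow> solution l z \<Longrightarrow>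
         Im ((z s\<^sub>0)\<^sup>2 * cis (- a\<^sub>0)) \<ge> 0 \<Longrightarrow> integral {s\<^sub>0..q} (defect z) \<le> \<delta>"
      using \<delta> unfolding T_def good_def by blast
    show "\<exists>\<Lambda>>0. \<forall>l\<ge>\<Lambda>. \<forall>z. solution l z \<longrightarrow>
     Im ((z s\<^sub>0)\<^sup>2 * cis (- a\<^sub>0)) \<ge> 0 \<longrightarrow> integral {s\<^sub>0..t} (defect z) \<le> \<delta>"
    proof (intro exI[of _ \<Lambda>] conjI allI impI \<Lambda>(1))
      fix l z assume l: "l \<ge> \<Lambda>" and z: "solution l z" and hp: "Im ((z s\<^sub>0)\<^sup>2 * cis (- a\<^sub>0)) \<ge> 0"
      have l0: "l > 0" using l \<Lambda>(1) by simp
      have qL: "q \<le> L" using q by (simp add: T_def)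
      have "integral {s\<^sub>0..t} (defect z) + integral {t..q} (defect z) = integral {s\<^sub>0..q} (defect z)"
        by (rule integral_defect_combine[OF z l0]) (use t q qL s\<^sub>0 in auto)
      moreover have "integral {t..q} (defect z) \<ge> 0"
        by (rule integral_defect_nonneg[OF z l0]) (use t qL s\<^sub>0 in auto)
      ultimately show "integral {s\<^sub>0..t} (defect z) \<le> \<delta>" using \<Lambda>(2)[OF l z hp] by linarith
    qed
  qed
qed

text \<open>The development grows at the exponential rate L.\<close>
theorem development_growth:
  assumes cusps: "strongly_tree_reduced \<beta> L" and e: "e > 0"
  obtains \<Lambda> where "\<Lambda> > 0" "\<And>l :: real. l \<ge> \<Lambda> \<Longrightarrow>
     exp (l * (L - e)) \<le> norm (development True l L) + norm (development False l L)"
proof -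
  \<comment> \<open>Nothing is known near the end points, where the defect is at most 2: intervals of length at most \<open>e / 8\<close> are given away.\<close>
  define s\<^sub>0 where "s\<^sub>0 = min (e / 8) (L / 4)"
  have s\<^sub>0: "0 < s\<^sub>0" "s\<^sub>0 < L" "s\<^sub>0 \<le> L - s\<^sub>0" "s\<^sub>0 \<le> e / 8" using e L_pos by (auto simp: s\<^sub>0_def min_def)
  obtain a where a: "\<And>t \<delta>. s\<^sub>0 \<le> t \<Longrightarrow> t < L \<Longrightarrow> \<delta> > 0 \<Longrightarrow> \<exists>\<Lambda>>0. \<forall>l\<ge>\<Lambda>. \<forall>z. solution l z \<longrightarrow>
     Im ((z s\<^sub>0)\<^sup>2 * cis (- a)) \<ge> 0 \<longrightarrow> integral {s\<^sub>0..t} (defect z) \<le> \<delta>"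
    using defect_small_interior[OF cusps s\<^sub>0(1,2)] by metis
  obtain \<Lambda> where \<Lambda>: "\<Lambda> > 0" "\<And>l z. l \<ge> \<Lambda> \<Longrightarrow> solution l z \<Longrightarrow> Im ((z s\<^sub>0)\<^sup>2 * cis (- a)) \<ge> 0 \<Longrightarrow>
     integral {s\<^sub>0..L - s\<^sub>0} (defect z) \<le> e/2"
    using a[of "L - s\<^sub>0" "e/2"] s\<^sub>0 e by auto
  show ?thesis
  proof (rule that[OF \<Lambda>(1)])
    fix l :: real assume l: "l \<ge> \<Lambda>"
    then have l0: "l > 0" using \<Lambda>(1) by simp
    obtain z where z: "solution l z" "z s\<^sub>0 = cis (a / 2)"
      and zL: "norm (z L) \<le> (norm (development True l L) + norm (development False l L)) * norm (z 0)"
      using exists_solution[of s\<^sub>0 "cis (a / 2)" l] s\<^sub>0 by auto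
    have "Im ((z s\<^sub>0)\<^sup>2 * cis (- a)) \<ge> 0"
      unfolding z(2) by (simp only: power2_eq_square cis_mult) simp
    note mid = \<Lambda>(2)[OF l z(1) this]
    have left: "integral {0..s\<^sub>0} (defect z) \<le> e/4"
      using integral_defect_le[OF z(1) l0, of 0 s\<^sub>0] s\<^sub>0 by simp
    have right: "integral {L - s\<^sub>0..L} (defect z) \<le> e/4"
      using integral_defect_le[OF z(1) l0, of "L - s\<^sub>0" L] s\<^sub>0 by simp
    have "integral {0..s\<^sub>0} (defect z) + integral {s\<^sub>0..L} (defect z) = integral {0..L} (defect z)"
      by (rule integral_defect_combine[OF z(1) l0]) (use s\<^sub>0 in auto)
    moreover have "integral {s\<^sub>0..L - s\<^sub>0} (defect z) + integral {L - s\<^sub>0..L} (defect z) = integral {s\<^sub>0..L} (defect z)"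
      by (rule integral_defect_combine[OF z(1) l0]) (use s\<^sub>0 in auto)
    ultimately have total: "integral {0..L} (defect z) \<le> e" using left mid right by linarith
    have "integral {0..L} (defect z) = L - integral {0..L} (alignment z)"
      using primitiveD(4)[OF primitive_defect[OF z(1) l0], of 0 L] primitiveD(4)[OF primitive_alignment[OF z(1) l0], of 0 L] L_pos
      by simp
    then have "exp (l * (L - e)) \<le> exp (l * integral {0..L} (alignment z))"
      using total l0 by simp
    then have "norm (z 0) * exp (l * (L - e)) \<le> norm (z L)"
      unfolding solution_growth[OF z(1) l0] by (intro mult_left_mono) auto
    also note zL
    finally show "exp (l * (L - e)) \<le> norm (development True l L) + norm (development False l L)"
      using solution_nonzero[OF z(1), of 0] L_pos by (simp add: mult.commute)
  qed
qed

end

section \<open>The limit\<close>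

text \<open>
  The least difference \<open>d > 0\<close> of two elements divides all elements, so \<open>d = 1\<close>; and the semigroup
  generated by \<open>b\<close> and \<open>b + 1\<close> contains all large numbers.
\<close>
lemma numerical_semigroup:
  fixes S :: "nat set"
  assumes add: "\<And>a b. a \<in> S \<Longrightarrow> b \<in> S \<Longrightarrow> a + b \<in> S" and zero: "0 \<in> S"
    and gcd: "\<And>d. d \<ge> 2 \<Longrightarrow> \<exists>k\<in>S. \<not> d dvd k"
  obtains N where "\<And>k. k \<ge> N \<Longrightarrow> k \<in> S"
proof -
  have mult: "a \<in> S \<Longrightarrow> n * a \<in> S" for a n
    by (induction n) (auto intro: add zero)
  obtain p where p: "p \<in> S" "p > 0" using gcd[of 2] by (metis dvd_0_right gr0I le_refl)
  define D where "D = {d. d > 0 \<and> (\<exists>b\<in>S. b + d \<in> S)}"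
  have "p \<in> D" using p zero by (auto simp: D_def intro!: bexI[of _ 0])
  define d where "d = (LEAST d. d \<in> D)"
  have dD: "d \<in> D" unfolding d_def by (rule LeastI[of "\<lambda>d. d \<in> D", OF \<open>p \<in> D\<close>])
  then obtain b where b: "d > 0" "b \<in> S" "b + d \<in> S" by (auto simp: D_def)
  have dmin: "d \<le> x" if "x \<in> D" for x unfolding d_def by (rule Least_le[of "\<lambda>d. d \<in> D", OF that])
  have "d dvd s" if s: "s \<in> S" for s
  proof (rule ccontr)
    assume "\<not> d dvd s"
    then have r: "s mod d > 0" "s mod d < d" using b(1) by (auto simp: dvd_eq_mod_eq_0)
    let ?q = "s div d"
    have "?q * (b + d) + s mod d = s + ?q * b"
      by (simp add: algebra_simps)
    then have "?q * (b + d) + s mod d \<in> S" using add[OF s mult[OF b(2)]] by simp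
    then have "s mod d \<in> D" using r(1) mult[OF b(3)] by (auto simp: D_def)
    then show False using dmin r(2) by fastforce
  qed
  then have "d = 1" using gcd[of d] b(1) by (cases "d \<ge> 2") auto
  then have b1: "b + 1 \<in> S" using b by simp
  show ?thesis
  proof (rule that)
    fix k assume k: "k \<ge> (b + 1) * (b + 1)"
    show "k \<in> S"
    proof (cases "b = 0")
      case True
      then show ?thesis using mult[OF b1, of k] by simp
    next
      case False
      have "k mod b < b" using False by simp
      moreover have "b \<le> k div b"
      proof -
        have "b * b \<le> k" using k by simp
        then show ?thesis using False by (simp add: less_eq_div_iff_mult_less_eq)
      qed
      ultimately have "k mod b \<le> k div b" by linarith
      then have "(k div b - k mod b) * b + (k mod b) * (b + 1) = k"
        by (simp add: algebra_simps diff_mult_distrib flip: add_mult_distrib)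
      then show ?thesis using add[OF mult[OF b(2)] mult[OF b1], of "k div b - k mod b" "k mod b"] by simp
    qed
  qed
qed

text \<open>
  A form of Fekete's lemma.
\<close>
lemma supermultiplicative_eventually:
  fixes s :: "nat \<Rightarrow> real"
  assumes sm: "\<And>n m. s n * s m \<le> s (n + m)" and pos: "\<And>k. k \<ge> N \<Longrightarrow> s k > 0"
    and n: "n > 0" "s n > r ^ n" and r: "0 < r"
  shows "eventually (\<lambda>k. s k > r ^ k) sequentially"
proof -
  have sn: "s n > 0" using less_trans[OF zero_less_power[OF r] n(2)] .
  have pw: "s n ^ q * s k \<le> s (q * n + k)" for q k
  proof (induction q)
    case (Suc q)
    have "s n ^ Suc q * s k = s n * (s n ^ q * s k)" by simp
    also have "\<dots> \<le> s n * s (q * n + k)"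
      using Suc sn by (intro mult_left_mono) auto
    also have "\<dots> \<le> s (n + (q * n + k))" by (rule sm)
    finally show ?case by (simp add: add_ac)
  qed simp
  \<comment> \<open>Write \<open>k = q * n + j\<close> with \<open>j\<close> in one period beyond \<open>N\<close>: the loss \<open>c\<close> from \<open>j\<close> is bounded, the gain \<open>t ^ q\<close> is not.\<close>
  define c where "c = Min ((\<lambda>k. s k / r ^ k) ` {N..<N + n})"
  have fin: "finite ((\<lambda>k. s k / r ^ k) ` {N..<N + n})" "(\<lambda>k. s k / r ^ k) ` {N..<N + n} \<noteq> {}"
    using n(1) by auto
  have c: "c > 0" unfolding c_def using fin pos r by (subst Min_gr_iff) auto
  have cle: "c * r ^ k \<le> s k" if "k \<in> {N..<N + n}" for k
  proof -
    have "c \<le> s k / r ^ k" unfolding c_def using fin that by (intro Min_le) auto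
    then show ?thesis using r by (simp add: pos_le_divide_eq)
  qed
  define t where "t = s n / r ^ n"
  have t: "t > 1" using n r by (simp add: t_def)
  obtain M where M: "1 / c < t ^ M" using real_arch_pow[OF t] by blast
  have "s k > r ^ k" if k: "k \<ge> N + n * M" for k
  proof -
    define q where "q = (k - N) div n"
    define j where "j = N + (k - N) mod n"
    have kq: "k = q * n + j" using k by (simp add: q_def j_def)
    have j: "j \<in> {N..<N + n}" using n(1) by (simp add: j_def)
    have "M \<le> q" unfolding q_def using k n(1) by (simp add: less_eq_div_iff_mult_less_eq mult.commute)
    then have "t ^ M \<le> t ^ q" using t by (intro power_increasing) auto
    then have "1 < c * t ^ q" using M c by (simp add: divide_less_eq mult.commute) (smt (verit) mult_left_mono)
    then have "r ^ k < c * t ^ q * r ^ k" using r by simp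
    also have "\<dots> = s n ^ q * (c * r ^ j)"
      using r by (simp add: kq t_def power_add power_divide power_mult mult.commute[of q n])
    also have "\<dots> \<le> s n ^ q * s j"
      using cle[OF j] sn by (intro mult_left_mono zero_le_power) auto
    also have "\<dots> \<le> s k" unfolding kq by (rule pw)
    finally show ?thesis .
  qed
  then show ?thesis unfolding eventually_sequentially by blast
qed

context angle_path begin

lemma max_word_nonneg: "max_word n \<ge> 0"
proof -
  obtain c where "max_word n = fact n * norm (word_integral c L)" by (rule max_word_obtain)
  then show ?thesis by simp
qed

lemma exists_large_max_word:
  assumes cusps: "strongly_tree_reduced \<beta> L" and r: "0 < r" "r < L"
  shows "\<exists>n>0. max_word n > r ^ n"
proof (rule ccontr)
  assume "\<not> ?thesis"
  then have le: "max_word n \<le> r ^ n" if "n > 0" for n using that by (meson not_less)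
  have A: "fact n * norm (alt n L) \<le> r ^ n" for n
  proof (cases "n = 0")
    case False
    then show ?thesis using le[of n] max_word_ge[of "alternating_word n" n] by simp
  qed simp
  \<comment> \<open>Otherwise the development would grow at most at the rate \<open>r\<close>.\<close>
  define e where "e = (L - r) / 2"
  have e: "e > 0" "L - e > r" using r by (auto simp: e_def field_simps)
  obtain \<Lambda> where \<Lambda>: "\<Lambda> > 0" "\<And>l :: real. l \<ge> \<Lambda> \<Longrightarrow>
     exp (l * (L - e)) \<le> norm (development True l L) + norm (development False l L)"
    using development_growth[OF cusps e(1)] by metis
  have "exp (\<Lambda> * (L - e)) \<le> exp (norm (complex_of_real \<Lambda>) * r)"
    using \<Lambda>(2)[of \<Lambda>] sum_norm_development_le[OF A, of "complex_of_real \<Lambda>"] r by linarith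
  then have "\<Lambda> * (L - e) \<le> \<Lambda> * r" using \<Lambda>(1) by simp
  then show False using \<Lambda>(1) e(2) by simp
qed

text \<open>
  The orders of the nonzero terms have no common divisor \<open>d > 1\<close>: otherwise the development would be invariant
  under multiplication of the parameter by a \<open>d\<close>-th root of unity.
\<close>
lemma exists_nonzero_not_dvd:
  assumes cusps: "strongly_tree_reduced \<beta> L" and d: "d \<ge> 2"
  shows "\<exists>n. max_word n > 0 \<and> \<not> d dvd n"
proof (rule ccontr)
  assume "\<not> ?thesis"
  then have z: "max_word n = 0" if "\<not> d dvd n" for n
    using that max_word_nonneg[of n] by (metis le_less)
  have alt0: "alt n L = 0" if "\<not> d dvd n" for n
    using max_word_ge[of "alternating_word n" n] z[OF that] by (simp add: mult_le_0_iff) (metis fact_gt_zero not_less)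
  define \<omega> where "\<omega> = cis (2 * pi / real d)"
  have \<omega>d: "\<omega> ^ d = 1" unfolding \<omega>_def Complex.DeMoivre using d by simp
  have inv: "development b (\<omega> * \<mu>) L = development b \<mu> L" for b \<mu>
  proof -
    have "development_term b (\<omega> * \<mu>) n L = development_term b \<mu> n L" for n
    proof (cases "d dvd n")
      case True
      then obtain m where "n = d * m" by auto
      then have "\<omega> ^ n = 1" by (simp add: power_mult \<omega>d)
      then show ?thesis by (simp add: development_term_def power_mult_distrib)
    qed (simp add: development_term_def alt0)
    then show ?thesis by (simp add: development_def)
  qed
  show False
  proof (cases "d = 2")
    case True
    have "development False \<mu> L = (\<Sum>n. 0)" for \<mu>
      unfolding development_def
      by (intro suminf_cong) (auto simp: development_term_def alt0 True)
    then have Q: "development False \<mu> L = 0" for \<mu> by simp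
    have P: "norm (development True l L) = 1" for l :: real
      using development_det[of L l] L_pos Q by (simp add: power2_eq_1_iff) (smt (verit) norm_ge_zero)
    obtain \<Lambda> where \<Lambda>: "\<Lambda> > 0" "\<And>l :: real. l \<ge> \<Lambda> \<Longrightarrow>
       exp (l * (L - L/2)) \<le> norm (development True l L) + norm (development False l L)"
      using development_growth[OF cusps, of "L/2"] L_pos by auto
    have "exp (\<Lambda> * (L - L/2)) \<le> 1" using \<Lambda>(2)[of \<Lambda>] by (simp add: P Q)
    then have "\<Lambda> * L \<le> 0" by simp
    then show False using \<Lambda>(1) L_pos by (simp add: mult_le_0_iff)
  next
    case False
    then have d3: "d \<ge> 3" using d by simp
    define k where "k = \<bar>Re \<omega>\<bar>"
    have "k < 1"
    proof -
      have x: "0 < 2 * pi / real d" "2 * pi / real d < pi"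
        using d3 by (auto simp: divide_less_eq)
      have "cos (2 * pi / real d) < cos 0" using x by (intro cos_monotone_0_pi) auto
      moreover have "cos pi < cos (2 * pi / real d)" using x by (intro cos_monotone_0_pi) auto
      ultimately show ?thesis by (simp add: k_def \<omega>_def abs_less_iff)
    qed
    \<comment> \<open>In the direction of \<open>\<omega>\<close> the growth rate is at most \<open>k * L\<close>.  The lower bound on \<open>l\<close> beats the factor 2 that
      comes from comparing the sum of the two moduli with the sum of their squares.\<close>
    define e where "e = L * (1 - k) / 2"
    have e: "e > 0" "L - e > k * L" using \<open>k < 1\<close> L_pos by (auto simp: e_def field_simps)
    obtain \<Lambda> where \<Lambda>: "\<Lambda> > 0" "\<And>l :: real. l \<ge> \<Lambda> \<Longrightarrow>
       exp (l * (L - e)) \<le> norm (development True l L) + norm (development False l L)"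
      using development_growth[OF cusps e(1)] by metis
    define l where "l = max \<Lambda> (1 / (L - e - k * L))"
    have l: "l \<ge> \<Lambda>" "l > 0" "l * (L - e - k * L) \<ge> 1"
      using \<Lambda>(1) e(2) by (auto simp: l_def pos_divide_le_eq[symmetric])
    let ?x = "norm (development True l L)" and ?y = "norm (development False l L)"
    have "?x\<^sup>2 + ?y\<^sup>2 \<le> exp (2 * \<bar>Re (\<omega> * l)\<bar> * L)"
      using development_energy_le[of "\<omega> * l"] by (simp add: inv)
    also have "2 * \<bar>Re (\<omega> * l)\<bar> * L = 2 * (l * (k * L))"
      using l(2) by (simp add: k_def abs_mult)
    finally have up: "?x\<^sup>2 + ?y\<^sup>2 \<le> exp (2 * (l * (k * L)))" .
    have "(exp (l * (L - e)))\<^sup>2 \<le> (?x + ?y)\<^sup>2"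
      using \<Lambda>(2)[OF l(1)] by (intro power_mono) auto
    also have "\<dots> \<le> 2 * (?x\<^sup>2 + ?y\<^sup>2)"
      using sum_squares_bound[of ?x ?y] by (simp add: power2_sum)
    also have "\<dots> \<le> 2 * exp (2 * (l * (k * L)))" using up by simp
    finally have "exp (2 * (l * (L - e))) \<le> 2 * exp (2 * (l * (k * L)))"
      by (simp add: exp_double)
    then have "exp (2 * (l * (L - e)) - 2 * (l * (k * L))) \<le> 2"
      by (simp add: exp_diff divide_le_eq)
    moreover have "1 + (2 * (l * (L - e)) - 2 * (l * (k * L))) \<le> exp (2 * (l * (L - e)) - 2 * (l * (k * L)))"
      by (rule exp_ge_add_one_self)
    moreover have "2 * (l * (L - e)) - 2 * (l * (k * L)) = 2 * (l * (L - e - k * L))"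
      by (simp add: algebra_simps)
    ultimately show False using l(3) by linarith
  qed
qed

lemma max_word_0: "max_word 0 = 1"
  by (simp add: max_word_def)

lemma max_word_eventually_large:
  assumes cusps: "strongly_tree_reduced \<beta> L" and r: "0 < r" "r < L"
  shows "eventually (\<lambda>n. max_word n > r ^ n) sequentially"
proof -
  define S where "S = {n. max_word n > 0}"
  obtain N where N: "\<And>k. k \<ge> N \<Longrightarrow> k \<in> S"
  proof (rule numerical_semigroup[of S])
    fix a b assume "a \<in> S" "b \<in> S"
    then have "0 < max_word a * max_word b" by (simp add: S_def)
    also have "\<dots> \<le> max_word (a + b)" by (rule max_word_supermult)
    finally show "a + b \<in> S" by (simp add: S_def)
  next
    show "0 \<in> S" by (simp add: S_def max_word_0)
  next
    fix d :: nat assume "d \<ge> 2"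
    then show "\<exists>k\<in>S. \<not> d dvd k" using exists_nonzero_not_dvd[OF cusps] by (auto simp: S_def)
  qed blast
  obtain n where "n > 0" "max_word n > r ^ n" using exists_large_max_word[OF cusps r] by blast
  then show ?thesis
    using N r by (intro supermultiplicative_eventually[of max_word N n r] max_word_supermult) (auto simp: S_def)
qed

lemma has_integral_letter_increment:
  fixes \<gamma> :: "real \<Rightarrow> real ^ 2"
  assumes \<gamma>: "\<And>j. primitive L (\<lambda>t. \<gamma> t $ j) (velocity j)" and st: "0 \<le> s" "s \<le> t" "t \<le> L"
  shows "((letter True) has_integral Complex (\<gamma> t $ 1 - \<gamma> s $ 1) (\<gamma> t $ 2 - \<gamma> s $ 2)) {s..t}"
proof -
  have "((\<lambda>r. complex_of_real (velocity 1 r) + \<i> * complex_of_real (velocity 2 r)) has_integral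
     complex_of_real (\<gamma> t $ 1 - \<gamma> s $ 1) + \<i> * complex_of_real (\<gamma> t $ 2 - \<gamma> s $ 2)) {s..t}"
    using primitiveD(3)[OF \<gamma> st]
    by (intro has_integral_add has_integral_mult_right has_integral_of_real)
  moreover have "complex_of_real (velocity 1 r) + \<i> * complex_of_real (velocity 2 r) = letter True r" for r
    by (simp add: velocity_def letter_def complex_eq_iff)
  moreover have "complex_of_real a + \<i> * complex_of_real b = Complex a b" for a b
    by (simp add: complex_eq_iff)
  ultimately show ?thesis by (simp only:)
qed

lemma norm_vec2: "norm (v :: real ^ 2) = norm (Complex (v $ 1) (v $ 2))"
  by (simp add: norm_vec_def L2_set_def sum_2 cmod_def)

lemma path_increment_le:
  fixes \<gamma> :: "real \<Rightarrow> real ^ 2"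
  assumes \<gamma>: "\<And>j. primitive L (\<lambda>t. \<gamma> t $ j) (velocity j)" and st: "0 \<le> s" "s \<le> t" "t \<le> L"
  shows "norm (\<gamma> t - \<gamma> s) \<le> t - s"
proof -
  have "norm (\<gamma> t - \<gamma> s) = norm (integral {s..t} (letter True))"
    using integral_unique[OF has_integral_letter_increment[OF \<gamma> st]] by (simp add: norm_vec2)
  also have "\<dots> \<le> 1 * (t - s)"
    by (rule bounded_measurable_norm_le[OF letter_measurable _ st]) simp
  finally show ?thesis by simp
qed

lemma path_length_eq:
  fixes \<gamma> :: "real \<Rightarrow> real ^ 2"
  assumes \<gamma>: "\<And>j. primitive L (\<lambda>t. \<gamma> t $ j) (velocity j)"
  shows "path_length \<gamma> 0 L = L"
proof -
  let ?V = "\<lambda>d. \<Sum>k\<in>d. norm (\<gamma> (Sup k) - \<gamma> (Inf k))"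
  let ?S = "{?V d | d. d division_of {0..L}}"
  have up: "?V d \<le> L" if d: "d division_of {0..L}" for d
  proof -
    have "?V d \<le> (\<Sum>k\<in>d. measure lborel k)"
    proof (rule sum_mono)
      fix k assume k: "k \<in> d"
      then obtain a b where ab: "k = {a..b}" "{a..b} \<subseteq> {0..L}" "{a..b} \<noteq> {}"
        using division_ofD(2,3,4)[OF d] by (metis cbox_interval)
      then have "0 \<le> a" "a \<le> b" "b \<le> L" by auto
      then show "norm (\<gamma> (Sup k) - \<gamma> (Inf k)) \<le> measure lborel k"
        using path_increment_le[OF \<gamma>, of a b] ab by simp
    qed
    also have "\<dots> = L" using additive_content_division[of d 0 L] d L_pos by simp
    finally show ?thesis .
  qed
  have triv: "{{0..L}} division_of {0..L}" using L_pos division_of_self[of 0 L] by simp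
  have "Sup ?S \<le> L" by (rule cSup_least) (use triv up in blast)+
  \<comment> \<open>A uniform partition suffices on which the velocity is almost constant: each increment is tested against this constant.\<close>
  moreover have "L \<le> Sup ?S"
  proof (rule field_le_epsilon)
    fix e :: real assume e: "e > 0"
    obtain K :: nat and v where K: "K > 0" and v: "\<And>i. norm (v i) \<le> 1" and step:
      "(\<Sum>i<K. integral {L * real i / real K..L * real (Suc i) / real K} (\<lambda>t. norm (letter True t - v i))) \<le> e"
      using step_approximation[OF e] by auto
    let ?a = "\<lambda>i. L * real i / real K"
    have lt: "?a i < ?a j \<longleftrightarrow> i < j" for i j using L_pos K by (simp add: divide_less_cancel)
    have le: "?a i \<le> ?a j \<longleftrightarrow> i \<le> j" for i j using lt[of j i] by (meson not_less)
    have aK: "?a K = L" using K by simp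
    have sub: "0 \<le> ?a i" "?a i \<le> ?a (Suc i)" "?a (Suc i) \<le> L" "?a (Suc i) - ?a i = L / real K" if "i < K" for i
    proof -
      show "0 \<le> ?a i" using L_pos by simp
      show "?a i \<le> ?a (Suc i)" using le[of i "Suc i"] by (simp del: of_nat_Suc)
      show "?a (Suc i) \<le> L" using le[of "Suc i" K] that unfolding aK by (simp del: of_nat_Suc)
      show "?a (Suc i) - ?a i = L / real K" by (simp add: field_simps add_divide_distrib)
    qed
    define d where "d = (\<lambda>i. {?a i..?a (Suc i)}) ` {..<K}"
    have inj: "inj_on (\<lambda>i. {?a i..?a (Suc i)}) {..<K}"
    proof (rule inj_onI)
      fix i j assume ij: "i \<in> {..<K}" "j \<in> {..<K}" and eq: "{?a i..?a (Suc i)} = {?a j..?a (Suc j)}"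
      have "Inf {?a i..?a (Suc i)} = Inf {?a j..?a (Suc j)}" unfolding eq ..
      then have "?a i = ?a j" using sub(2)[of i] sub(2)[of j] ij by (simp del: of_nat_Suc)
      then show "i = j" using L_pos K by simp
    qed
    have dd: "d division_of {0..L}"
    proof (rule division_ofI)
      show "finite d" by (simp add: d_def)
      fix k assume "k \<in> d"
      then obtain i where i: "i < K" "k = {?a i..?a (Suc i)}" by (auto simp: d_def)
      show "k \<subseteq> {0..L}" "k \<noteq> {}" "\<exists>a b. k = cbox a b"
        using i sub[OF i(1)] by (auto simp del: of_nat_Suc)
      fix k' assume "k' \<in> d" "k \<noteq> k'"
      then obtain j where j: "j < K" "k' = {?a j..?a (Suc j)}" "i \<noteq> j" using i by (auto simp: d_def)
      have "?a (Suc i) \<le> ?a j \<or> ?a (Suc j) \<le> ?a i"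
        unfolding le using j(3) by linarith
      then show "interior k \<inter> interior k' = {}"
        unfolding i(2) j(2) interior_atLeastAtMost_real by auto
    next
      show "\<Union> d = {0..L}"
      proof
        show "\<Union> d \<subseteq> {0..L}"
        proof
          fix x assume "x \<in> \<Union> d"
          then obtain i where "i < K" "x \<in> {?a i..?a (Suc i)}" unfolding d_def by blast
          then show "x \<in> {0..L}" using sub(1,3)[of i] unfolding atLeastAtMost_iff by linarith
        qed
        have "{0..?a k} \<subseteq> (\<Union>i<k. {?a i..?a (Suc i)})" if "k > 0" for k
          using that
        proof (induction k)
          case (Suc k)
          show ?case
          proof (cases "k = 0")
            case False
            have "{0..?a (Suc k)} \<subseteq> {0..?a k} \<union> {?a k..?a (Suc k)}" by auto
            then show ?thesis using Suc.IH False by (auto simp: lessThan_Suc simp del: of_nat_Suc)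
          qed (simp add: lessThan_Suc)
        qed simp
        from this[OF K] show "{0..L} \<subseteq> \<Union> d" unfolding aK by (simp add: d_def)
      qed
    qed
    have each: "L / real K - integral {?a i..?a (Suc i)} (\<lambda>t. norm (letter True t - v i)) \<le> norm (\<gamma> (?a (Suc i)) - \<gamma> (?a i))"
      if i: "i < K" for i
    proof -
      note s = sub[OF i]
      let ?D = "Complex (\<gamma> (?a (Suc i)) $ 1 - \<gamma> (?a i) $ 1) (\<gamma> (?a (Suc i)) $ 2 - \<gamma> (?a i) $ 2)"
      have hN: "((\<lambda>t. norm (letter True t - v i)) has_integral integral {?a i..?a (Suc i)} (\<lambda>t. norm (letter True t - v i))) {?a i..?a (Suc i)}"
        by (intro integrable_integral norm_letter_diff_integrable) (use s in auto)
      have hD: "((\<lambda>t. Re (letter True t * cnj (v i))) has_integral Re (?D * cnj (v i))) {?a i..?a (Suc i)}"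
        using has_integral_linear[OF has_integral_mult_left[OF has_integral_letter_increment[OF \<gamma> s(1-3)], of "cnj (v i)"] bounded_linear_Re]
        by (simp add: o_def)
      have h1: "((\<lambda>_. 1) has_integral L / real K) {?a i..?a (Suc i)}"
        using has_integral_const_real[of "1::real" "?a i" "?a (Suc i)"] s by (simp del: of_nat_Suc)
      have "L / real K - integral {?a i..?a (Suc i)} (\<lambda>t. norm (letter True t - v i)) \<le> Re (?D * cnj (v i))"
      proof (rule has_integral_le[OF has_integral_diff[OF h1 hN] hD])
        fix t
        have ww: "letter True t * cnj (letter True t) = 1" by (simp add: complex_norm_square[symmetric])
        have "1 = Re (letter True t * cnj (letter True t))" unfolding ww by simp
        also have "\<dots> = Re (letter True t * cnj (letter True t - v i)) + Re (letter True t * cnj (v i))"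
          by (simp add: algebra_simps)
        also have "Re (letter True t * cnj (letter True t - v i)) \<le> norm (letter True t) * norm (letter True t - v i)"
          using complex_Re_le_cmod[of "letter True t * cnj (letter True t - v i)"] by (simp only: norm_mult complex_mod_cnj)
        finally show "1 - norm (letter True t - v i) \<le> Re (letter True t * cnj (v i))" by simp
      qed
      also have "\<dots> \<le> norm ?D * norm (v i)"
        using complex_Re_le_cmod[of "?D * cnj (v i)"] by (simp only: norm_mult complex_mod_cnj)
      also have "\<dots> \<le> norm ?D" using v[of i] by (intro mult_right_le_one_le) auto
      also have "norm ?D = norm (\<gamma> (?a (Suc i)) - \<gamma> (?a i))" by (simp add: norm_vec2)
      finally show ?thesis .
    qed
    have "L - e \<le> (\<Sum>i<K. L / real K - integral {?a i..?a (Suc i)} (\<lambda>t. norm (letter True t - v i)))"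
      using step K by (simp add: sum_subtractf)
    also have "\<dots> \<le> (\<Sum>i<K. norm (\<gamma> (?a (Suc i)) - \<gamma> (?a i)))"
      using each by (intro sum_mono) auto
    also have "\<dots> = ?V d"
      unfolding d_def sum.reindex[OF inj] o_def using sub(2) by (intro sum.cong) (auto simp del: of_nat_Suc)
    also have "\<dots> \<le> Sup ?S"
      by (rule cSup_upper) (use dd up in \<open>auto simp: bdd_above_def\<close>)
    finally show "L \<le> Sup ?S + e" by simp
  qed
  ultimately show ?thesis unfolding path_length_def by simp
qed

theorem length_eq_limit:
  fixes \<gamma> :: "real \<Rightarrow> real ^ 2"
  assumes cusps: "strongly_tree_reduced \<beta> L" and \<gamma>: "\<And>j. primitive L (\<lambda>t. \<gamma> t $ j) (velocity j)"
  shows "(\<lambda>n. root n (projective_norm n (\<lambda>I. fact n * iterated_integral \<gamma> n L I))) \<longlonglongrightarrow> path_length \<gamma> 0 L"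
  unfolding path_length_eq[OF \<gamma>]
proof (rule order_tendstoI)
  let ?p = "\<lambda>n. projective_norm n (\<lambda>I. fact n * iterated_integral \<gamma> n L I)"
  fix r assume r: "r < L"
  define r' where "r' = max r (L / 2)"
  have r': "0 < r'" "r' < L" "r \<le> r'" using r L_pos by (auto simp: r'_def)
  from max_word_eventually_large[OF cusps r'(1,2)] eventually_gt_at_top[of 0]
  show "\<forall>\<^sub>F n in sequentially. r < root n (?p n)"
  proof eventually_elim
    case (elim n)
    then have "r' ^ n < ?p n" using max_word_le_projective_norm[OF \<gamma>, of n] by linarith
    then have "root n (r' ^ n) < root n (?p n)" using elim by (intro real_root_less_mono)
    then show ?case using elim r' by (simp add: real_root_power_cancel)
  qed
next
  let ?p = "\<lambda>n. projective_norm n (\<lambda>I. fact n * iterated_integral \<gamma> n L I)"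
  fix r assume r: "L < r"
  from eventually_gt_at_top[of 0]
  show "\<forall>\<^sub>F n in sequentially. root n (?p n) < r"
  proof eventually_elim
    case (elim n)
    have "root n (?p n) \<le> root n (L ^ n)"
      using elim by (intro real_root_le_mono projective_norm_le_power[OF \<gamma> path_increment_le[OF \<gamma>]])
    then show ?case using elim r L_pos by (simp add: real_root_power_cancel)
  qed
qed

end

theorem theorem2p1:
  fixes L x0 y0 :: real and \<beta> :: "real \<Rightarrow> real" and \<gamma> :: "real \<Rightarrow> real ^ 2"
  assumes "L > 0"
    and "\<beta> \<in> borel_measurable (lebesgue_on {0..L})"
    and "\<And>t. t \<in> {0..L} \<Longrightarrow>
           \<gamma> t = vector [x0 + (LINT s:{0..t}|lebesgue. cos (\<beta> s)),
                         y0 + (LINT s:{0..t}|lebesgue. sin (\<beta> s))]"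
    and "strongly_tree_reduced \<beta> L"
  shows "(\<lambda>n. root n (projective_norm n (\<lambda>I. fact n * iterated_integral \<gamma> n L I)))
           \<longlonglongrightarrow> path_length \<gamma> 0 L"
proof -
  interpret angle_path L \<beta> using assms(1,2) by unfold_locales
  have m: "velocity j \<in> borel_measurable (lebesgue_on {0..L})" for j
    using assms(2) unfolding velocity_def by (cases "j = 1") simp_all
  have b: "bounded (velocity j ` {0..L})" for j
    unfolding bounded_iff velocity_def by (auto intro!: exI[of _ 1])
  have i: "(LINT s:{0..t}|lebesgue. velocity j s) = integral {0..t} (velocity j)" if "t \<in> {0..L}" for t j
    using bounded_measurable_absolutely_integrable[OF m b, of 0 t] that
    by (intro set_lebesgue_integral_eq_integral(2)) auto
  have \<gamma>: "\<gamma> t $ j = (if j = 1 then x0 else y0) + integral {0..t} (velocity j)" if "t \<in> {0..L}" for t j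
    using i[OF that, of j] assms(3)[OF that] exhaust_2[of j]
    by (auto simp: velocity_def vector_2)
  have "primitive L (\<lambda>t. \<gamma> t $ j) (velocity j)" for j
  proof (rule primitive_integralI[OF m b])
    fix t assume "t \<in> {0..L}"
    then show "\<gamma> t $ j = \<gamma> 0 $ j + integral {0..t} (velocity j)"
      using \<gamma>[of t j] \<gamma>[of 0 j] assms(1) by simp
  qed
  then show ?thesis by (rule length_eq_limit[OF assms(4)])
qed

end
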